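(* For a generic Gough-Stewart platform, the hypersurface $\mathrm{Sing}\subset \mathrm{SE}(3)$ of singular configurations is rational over $\mathbb{R}$, i.e. it is birationally equivalent over $\mathbb{R}$ to affine space $\mathbb{A}^5_{\mathbb{R}}$.
   Context: A (6-UPS) Gough-Stewart platform (its architecture) is given by vectors $A_1,\dots,A_6\in\mathbb{R}^3$ (joint centers on the base, in the fixed frame) and $b_1,\dots,b_6\in\mathbb{R}^3$ (joint centers on the platform, in the mobile frame). A configuration is an element $(R,P)\in \mathrm{SE}(3)$, with $R\in \mathrm{SO}(3)$ a rotation matrix and $P=(x,y,z)^{\mathsf T}$ a translation vector, acting by $X\mapsto RX+P$. Put $B_i=Rb_i$ and $C_i=B_i-A_i$. Let $\mathrm{Jac}$ be the $6\times 6$ matrix whose $i$-th row is $\big((C_i+P)^{\mathsf T},\,(A_i\times(C_i+P))^{\mathsf T}\big)$, i.e. the Plücker coordinates of the $i$-th limb. $\mathrm{Sing}\subset \mathrm{SE}(3)$ is the algebraic hypersurface over $\mathbb{R}$ with equation $\det(\mathrm{Jac})=0$. "For a generic Gough-Stewart platform" means: for all architectures $(A_i,b_i)_{i}$ in some nonempty Zariski open subset of the real parameter space of architectures. One may choose the frames so that $A_1=b_1=0$. *)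

theory Defs
  imports "HOL-Analysis.Analysis"
begin

section \<open>Algebraic varieties over the reals\<close>

text \<open>
  An affine variety over the field of real numbers is represented by its set of complex points in
  \<^typ>\<open>complex^'n\<close>, cut out by polynomials with real coefficients. Real points alone would not
  determine the variety. The Zariski topology used below is the one whose closed sets are
  defined over the reals.
\<close>

inductive poly_over_reals :: "(complex^'n \<Rightarrow> complex) \<Rightarrow> bool" where
  const: "poly_over_reals (\<lambda>x. complex_of_real c)"
| coord: "poly_over_reals (\<lambda>x. x $ i)"
| add: "poly_over_reals p \<Longrightarrow> poly_over_reals q \<Longrightarrow> poly_over_reals (\<lambda>x. p x + q x)"
| mult: "poly_over_reals p \<Longrightarrow> poly_over_reals q \<Longrightarrow> poly_over_reals (\<lambda>x. p x * q x)"

definition zariski_closed :: "(complex^'n) set \<Rightarrow> bool" where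
  "zariski_closed Z \<longleftrightarrow> (\<exists>F. (\<forall>f\<in>F. poly_over_reals f) \<and> Z = {x. \<forall>f\<in>F. f x = 0})"

definition zariski_open_in :: "(complex^'n) set \<Rightarrow> (complex^'n) set \<Rightarrow> bool" where
  "zariski_open_in X U \<longleftrightarrow> (\<exists>Z. zariski_closed Z \<and> U = X - Z)"

definition zariski_dense_in :: "(complex^'n) set \<Rightarrow> (complex^'n) set \<Rightarrow> bool" where
  "zariski_dense_in X U \<longleftrightarrow> U \<subseteq> X \<and> (\<forall>Z. zariski_closed Z \<and> U \<subseteq> Z \<longrightarrow> X \<subseteq> Z)"

text \<open>
  A regular function on \<open>U\<close> is locally a quotient of polynomials. It is enough to take
  as neighbourhoods the sets on which the denominator does not vanish, since numerator and
  denominator may be multiplied by a further polynomial to shrink the neighbourhood.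
\<close>

definition regular_function_on :: "(complex^'n) set \<Rightarrow> (complex^'n \<Rightarrow> complex) \<Rightarrow> bool" where
  "regular_function_on U f \<longleftrightarrow>
     (\<forall>x\<in>U. \<exists>p q. poly_over_reals p \<and> poly_over_reals q \<and> q x \<noteq> 0 \<and>
        (\<forall>y\<in>U. q y \<noteq> 0 \<longrightarrow> f y = p y / q y))"

definition regular_map_on :: "(complex^'n) set \<Rightarrow> (complex^'n \<Rightarrow> complex^'m) \<Rightarrow> bool" where
  "regular_map_on U f \<longleftrightarrow> (\<forall>i. regular_function_on U (\<lambda>x. f x $ i))"

definition isomorphic_over_reals :: "(complex^'n) set \<Rightarrow> (complex^'m) set \<Rightarrow> bool" where
  "isomorphic_over_reals U V \<longleftrightarrow>
     (\<exists>f g. regular_map_on U f \<and> regular_map_on V g \<and>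
        f ` U \<subseteq> V \<and> g ` V \<subseteq> U \<and> (\<forall>x\<in>U. g (f x) = x) \<and> (\<forall>y\<in>V. f (g y) = y))"

text \<open>
  Irreducibility is not presupposed: the open sets are required to be dense, so a variety
  birationally equivalent to an irreducible one is itself irreducible.
\<close>

definition birational_over_reals :: "(complex^'n) set \<Rightarrow> (complex^'m) set \<Rightarrow> bool" where
  "birational_over_reals X Y \<longleftrightarrow>
     (\<exists>U V. zariski_open_in X U \<and> zariski_dense_in X U \<and>
        zariski_open_in Y V \<and> zariski_dense_in Y V \<and> isomorphic_over_reals U V)"


section \<open>Gough-Stewart platforms\<close>

text \<open>An architecture is a pair \<open>(A, b)\<close> of six base points and six platform points.\<close>

type_synonym architecture = "((real^3)^6) \<times> ((real^3)^6)"

definition zariski_open_architectures :: "architecture set \<Rightarrow> bool" where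
  "zariski_open_architectures W \<longleftrightarrow>
     (\<exists>F. (\<forall>f\<in>F. real_polynomial_function f) \<and> W = {a. \<exists>f\<in>F. f a \<noteq> 0})"

definition complex_vec :: "real^'n \<Rightarrow> complex^'n" where
  "complex_vec v = (\<chi> i. complex_of_real (v $ i))"

text \<open>The formula of \<^const>\<open>cross3\<close>, which is available for real vectors only.\<close>

definition complex_cross3 :: "complex^3 \<Rightarrow> complex^3 \<Rightarrow> complex^3" where
  "complex_cross3 a b =
     vector [a$2 * b$3 - a$3 * b$2, a$3 * b$1 - a$1 * b$3, a$1 * b$2 - a$2 * b$1]"

definition limb :: "architecture \<Rightarrow> complex^3^3 \<Rightarrow> complex^3 \<Rightarrow> 6 \<Rightarrow> complex^3" where
  "limb a R P i = (R *v complex_vec (snd a $ i) - complex_vec (fst a $ i)) + P"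

definition Jac :: "architecture \<Rightarrow> complex^3^3 \<Rightarrow> complex^3 \<Rightarrow> complex^6^6" where
  "Jac a R P = (\<chi> i.
     let l = limb a R P i; m = complex_cross3 (complex_vec (fst a $ i)) l
     in vector [l$1, l$2, l$3, m$1, m$2, m$3])"

text \<open>
  Affine 12-space with coordinates the nine entries of \<open>R\<close> (index \<open>Inl (i, j)\<close>) and the three
  entries of \<open>P\<close> (index \<open>Inr i\<close>).
\<close>

type_synonym config = "complex^((3 \<times> 3) + 3)"

definition rot :: "config \<Rightarrow> complex^3^3" where
  "rot X = (\<chi> i j. X $ Inl (i, j))"

definition transl :: "config \<Rightarrow> complex^3" where
  "transl X = (\<chi> i. X $ Inr i)"

definition SE3 :: "config set" where
  "SE3 = {X. orthogonal_matrix (rot X) \<and> det (rot X) = 1}"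

definition Sing :: "architecture \<Rightarrow> config set" where
  "Sing a = {X \<in> SE3. det (Jac a (rot X) (transl X)) = 0}"

end

(*
  A configuration is singular iff some nonzero screw (u, w) is reciprocal to all six limbs. Move the
  origins of both frames to the first joint centers and put T = P x w. The conditions become
  P.u = 0 together with five equations that are linear in (u, T). Added to T.w = 0 they are six linear
  equations in the six unknowns (u, T) for given R and w; and (u, T, w) determines
  P = (u x T) / (u.w). So Sing is parametrized by the rotation (Cayley coordinates) and the direction
  [w] in the projective plane. The inverse reads w off the cofactors of Jac.

  The substance is that the image is dense in all of Sing. By continuity of roots, Sing, as a
  hypersurface in a chart of SE(3), is nowhere locally contained in a set on which any five of the
  six chart coordinates are algebraically dependent. The configurations reciprocal to a screw of
  pitch zero (u.w = 0: all limbs meet a common line) form such a set for generic architectures: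
  together with the architecture they are images of a 40-dimensional affine space, while 36 + 5
  coordinates are at our disposal. Away from them the kernel of Jac is one-dimensional, and a
  perturbation of (R, w) on the quadric T.w = 0 reaches the image of the parametrization.
*)

theory Submission
  imports Defs "HOL-Complex_Analysis.Conformal_Mappings"
begin

section \<open>Algebras of functions over the reals\<close>

text \<open>In the unknowns x = R^T u and y = T - u the five limb equations have a coefficient
  matrix that depends on the architecture alone. Its kernel is spanned by the vector (p, r) of
  maximal minors, so for given (R, w) the solutions form a line with parameter t, and T.w = 0
  becomes c + t g = 0 with g = w.(R p + r). This equation is linear in t, hence rationality over the
  reals. Sing is not known beforehand to be irreducible, so a component could escape the
  parametrization. On the hypersurface c + t g = 0 the danger is that g divides c, which would make
  g = 0 a component of its own. A direction with g = 0 and c nonzero at the identity rotation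
  excludes this, and such a direction exists for a generic architecture. All approximations are
  Euclidean, on complex points, and use one device: leave a zero of a polynomial by a small
  perturbation, then return to the zero set along a line. Whatever does not change along that line
  keeps what the perturbation gained. Complex points are essential here, since real zeros may
  disappear under perturbation.\<close>

locale real_function_algebra =
  fixes S :: "('x \<Rightarrow> complex) set"
  assumes const_mem: "(\<lambda>x. complex_of_real c) \<in> S"
    and add_mem: "f \<in> S \<Longrightarrow> g \<in> S \<Longrightarrow> (\<lambda>x. f x + g x) \<in> S"
    and mult_mem: "f \<in> S \<Longrightarrow> g \<in> S \<Longrightarrow> (\<lambda>x. f x * g x) \<in> S"
begin

lemma zero_mem: "(\<lambda>x. 0) \<in> S" and one_mem: "(\<lambda>x. 1) \<in> S"
  using const_mem[of 0] const_mem[of 1] by simp_all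

lemma numeral_mem: "(\<lambda>x. numeral n) \<in> S"
  using const_mem[of "numeral n"] by simp

lemma uminus_mem: "f \<in> S \<Longrightarrow> (\<lambda>x. - f x) \<in> S"
  using mult_mem[OF const_mem[of "-1"], of f] by simp

lemma diff_mem: "f \<in> S \<Longrightarrow> g \<in> S \<Longrightarrow> (\<lambda>x. f x - g x) \<in> S"
  using add_mem[OF _ uminus_mem, of f g] by simp

lemma power_mem: "f \<in> S \<Longrightarrow> (\<lambda>x. f x ^ n) \<in> S"
  by (induction n) (auto intro: mult_mem one_mem)

lemma sum_mem: "(\<And>i. i \<in> I \<Longrightarrow> f i \<in> S) \<Longrightarrow> (\<lambda>x. \<Sum>i\<in>I. f i x) \<in> S"
  by (induction I rule: infinite_finite_induct) (auto intro: add_mem zero_mem)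

lemma prod_mem: "(\<And>i. i \<in> I \<Longrightarrow> f i \<in> S) \<Longrightarrow> (\<lambda>x. \<Prod>i\<in>I. f i x) \<in> S"
  by (induction I rule: infinite_finite_induct) (auto intro: mult_mem one_mem)

lemma det_mem: "(\<And>i j. (\<lambda>x. M x $ i $ j) \<in> S) \<Longrightarrow> (\<lambda>x. det (M x :: complex^'n^'n)) \<in> S"
  unfolding det_def
proof (intro sum_mem mult_mem prod_mem)
  show "(\<lambda>x. of_int (sign p)) \<in> S" for p :: "'n \<Rightarrow> 'n"
    using const_mem[of "real_of_int (sign p)"] by simp
qed

lemma poly_compose_mem:
  assumes "poly_over_reals h" "\<And>j. (\<lambda>x. g x $ j) \<in> S"
  shows "(\<lambda>x. h (g x)) \<in> S"
  using assms(1) by induction (auto intro: assms(2) const_mem add_mem mult_mem)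

lemmas mem_intros = const_mem zero_mem one_mem numeral_mem add_mem uminus_mem diff_mem
  mult_mem power_mem sum_mem prod_mem

end

text \<open>The same closure lemmas serve again for polynomials in the architecture and for
  fractions whose denominator is a power of a fixed polynomial.\<close>

global_interpretation poly: real_function_algebra "{f. poly_over_reals f}"
  rewrites "\<And>f :: complex^'n \<Rightarrow> complex. f \<in> {f. poly_over_reals f} \<longleftrightarrow> poly_over_reals f"
  by unfold_locales (auto intro: poly_over_reals.intros)

section \<open>Polynomial functions in several complex variables\<close>

lemma continuous_on_poly_over_reals:
  "poly_over_reals f \<Longrightarrow> continuous_on A f"
  by (induction rule: poly_over_reals.induct) (auto intro!: continuous_intros)

text \<open>Restriction to a complex line reduces several variables to one, where a nonzero
  polynomial has finitely many roots. Base point and direction are complex, so the coefficients of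
  \<open>p\<close> need not be real.\<close>

lemma poly_over_reals_line:
  assumes "poly_over_reals f"
  shows "\<exists>p. \<forall>t. f (x + t *s v) = poly p t"
  using assms
proof induction
  case (const c)
  show ?case by (intro exI[of _ "[:complex_of_real c:]"]) simp
next
  case (coord i)
  show ?case by (intro exI[of _ "[:x $ i, v $ i:]"]) (simp add: mult.commute)
next
  case (add p q)
  then show ?case by (metis poly_add)
next
  case (mult p q)
  then show ?case by (metis poly_mult)
qed

lemma poly_nonzero_frequently:
  fixes p :: "complex poly"
  assumes "poly p t \<noteq> 0" "\<epsilon> > 0"
  shows "\<exists>s. 0 < norm s \<and> norm s < \<epsilon> \<and> poly p s \<noteq> 0"
proof -
  have "finite {s. poly p s = 0}"
    using assms by (intro poly_roots_finite) auto
  moreover have "infinite (of_real ` {0<..<\<epsilon>} :: complex set)"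
    using assms by (subst finite_image_iff) (auto simp: inj_on_def)
  ultimately obtain s where "s \<in> of_real ` {0<..<\<epsilon>}" "poly p s \<noteq> 0"
    by (metis (mono_tags, lifting) finite_subset mem_Collect_eq subsetI)
  then show ?thesis by (intro exI[of _ s]) auto
qed

lemma norm_vec_smult: "norm (t *s (v :: complex^'n)) = norm t * norm v"
  by (simp add: norm_vec_def vector_scalar_mult_def norm_mult L2_set_right_distrib)

text \<open>On the line from \<open>z0\<close> to \<open>x\<close> the zeros of \<open>f\<close> are
  finite in number, so nonzeros accumulate at \<open>z0\<close>.\<close>

lemma poly_over_reals_nonzero_near:
  assumes "poly_over_reals f" "f x \<noteq> 0" "\<epsilon> > 0"
  shows "\<exists>z. dist z z0 < \<epsilon> \<and> f z \<noteq> 0"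
proof -
  obtain p where p: "\<And>t. f (z0 + t *s (x - z0)) = poly p t"
    using poly_over_reals_line[OF assms(1)] by blast
  have "poly p 1 \<noteq> 0" using p[of 1] assms(2) by simp
  moreover have "\<epsilon> / (norm (x - z0) + 1) > 0" using assms(3) by (simp add: add_nonneg_pos)
  ultimately obtain s where s: "norm s < \<epsilon> / (norm (x - z0) + 1)" "poly p s \<noteq> 0"
    using poly_nonzero_frequently by blast
  have "norm s * norm (x - z0) \<le> norm s * (norm (x - z0) + 1)"
    by (simp add: mult_left_mono)
  also have "\<dots> < \<epsilon>" using s(1) by (simp add: pos_less_divide_eq add_nonneg_pos)
  finally have "dist (z0 + s *s (x - z0)) z0 < \<epsilon>"
    by (simp add: dist_norm norm_vec_smult del: vector_ssub_ldistrib)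
  then show ?thesis using s(2) p by metis
qed

text \<open>The integral domain property, from topology: \<open>f\<close> stays nonzero on a ball,
  and \<open>g\<close> cannot vanish on a whole ball.\<close>

lemma poly_over_reals_mult_nonzero:
  assumes "poly_over_reals f" "poly_over_reals g" "f x \<noteq> 0" "g y \<noteq> 0"
  shows "\<exists>z. f z * g z \<noteq> 0"
proof -
  have "continuous_on UNIV f" using assms(1) by (rule continuous_on_poly_over_reals)
  then have "open {z. f z \<noteq> 0}"
    by (intro open_Collect_neq) auto
  then obtain \<epsilon> where "\<epsilon> > 0" "ball x \<epsilon> \<subseteq> {z. f z \<noteq> 0}"
    using assms(3) open_contains_ball by blast
  moreover then obtain z where "dist z x < \<epsilon>" "g z \<noteq> 0"
    using poly_over_reals_nonzero_near[OF assms(2,4)] by blast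
  ultimately show ?thesis by (auto simp: dist_commute subset_iff)
qed

lemma poly_over_reals_prod_nonzero:
  assumes "finite I" "\<And>i. i \<in> I \<Longrightarrow> poly_over_reals (f i)" "\<And>i. i \<in> I \<Longrightarrow> \<exists>x. f i x \<noteq> 0"
  shows "\<exists>z. (\<Prod>i\<in>I. f i z) \<noteq> 0"
  using assms
proof (induction I rule: finite_induct)
  case (insert i I)
  obtain x where "f i x \<noteq> 0" using insert.prems(2) by blast
  moreover have "\<exists>y. (\<Prod>i\<in>I. f i y) \<noteq> 0"
    using insert.prems by (intro insert.IH) auto
  then obtain y where "(\<Prod>i\<in>I. f i y) \<noteq> 0" by blast
  moreover have "poly_over_reals (\<lambda>z. \<Prod>i\<in>I. f i z)" "poly_over_reals (f i)"
    using insert.prems(1) by (auto intro: poly.prod_mem)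
  ultimately obtain z where "f i z * (\<Prod>i\<in>I. f i z) \<noteq> 0"
    using poly_over_reals_mult_nonzero by blast
  then show ?case using insert.hyps by (intro exI[of _ z]) simp
qed auto

text \<open>Through this, density in the Euclidean topology of the complex points yields Zariski
  density.\<close>

lemma zariski_closed_imp_closed: "zariski_closed Z \<Longrightarrow> closed Z"
proof -
  assume "zariski_closed Z"
  then obtain F where F: "\<And>f. f \<in> F \<Longrightarrow> poly_over_reals f" "Z = {x. \<forall>f\<in>F. f x = 0}"
    unfolding zariski_closed_def by blast
  have "Z = (\<Inter>f\<in>F. {x. f x = 0})" using F(2) by auto
  moreover have "closed {x. f x = 0}" if "f \<in> F" for f
    by (intro closed_Collect_eq continuous_on_const continuous_on_poly_over_reals[OF F(1)[OF that]])
  ultimately show ?thesis by auto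
qed

section \<open>Continuity of roots\<close>

text \<open>Let \<open>m\<close> be the minimum on a small circle of the restriction to the line
  through \<open>z0\<close>. If the restriction at a nearby \<open>z\<close> had no zero in the
  disc, its reciprocal would be holomorphic there and at most 2/m on the circle, yet larger than 2/m
  at the centre, against the maximum modulus principle. The hypothesis on \<open>t\<close> keeps the
  restriction at \<open>z0\<close> from being identically zero.\<close>

lemma root_near:
  assumes f: "poly_over_reals f" and z0: "f z0 = 0" and t: "f (z0 + t *s d) \<noteq> 0" and \<epsilon>: "\<epsilon> > 0"
  shows "\<exists>\<eta>>0. \<forall>z. dist z z0 < \<eta> \<longrightarrow> (\<exists>t. norm t < \<epsilon> \<and> f (z + t *s d) = 0)"
proof -
  obtain p where p: "\<And>t. f (z0 + t *s d) = poly p t"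
    using poly_over_reals_line[OF f] by blast
  have "p \<noteq> 0" using t p by auto
  then have "finite (norm ` {s. poly p s = 0})" by (simp add: poly_roots_finite)
  moreover have "infinite {0<..<\<epsilon>}" using \<epsilon> by simp
  \<comment> \<open>The radius avoids the moduli of all roots, so the minimum on the circle is
    positive.\<close>
  ultimately obtain r where r: "r \<in> {0<..<\<epsilon>}" "r \<notin> norm ` {s. poly p s = 0}"
    by (metis finite_subset subsetI)
  have circ: "compact (sphere (0::complex) r)" "sphere (0::complex) r \<noteq> {}" using r by auto
  define F where "F = (\<lambda>y :: (complex^'a) \<times> complex. f (fst y + snd y *s d))"
  have contF: "continuous_on UNIV F"
  proof -
    have "continuous_on UNIV (\<lambda>y :: (complex^'a) \<times> complex. fst y + snd y *s d)"
      unfolding vector_scalar_mult_def by (intro continuous_intros)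
    then show ?thesis unfolding F_def
      by (rule continuous_on_compose2[OF continuous_on_poly_over_reals[OF f, of UNIV]]) auto
  qed
  have cp: "continuous_on (sphere 0 r) (\<lambda>s. norm (poly p s))" by (intro continuous_intros)
  obtain s0 where s0: "s0 \<in> sphere 0 r" "\<And>s. s \<in> sphere 0 r \<Longrightarrow> norm (poly p s0) \<le> norm (poly p s)"
    using continuous_attains_inf[OF circ cp] by blast
  define m where "m = norm (poly p s0)"
  have m: "m > 0" using s0(1) r(2) unfolding m_def by (auto simp: image_iff)
  define K where "K = cball z0 1 \<times> cball (0::complex) r"
  have "uniformly_continuous_on K F"
    unfolding K_def by (intro compact_uniformly_continuous compact_Times continuous_on_subset[OF contF]) auto
  then obtain \<eta> where \<eta>: "\<eta> > 0"
    "\<And>y y'. y \<in> K \<Longrightarrow> y' \<in> K \<Longrightarrow> dist y' y < \<eta> \<Longrightarrow> dist (F y') (F y) < m / 2"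
    unfolding uniformly_continuous_on_def using m by (metis half_gt_zero)
  have "\<exists>t. norm t < \<epsilon> \<and> f (z + t *s d) = 0" if z: "dist z z0 < min \<eta> 1" for z
  proof (rule ccontr)
    assume no: "\<not> ?thesis"
    obtain q where q: "\<And>t. f (z + t *s d) = poly q t"
      using poly_over_reals_line[OF f] by blast
    have nz: "poly q s \<noteq> 0" if "norm s \<le> r" for s
      using no q that r by (metis greaterThanLessThan_iff order_le_less_trans)
    have close: "norm (poly q s - poly p s) < m / 2" if "norm s \<le> r" for s
    proof -
      have "dist (F (z, s)) (F (z0, s)) < m / 2"
        by (rule \<eta>(2)) (use z that in \<open>auto simp: K_def dist_prod_def dist_commute\<close>)
      then show ?thesis by (simp add: F_def p q dist_norm)
    qed
    have "norm (inverse (poly q 0)) \<le> inverse (m / 2)"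
    proof (rule maximum_modulus_frontier[of "\<lambda>s. inverse (poly q s)" "cball 0 r"])
      show "(\<lambda>s. inverse (poly q s)) holomorphic_on interior (cball 0 r)"
        by (intro holomorphic_intros) (use nz in auto)
      show "continuous_on (closure (cball 0 r)) (\<lambda>s. inverse (poly q s))"
        by (intro continuous_intros) (use nz in auto)
      fix s :: complex assume "s \<in> frontier (cball 0 r)"
      then have s: "norm s = r" using r by auto
      then have "m \<le> norm (poly p s)" unfolding m_def by (intro s0(2)) auto
      moreover have "norm (poly p s) \<le> norm (poly q s) + norm (poly q s - poly p s)"
        by (metis norm_minus_commute norm_triangle_sub)
      ultimately have "m / 2 \<le> norm (poly q s)" using close[of s] s by linarith
      then show "norm (inverse (poly q s)) \<le> inverse (m / 2)"
        using m by (subst norm_inverse, intro le_imp_inverse_le) auto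
    qed (use r in auto)
    moreover have "norm (poly q 0) < m / 2"
      using close[of 0] r z0 p[of 0] by simp
    then have "inverse (m / 2) < norm (inverse (poly q 0))"
      using nz[of 0] r by (subst norm_inverse, intro less_imp_inverse_less) auto
    ultimately show False by linarith
  qed
  then show ?thesis using \<eta>(1) by (intro exI[of _ "min \<eta> 1"]) auto
qed

lemma dist_add_smult: "dist (z + t *s d) (z :: complex^'n) = norm t * norm d"
  by (simp add: dist_norm norm_vec_smult)

lemma small_multiple: "\<exists>s>0. s * norm (d :: 'a::real_normed_vector) < \<epsilon>" if "\<epsilon> > (0::real)"
proof (intro exI conjI)
  have n: "norm d + 1 > 0" by (simp add: add_nonneg_pos)
  show "\<epsilon> / (norm d + 1) > 0" using that n by simp
  show "\<epsilon> / (norm d + 1) * norm d < \<epsilon>" using that n by (simp add: field_simps)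
qed

text \<open>The form used for every density argument: any small perturbation of the zero
  \<open>z1\<close> can be brought back to the zero set along \<open>d\<close> without leaving a
  prescribed ball around \<open>z0\<close>.\<close>

lemma root_near_within:
  assumes p: "poly_over_reals p" "p z1 = 0" "p (z1 + t *s d) \<noteq> 0" and "dist z1 z0 < \<delta>"
  shows "\<exists>\<eta>>0. \<forall>z. dist z z1 < \<eta> \<longrightarrow> (\<exists>s. p (z + s *s d) = 0 \<and> dist (z + s *s d) z0 < \<delta>)"
proof -
  define \<epsilon> where "\<epsilon> = (\<delta> - dist z1 z0) / 2"
  have \<epsilon>: "\<epsilon> > 0" using assms(4) by (simp add: \<epsilon>_def)
  obtain r where r: "r > 0" "r * norm d < \<epsilon>" using small_multiple[OF \<epsilon>] by blast
  obtain \<eta> where \<eta>: "\<eta> > 0" "\<And>z. dist z z1 < \<eta> \<Longrightarrow> \<exists>s. norm s < r \<and> p (z + s *s d) = 0"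
    using root_near[OF p r(1)] by blast
  have "\<exists>s. p (z + s *s d) = 0 \<and> dist (z + s *s d) z0 < \<delta>" if z: "dist z z1 < min \<eta> \<epsilon>" for z
  proof -
    obtain s where s: "norm s < r" "p (z + s *s d) = 0" using \<eta>(2)[of z] z by auto
    have "norm s * norm d \<le> r * norm d" using s(1) by (simp add: mult_right_mono)
    then have "dist (z + s *s d) z < \<epsilon>" using r(2) unfolding dist_add_smult by linarith
    then have "dist (z + s *s d) z0 < \<delta>"
      using z dist_triangle[of "z + s *s d" z0 z] dist_triangle[of z z0 z1] unfolding \<epsilon>_def
      by (simp add: min_less_iff_conj)
    then show ?thesis using s(2) by blast
  qed
  then show ?thesis using \<eta>(1) \<epsilon> by (intro exI[of _ "min \<eta> \<epsilon>"]) auto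
qed

text \<open>Contrapositive of: near a zero at which \<open>f\<close> does not vanish on the whole coordinate box,
  there is a zero with a coordinate direction along which \<open>f\<close> is not constantly zero.\<close>

lemma vanishes_on_box:
  fixes f :: "complex^'n \<Rightarrow> complex"
  assumes z0: "f z0 = 0" and finJ: "finite J"
    and step: "\<And>z j t. (\<And>i. norm (z $ i - z0 $ i) < \<epsilon>) \<Longrightarrow> f z = 0 \<Longrightarrow> j \<in> J \<Longrightarrow> f (z + t *s axis j 1) = 0"
    and z: "\<And>i. norm (z $ i - z0 $ i) < \<epsilon>" "\<And>i. i \<notin> J \<Longrightarrow> z $ i = z0 $ i"
  shows "f z = 0"
  using finJ step z
proof (induction J arbitrary: z rule: finite_induct)
  case empty
  then have "z = z0" by (simp add: vec_eq_iff)
  then show ?case using z0 by simp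
next
  case (insert j J)
  define z' where "z' = (\<chi> i. if i = j then z0 $ i else z $ i)"
  have \<epsilon>: "0 < \<epsilon>" using insert.prems(2)[of j] by (meson norm_ge_zero order_le_less_trans)
  have "f z' = 0"
    by (rule insert.IH) (use insert.prems(1,2,3) \<epsilon> in \<open>auto simp: z'_def\<close>)
  moreover have "z = z' + (z $ j - z0 $ j) *s axis j 1"
    by (auto simp: z'_def vec_eq_iff axis_def)
  moreover have "norm (z' $ i - z0 $ i) < \<epsilon>" for i
    using insert.prems(2) \<epsilon> by (auto simp: z'_def)
  ultimately show ?case using insert.prems(1) by (metis insertI1)
qed

section \<open>Algebraic dependence of too many polynomials\<close>

text \<open>Gaussian elimination: the equation \<open>k0\<close> eliminates an unknown
  \<open>i0\<close> that occurs in it. The index sets are arbitrary because unknowns and equations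
  will be indexed by exponent functions.\<close>

lemma homogeneous_system_nontrivial:
  fixes C :: "'i \<Rightarrow> 'k \<Rightarrow> real"
  assumes "finite K" "finite I" "card K < card I"
  shows "\<exists>c. (\<exists>i\<in>I. c i \<noteq> 0) \<and> (\<forall>k\<in>K. (\<Sum>i\<in>I. c i * C i k) = 0)"
  using assms
proof (induction K arbitrary: I C rule: finite_induct)
  case empty
  then have "I \<noteq> {}" by auto
  then show ?case by (intro exI[of _ "\<lambda>_. 1"]) auto
next
  case (insert k0 K)
  show ?case
  proof (cases "\<forall>i\<in>I. C i k0 = 0")
    case True
    obtain c where "\<exists>i\<in>I. c i \<noteq> 0" "\<forall>k\<in>K. (\<Sum>i\<in>I. c i * C i k) = 0"
      using insert.IH[of I C] insert.prems insert.hyps by auto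
    then show ?thesis using True by (intro exI[of _ c]) auto
  next
    case False
    then obtain i0 where i0: "i0 \<in> I" "C i0 k0 \<noteq> 0" by blast
    define C' where "C' = (\<lambda>i k. C i k - C i k0 / C i0 k0 * C i0 k)"
    have "card K < card (I - {i0})" "finite (I - {i0})" using insert.prems insert.hyps i0 by auto
    then obtain c where c: "\<exists>i\<in>I - {i0}. c i \<noteq> 0" "\<forall>k\<in>K. (\<Sum>i\<in>I - {i0}. c i * C' i k) = 0"
      using insert.IH by blast
    \<comment> \<open>The value of the eliminated unknown that equation \<open>k0\<close>
      forces.\<close>
    define c0 where "c0 = - (\<Sum>i\<in>I - {i0}. c i * C i k0 / C i0 k0)"
    have *: "(\<Sum>i\<in>I. (c(i0 := c0)) i * C i k) = (\<Sum>i\<in>I - {i0}. c i * C' i k)" for k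
    proof -
      have "(\<Sum>i\<in>I. (c(i0 := c0)) i * C i k) = c0 * C i0 k + (\<Sum>i\<in>I - {i0}. (c(i0 := c0)) i * C i k)"
        using i0 insert.prems by (subst sum.remove[of _ i0]) auto
      also have "(\<Sum>i\<in>I - {i0}. (c(i0 := c0)) i * C i k) = (\<Sum>i\<in>I - {i0}. c i * C i k)"
        by (intro sum.cong) auto
      also have "c0 * C i0 k = - (\<Sum>i\<in>I - {i0}. c i * (C i k0 / C i0 k0 * C i0 k))"
        by (simp add: c0_def sum_distrib_right mult.assoc)
      finally show ?thesis
        by (simp add: C'_def right_diff_distrib sum_subtractf)
    qed
    have "(\<Sum>i\<in>I - {i0}. c i * C' i k0) = 0"
      unfolding C'_def using i0 by (intro sum.neutral) auto
    then show ?thesis using c * by (intro exI[of _ "c(i0 := c0)"]) auto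
  qed
qed

section \<open>Polynomials with exponents bounded in each variable\<close>

definition monomial :: "('n \<Rightarrow> nat) \<Rightarrow> complex^'n \<Rightarrow> complex" where
  "monomial k x = (\<Prod>i\<in>UNIV. x $ i ^ k i)"

text \<open>The degree is bounded separately in each variable, not in total, so that the number of
  monomials is a plain power.\<close>

inductive_set box_polys :: "nat \<Rightarrow> (complex^'n \<Rightarrow> complex) set" for D where
  mono: "(\<And>i. k i \<le> D) \<Longrightarrow> (\<lambda>x. monomial k x) \<in> box_polys D"
| add: "f \<in> box_polys D \<Longrightarrow> g \<in> box_polys D \<Longrightarrow> (\<lambda>x. f x + g x) \<in> box_polys D"
| scale: "f \<in> box_polys D \<Longrightarrow> (\<lambda>x. complex_of_real c * f x) \<in> box_polys D"

lemma box_polys_mono: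
  assumes "f \<in> box_polys D" "D \<le> E"
  shows "f \<in> box_polys E"
  using assms
proof induction
  case (mono k)
  then show ?case by (intro box_polys.mono) (meson order_trans)
qed (auto intro: box_polys.intros)

lemma monomial_add: "monomial (\<lambda>i. k i + l i) x = monomial k x * monomial l x"
  by (simp add: monomial_def power_add prod.distrib)

lemma box_polys_mult:
  assumes "f \<in> box_polys D" "g \<in> box_polys E"
  shows "(\<lambda>x. f x * g x) \<in> box_polys (D + E)"
  using assms
proof induction
  case (mono k)
  show ?case using mono(2)
  proof induction
    case (mono l)
    then have "(\<lambda>x. monomial (\<lambda>i. k i + l i) x) \<in> box_polys (D + E)"
      using \<open>\<And>i. k i \<le> D\<close> by (intro box_polys.mono) (simp add: add_mono)
    then show ?case by (simp add: monomial_add)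
  next
    case (add f g)
    then show ?case using box_polys.add by (fastforce simp: algebra_simps)
  next
    case (scale f c)
    then show ?case using box_polys.scale[of _ "D + E" c] by (fastforce simp: algebra_simps)
  qed
next
  case (add f h)
  then show ?case using box_polys.add by (fastforce simp: algebra_simps)
next
  case (scale f c)
  then show ?case using box_polys.scale[of _ "D + E" c] by (fastforce simp: algebra_simps)
qed

lemma box_polys_const: "(\<lambda>x. complex_of_real c) \<in> box_polys D"
  using box_polys.scale[OF box_polys.mono[of "\<lambda>_. 0" D], of c] by (simp add: monomial_def)

lemma box_polys_power: "f \<in> box_polys D \<Longrightarrow> (\<lambda>x. f x ^ n) \<in> box_polys (n * D)"
  by (induction n) (use box_polys_const[of 1] box_polys_mult in \<open>auto simp: algebra_simps\<close>)

lemma box_polys_prod: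
  assumes "finite I" "\<And>i. i \<in> I \<Longrightarrow> f i \<in> box_polys D"
  shows "(\<lambda>x. \<Prod>i\<in>I. f i x) \<in> box_polys (card I * D)"
  using assms
proof (induction rule: finite_induct)
  case empty
  then show ?case using box_polys_const[of 1] by simp
next
  case (insert i I)
  then show ?case using box_polys_mult[of "f i" D "\<lambda>x. \<Prod>i\<in>I. f i x" "card I * D"] by auto
qed

lemma poly_over_reals_box_polys: "poly_over_reals f \<Longrightarrow> \<exists>D. f \<in> box_polys D"
proof (induction rule: poly_over_reals.induct)
  case (const c)
  show ?case using box_polys_const by blast
next
  case (coord i)
  have "(\<lambda>x. monomial (\<lambda>j. if j = i then 1 else 0) x) \<in> box_polys 1"
    by (intro box_polys.mono) auto
  moreover have "monomial (\<lambda>j. if j = i then 1 else 0) x = x $ i" for x :: "complex^'a"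
    by (simp add: monomial_def if_distrib prod.delta cong: if_cong)
  ultimately show ?case by auto
next
  case (add p q)
  then obtain D E where "p \<in> box_polys D" "q \<in> box_polys E" by blast
  then have "p \<in> box_polys (max D E)" "q \<in> box_polys (max D E)" by (auto elim: box_polys_mono)
  then show ?case using box_polys.add by blast
next
  case (mult p q)
  then show ?case using box_polys_mult by blast
qed

definition boxed_exponents :: "nat \<Rightarrow> ('n \<Rightarrow> nat) set" where
  "boxed_exponents D = PiE UNIV (\<lambda>_. {..D})"

lemma card_boxed_exponents:
  "card (boxed_exponents D :: ('n::finite \<Rightarrow> nat) set) = Suc D ^ CARD('n)"
  "finite (boxed_exponents D :: ('n::finite \<Rightarrow> nat) set)"
  unfolding boxed_exponents_def by (auto simp: card_PiE intro!: finite_PiE)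

lemma box_polys_expansion:
  assumes "f \<in> box_polys D"
  shows "\<exists>c. \<forall>x. f x = (\<Sum>k\<in>boxed_exponents D. complex_of_real (c k) * monomial k x)"
  using assms
proof induction
  case (mono k)
  then have "k \<in> boxed_exponents D" by (auto simp: boxed_exponents_def)
  then have "(\<Sum>l\<in>boxed_exponents D. complex_of_real (if l = k then 1 else 0) * monomial l x) = monomial k x" for x
    by (subst sum.remove[of _ k]) (auto simp: card_boxed_exponents)
  then show ?case by (intro exI[of _ "\<lambda>l. if l = k then 1 else 0"]) simp
next
  case (add f g)
  then obtain c d where "\<forall>x. f x = (\<Sum>k\<in>boxed_exponents D. complex_of_real (c k) * monomial k x)"
    "\<forall>x. g x = (\<Sum>k\<in>boxed_exponents D. complex_of_real (d k) * monomial k x)" by blast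
  then show ?case
    by (intro exI[of _ "\<lambda>k. c k + d k"]) (simp add: distrib_right sum.distrib)
next
  case (scale f e)
  then obtain c where "\<forall>x. f x = (\<Sum>k\<in>boxed_exponents D. complex_of_real (c k) * monomial k x)"
    by blast
  then show ?case
    by (intro exI[of _ "\<lambda>k. e * c k"]) (simp add: sum_distrib_left mult.assoc)
qed

text \<open>Induction on the variables: with the others fixed, the sum is a polynomial in the
  variable \<open>j\<close> that vanishes identically, so each of its coefficients vanishes as a
  function of the remaining variables.\<close>

lemma real_monomials_independent:
  fixes c :: "('n \<Rightarrow> nat) \<Rightarrow> real"
  assumes "finite I" "\<And>x :: 'n \<Rightarrow> real. (\<Sum>k\<in>PiE I (\<lambda>_. {..D}). c k * (\<Prod>i\<in>I. x i ^ k i)) = 0"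
    and "k \<in> PiE I (\<lambda>_. {..D})"
  shows "c k = 0"
  using assms
proof (induction I arbitrary: c k rule: finite_induct)
  case empty
  then show ?case by simp
next
  case (insert j I)
  let ?E = "PiE I (\<lambda>_. {..D})"
  have inj: "inj_on (\<lambda>(y, g). g(j := y)) ({..D} \<times> ?E)"
    using insert.hyps inj_combinator[of j I "\<lambda>_. {..D}"] by simp
  have sum0: "(\<Sum>y\<le>D. (\<Sum>g\<in>?E. c (g(j := y)) * (\<Prod>i\<in>I. x i ^ g i)) * t ^ y) = 0"
    for x :: "'n \<Rightarrow> real" and t
  proof -
    have "0 = (\<Sum>k\<in>PiE (insert j I) (\<lambda>_. {..D}). c k * (\<Prod>i\<in>insert j I. (x(j := t)) i ^ k i))"
      using insert.prems(1) by simp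
    also have "\<dots> = (\<Sum>(y, g)\<in>{..D} \<times> ?E. c (g(j := y)) * (\<Prod>i\<in>insert j I. (x(j := t)) i ^ (g(j := y)) i))"
      by (subst PiE_insert_eq, subst sum.reindex[OF inj]) (simp add: case_prod_unfold)
    also have "\<dots> = (\<Sum>(y, g)\<in>{..D} \<times> ?E. (c (g(j := y)) * (\<Prod>i\<in>I. x i ^ g i)) * t ^ y)"
    proof (intro sum.cong refl, clarify)
      fix y g
      have "(\<Prod>i\<in>I. (x(j := t)) i ^ (g(j := y)) i) = (\<Prod>i\<in>I. x i ^ g i)"
        using insert.hyps by (intro prod.cong) auto
      then show "c (g(j := y)) * (\<Prod>i\<in>insert j I. (x(j := t)) i ^ (g(j := y)) i) =
          c (g(j := y)) * (\<Prod>i\<in>I. x i ^ g i) * t ^ y"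
        using insert.hyps by (simp add: mult_ac)
    qed
    finally show ?thesis by (simp add: sum.cartesian_product sum_distrib_right)
  qed
  have "(\<Sum>g\<in>?E. c (g(j := y)) * (\<Prod>i\<in>I. x i ^ g i)) = 0" if "y \<le> D" for x y
    using sum0[of x] polyfun_eq_0[of "\<lambda>y. \<Sum>g\<in>?E. c (g(j := y)) * (\<Prod>i\<in>I. x i ^ g i)" D] that
    by blast
  then have "c (g(j := y)) = 0" if "y \<le> D" "g \<in> ?E" for y g
    using insert.IH[of "\<lambda>g. c (g(j := y))" g] that by blast
  then show ?case using insert.prems(2) by (auto simp: PiE_insert_eq)
qed

text \<open>Counting: substituting \<open>\<phi>\<close> into the monomials with exponents at most
  \<open>d\<close> gives elements of a space with fewer monomials than were substituted, so some
  real combination of them vanishes. Its coefficients are real and not all zero, so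
  \<open>\<Phi>\<close> is nonzero already at a real point.\<close>

lemma algebraic_dependence:
  fixes \<phi> :: "complex^'m \<Rightarrow> complex^'n"
  assumes "\<And>j. poly_over_reals (\<lambda>x. \<phi> x $ j)" and less: "CARD('m) < CARD('n)"
  shows "\<exists>\<Phi>. poly_over_reals \<Phi> \<and> (\<exists>x. \<Phi> (complex_vec x) \<noteq> 0) \<and> (\<forall>x. \<Phi> (\<phi> x) = 0)"
proof -
  have "\<exists>D. (\<lambda>x. \<phi> x $ j) \<in> box_polys D" for j
    using assms(1) by (rule poly_over_reals_box_polys)
  then obtain D where D: "\<And>j. (\<lambda>x. \<phi> x $ j) \<in> box_polys (D j)" by metis
  define e where "e = Max (range D)"
  have e: "(\<lambda>x. \<phi> x $ j) \<in> box_polys e" for j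
    using D by (rule box_polys_mono) (simp add: e_def)
  define n where "n = CARD('n)"
  \<comment> \<open>With m parameters and n > m coordinates this choice gives (n d e + 1)^m <= ((n e
    + 1) (d + 1))^m = d (d + 1)^m, which is less than (d + 1)^(m+1) and hence than (d +
    1)^n.\<close>
  define d where "d = Suc (n * e) ^ CARD('m)"
  define E where "E = n * (d * e)"
  have mon_in: "(\<lambda>x. monomial k (\<phi> x)) \<in> box_polys E" if "k \<in> boxed_exponents d" for k
  proof -
    have "(\<lambda>x. (\<phi> x $ j) ^ k j) \<in> box_polys (d * e)" for j
      using box_polys_power[OF e[of j], of "k j"] that
      by (elim box_polys_mono) (auto simp: boxed_exponents_def PiE_def Pi_def intro!: mult_le_mono1)
    then show ?thesis
      unfolding monomial_def E_def n_def using box_polys_prod[of UNIV "\<lambda>j x. (\<phi> x $ j) ^ k j"] by auto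
  qed
  then have "\<exists>C. \<forall>x. monomial k (\<phi> x) = (\<Sum>l\<in>boxed_exponents E. complex_of_real (C l) * monomial l x)"
    if "k \<in> boxed_exponents d" for k
    using box_polys_expansion that by blast
  then obtain C where C: "\<And>k x. k \<in> boxed_exponents d \<Longrightarrow>
      monomial k (\<phi> x) = (\<Sum>l\<in>boxed_exponents E. complex_of_real (C k l) * monomial l x)"
    by metis
  have "Suc E ^ CARD('m) \<le> (Suc (n * e) * Suc d) ^ CARD('m)"
    unfolding E_def by (intro power_mono) (auto simp: algebra_simps)
  also have "\<dots> = d * Suc d ^ CARD('m)" by (simp only: power_mult_distrib d_def)
  also have "\<dots> < Suc d ^ Suc CARD('m)" by simp
  also have "\<dots> \<le> Suc d ^ CARD('n)" using less by (intro power_increasing) auto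
  finally have "card (boxed_exponents E :: ('m \<Rightarrow> nat) set) < card (boxed_exponents d :: ('n \<Rightarrow> nat) set)"
    by (simp only: card_boxed_exponents)
  then obtain c where c: "\<exists>k\<in>boxed_exponents d. c k \<noteq> 0"
    "\<And>l. l \<in> boxed_exponents E \<Longrightarrow> (\<Sum>k\<in>boxed_exponents d. c k * C k l) = 0"
    using homogeneous_system_nontrivial[OF card_boxed_exponents(2) card_boxed_exponents(2), of E d C]
    by blast
  define \<Phi> where "\<Phi> = (\<lambda>y :: complex^'n. \<Sum>k\<in>boxed_exponents d. complex_of_real (c k) * monomial k y)"
  have "poly_over_reals \<Phi>"
    unfolding \<Phi>_def monomial_def by (intro poly.mem_intros poly_over_reals.coord)
  moreover have "\<Phi> (\<phi> x) = 0" for x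
  proof -
    have "\<Phi> (\<phi> x) = (\<Sum>k\<in>boxed_exponents d. \<Sum>l\<in>boxed_exponents E.
        complex_of_real (c k * C k l) * monomial l x)"
      unfolding \<Phi>_def by (intro sum.cong refl) (simp add: C sum_distrib_left mult.assoc)
    also have "\<dots> = (\<Sum>l\<in>boxed_exponents E. complex_of_real (\<Sum>k\<in>boxed_exponents d. c k * C k l) * monomial l x)"
      by (subst sum.swap) (simp add: sum_distrib_right)
    also have "\<dots> = 0" using c(2) by simp
    finally show ?thesis .
  qed
  moreover have "\<exists>x. \<Phi> (complex_vec x) \<noteq> 0"
  proof (rule ccontr)
    assume no: "\<not> ?thesis"
    have "(\<Sum>k\<in>PiE UNIV (\<lambda>_. {..d}). c k * (\<Prod>i\<in>UNIV. x i ^ k i)) = 0" for x :: "'n \<Rightarrow> real"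
    proof -
      have "complex_of_real (\<Sum>k\<in>PiE UNIV (\<lambda>_. {..d}). c k * (\<Prod>i\<in>UNIV. x i ^ k i)) = \<Phi> (complex_vec (\<chi> i. x i))"
        by (simp add: \<Phi>_def complex_vec_def monomial_def boxed_exponents_def)
      then show ?thesis using no by (metis of_real_eq_0_iff)
    qed
    then have "c k = 0" if "k \<in> boxed_exponents d" for k
      using real_monomials_independent[where I = UNIV and c = c and D = d and k = k] that by (simp add: boxed_exponents_def)
    then show False using c(1) by blast
  qed
  ultimately show ?thesis by blast
qed

section \<open>Cofactors of a row\<close>

text \<open>Replacing the row by unit vectors yields the cofactors without explicit signs or
  submatrices.\<close>

definition row_cofactors :: "'a::field^'n^'n \<Rightarrow> 'n \<Rightarrow> 'a^'n" where
  "row_cofactors M i = (\<chi> c. det (\<chi> r. if r = i then axis c 1 else M $ r))"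

lemma det_eq_0_iff_kernel:
  fixes M :: "'a::field^'n^'n"
  shows "det M = 0 \<longleftrightarrow> (\<exists>x. x \<noteq> 0 \<and> M *v x = 0)"
  using invertible_det_nz[of M] invertible_left_inverse[of M] matrix_left_invertible_ker[of M] by blast

lemma det_replace_row:
  "det (\<chi> r. if r = i then v else M $ r) = (\<Sum>c\<in>UNIV. v $ c * row_cofactors M i $ c)"
proof -
  have "det (\<chi> r. if r = i then v else M $ r) =
      det (\<chi> r. if r = i then (\<Sum>c\<in>UNIV. v $ c *s axis c 1) else M $ r)"
    by (simp only: basis_expansion)
  also have "\<dots> = (\<Sum>c\<in>UNIV. det (\<chi> r. if r = i then v $ c *s axis c 1 else M $ r))"
    by (rule det_linear_row_sum) simp
  finally show ?thesis by (simp add: det_row_mul row_cofactors_def)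
qed

lemma row_cofactors_replace: "row_cofactors (\<chi> r. if r = i then v else M $ r) i = row_cofactors M i"
  unfolding row_cofactors_def by (simp add: vec_eq_iff cong: if_cong)

text \<open>A column of the adjugate identity. For a singular matrix it yields kernel vectors that
  are polynomial in the entries, which is what makes the inverse map rational.\<close>

lemma mult_row_cofactors: "M *v row_cofactors M i = det M *s axis i 1"
proof -
  have "(\<Sum>c\<in>UNIV. M $ r $ c * row_cofactors M i $ c) = (if r = i then det M else 0)" for r
  proof -
    have "(\<Sum>c\<in>UNIV. M $ r $ c * row_cofactors M i $ c) = det (\<chi> r'. if r' = i then M $ r else M $ r')"
      by (simp add: det_replace_row)
    also have "\<dots> = (if r = i then det M else 0)"
    proof (cases "r = i")
      case True
      then have "(\<chi> r'. if r' = i then M $ r else M $ r') = M" by (simp add: vec_eq_iff)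
      then show ?thesis using True by simp
    next
      case False
      then have "det (\<chi> r'. if r' = i then M $ r else M $ r') = 0"
        by (intro det_identical_rows[OF False]) (simp add: row_def vec_eq_iff)
      then show ?thesis using False by simp
    qed
    finally show ?thesis .
  qed
  then show ?thesis
    by (simp add: vec_eq_iff matrix_vector_mult_def axis_def)
qed

text \<open>Such a \<open>k\<close> is also killed by the matrix whose row \<open>i\<close> is the
  unit vector of \<open>c\<close>, and the determinant of that matrix is the nonzero
  cofactor.\<close>

lemma kernel_eq_0I:
  assumes "row_cofactors M i $ c \<noteq> 0" "M *v k = 0" "k $ c = 0"
  shows "k = 0"
proof (rule ccontr)
  assume "k \<noteq> 0"
  moreover have "(\<chi> r. if r = i then axis c 1 else M $ r) *v k = 0"
    using assms(2,3) by (auto simp: vec_eq_iff matrix_vector_mult_def axis_def if_distrib[of "\<lambda>x. x * _"] sum.delta cong: if_cong)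
  ultimately have "det (\<chi> r. if r = i then axis c 1 else M $ r) = 0"
    using det_eq_0_iff_kernel by blast
  then show False using assms(1) by (simp add: row_cofactors_def)
qed

lemma kernel_proportional:
  assumes "row_cofactors M i $ c \<noteq> 0" "M *v k = 0" "M *v l = 0"
  shows "k $ c *s l = l $ c *s k"
proof -
  have "k $ c *s l - l $ c *s k = 0"
    by (rule kernel_eq_0I[OF assms(1)])
       (simp_all add: matrix_vector_mult_diff_distrib vector_scalar_commute assms)
  then show ?thesis by simp
qed

text \<open>Choose \<open>c\<close> with \<open>k $ c \<noteq> 0\<close>. If all cofactors vanish,
  then for each \<open>i\<close> there is a nonzero \<open>x\<close> with \<open>x $ c = 0\<close>
  and \<open>M *v x\<close> a multiple of the unit vector of \<open>i\<close>. The multiple is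
  nonzero, since otherwise \<open>x\<close> would be proportional to \<open>k\<close>. Hence
  \<open>M\<close> is surjective, although it has a kernel.\<close>

lemma row_cofactors_nonzero:
  assumes k: "M *v k = 0" "k \<noteq> 0" and uniq: "\<And>l. M *v l = 0 \<Longrightarrow> \<exists>t. l = t *s k"
  shows "\<exists>i. row_cofactors M i \<noteq> 0"
proof (rule ccontr)
  assume no: "\<not> ?thesis"
  obtain c where c: "k $ c \<noteq> 0" using k(2) by (auto simp: vec_eq_iff)
  have "\<exists>x. M *v x = axis i 1" for i
  proof -
    have "det (\<chi> r. if r = i then axis c 1 else M $ r) = 0"
      using no by (simp add: row_cofactors_def vec_eq_iff)
    then obtain x where x: "x \<noteq> 0" "(\<chi> r. if r = i then axis c 1 else M $ r) *v x = 0"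
      using det_eq_0_iff_kernel by blast
    have rows: "(\<Sum>j\<in>UNIV. (if r = i then axis c 1 else M $ r) $ j * x $ j) = 0" for r
      using x(2) by (simp add: vec_eq_iff matrix_vector_mult_def)
    have xc: "x $ c = 0"
      using rows[of i] by (simp add: axis_def if_distrib[of "\<lambda>x. x * _"] sum.delta cong: if_cong)
    have "(M *v x) $ r = 0" if "r \<noteq> i" for r
      using rows[of r] that by (simp add: matrix_vector_mult_def)
    then have Mx: "M *v x = (M *v x) $ i *s axis i 1"
      by (auto simp: vec_eq_iff axis_def)
    have "(M *v x) $ i \<noteq> 0"
    proof
      assume "(M *v x) $ i = 0"
      then have "M *v x = 0" using Mx by simp
      then obtain t where "x = t *s k" using uniq by blast
      then show False using xc x(1) c by auto
    qed
    then have "M *v (inverse ((M *v x) $ i) *s x) = axis i 1"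
      using Mx by (metis (no_types, lifting) left_inverse vector_scalar_commute vector_smult_assoc vector_smult_lid)
    then show ?thesis by blast
  qed
  then obtain X where X: "\<And>i. M *v X i = axis i 1" by metis
  have "M ** transpose (\<chi> i. X i) = mat 1"
    using X by (simp add: vec_eq_iff matrix_matrix_mult_def matrix_vector_mult_def transpose_def mat_def axis_def)
  then have "det M * det (transpose (\<chi> i. X i)) = 1"
    by (metis det_I det_mul)
  moreover have "det M = 0" using k det_eq_0_iff_kernel by blast
  ultimately show False by simp
qed

section \<open>Vectors of dimension three and six\<close>

lemma exhaust_6: "x = 1 \<or> x = 2 \<or> x = 3 \<or> x = 4 \<or> x = 5 \<or> x = (6 :: 6)"
proof (induct x)
  case (of_int z)
  then have "0 \<le> z" "z < 6" by simp_all
  then have "z = 0 \<or> z = 1 \<or> z = 2 \<or> z = 3 \<or> z = 4 \<or> z = 5" by arith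
  then show ?case by auto
qed

lemma forall_6: "(\<forall>i::6. P i) \<longleftrightarrow> P 1 \<and> P 2 \<and> P 3 \<and> P 4 \<and> P 5 \<and> P 6"
  by (metis exhaust_6)

lemma UNIV_6: "UNIV = {1::6, 2, 3, 4, 5, 6}"
  using exhaust_6 by auto

lemma sum_6: "(\<Sum>i\<in>(UNIV::6 set). f i) = f 1 + f 2 + f 3 + f 4 + f 5 + f 6"
  unfolding UNIV_6 by (simp add: ac_simps)

lemma vector_6 [simp]:
  "(vector [a,b,c,d,e,f] :: 'a::zero^6) $ 1 = a"
  "(vector [a,b,c,d,e,f] :: 'a::zero^6) $ 2 = b"
  "(vector [a,b,c,d,e,f] :: 'a::zero^6) $ 3 = c"
  "(vector [a,b,c,d,e,f] :: 'a::zero^6) $ 4 = d"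
  "(vector [a,b,c,d,e,f] :: 'a::zero^6) $ 5 = e"
  "(vector [a,b,c,d,e,f] :: 'a::zero^6) $ 6 = f"
  unfolding vector_def by simp_all

text \<open>Bilinear and not Hermitian, so that all conditions stay polynomial; nonzero vectors may
  be isotropic.\<close>

definition cdot :: "complex^3 \<Rightarrow> complex^3 \<Rightarrow> complex" (infixl "\<odot>" 70) where
  "x \<odot> y = (\<Sum>i\<in>UNIV. x $ i * y $ i)"

lemma cross_component [simp]:
  "complex_cross3 a b $ 1 = a$2 * b$3 - a$3 * b$2"
  "complex_cross3 a b $ 2 = a$3 * b$1 - a$1 * b$3"
  "complex_cross3 a b $ 3 = a$1 * b$2 - a$2 * b$1"
  by (simp_all add: complex_cross3_def)

lemmas vec3_simps = cdot_def sum_3 vec_eq_iff[where 'b = 3] forall_3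

lemma cdot_commute: "x \<odot> y = y \<odot> x"
  by (simp add: cdot_def mult.commute)

lemma cdot_add: "x \<odot> (y + z) = x \<odot> y + x \<odot> z" "(y + z) \<odot> x = y \<odot> x + z \<odot> x"
  by (simp_all add: cdot_def algebra_simps sum.distrib)

lemma cdot_diff: "x \<odot> (y - z) = x \<odot> y - x \<odot> z" "(y - z) \<odot> x = y \<odot> x - z \<odot> x"
  by (simp_all add: cdot_def algebra_simps sum_subtractf)

lemma cdot_uminus: "x \<odot> (- y) = - (x \<odot> y)" "(- y) \<odot> x = - (y \<odot> x)"
  by (simp_all add: cdot_def sum_negf)

lemma cdot_smult: "x \<odot> (t *s y) = t * (x \<odot> y)" "(t *s y) \<odot> x = t * (y \<odot> x)"
  by (simp_all add: cdot_def sum_distrib_left mult_ac)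

lemma cdot_0 [simp]: "x \<odot> 0 = 0" "0 \<odot> x = 0"
  by (simp_all add: cdot_def)

lemmas cdot_linear = cdot_add cdot_diff cdot_uminus cdot_smult

lemma cross_smult:
  "complex_cross3 (t *s a) b = t *s complex_cross3 a b" "complex_cross3 a (t *s b) = t *s complex_cross3 a b"
  by (simp_all add: vec3_simps algebra_simps)

lemma cross_cross: "complex_cross3 (complex_cross3 a b) c = (a \<odot> c) *s b - (b \<odot> c) *s a"
  by (simp add: vec3_simps algebra_simps)

lemma cdot_cross: "complex_cross3 a b \<odot> c = b \<odot> complex_cross3 c a"
  by (simp add: vec3_simps algebra_simps)

lemma cdot_cross_self [simp]:
  "a \<odot> complex_cross3 a b = 0" "b \<odot> complex_cross3 a b = 0"
  "complex_cross3 a b \<odot> a = 0" "complex_cross3 a b \<odot> b = 0"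
  by (simp_all add: vec3_simps algebra_simps)

lemma cdot_matrix: "(M *v x) \<odot> y = x \<odot> (transpose M *v y)"
  by (simp add: cdot_def matrix_vector_mult_def transpose_def sum_3 algebra_simps)

lemma cdot_orthogonal: "orthogonal_matrix R \<Longrightarrow> (R *v x) \<odot> (R *v y) = x \<odot> y"
  by (simp add: cdot_matrix orthogonal_matrix_def matrix_vector_mul_assoc)

lemma orthogonal_matrix_cancel:
  "orthogonal_matrix R \<Longrightarrow> R *v (transpose R *v x) = x"
  "orthogonal_matrix R \<Longrightarrow> transpose R *v (R *v x) = x"
  by (simp_all add: orthogonal_matrix_def matrix_vector_mul_assoc)

definition join6 :: "complex^3 \<Rightarrow> complex^3 \<Rightarrow> complex^6" where
  "join6 x y = vector [x$1, x$2, x$3, y$1, y$2, y$3]"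

definition fst6 :: "complex^6 \<Rightarrow> complex^3" where
  "fst6 v = vector [v$1, v$2, v$3]"

definition snd6 :: "complex^6 \<Rightarrow> complex^3" where
  "snd6 v = vector [v$4, v$5, v$6]"

lemma join6_component [simp]:
  "join6 x y $ 1 = x $ 1" "join6 x y $ 2 = x $ 2" "join6 x y $ 3 = x $ 3"
  "join6 x y $ 4 = y $ 1" "join6 x y $ 5 = y $ 2" "join6 x y $ 6 = y $ 3"
  by (simp_all add: join6_def)

lemma fst6_component [simp]: "fst6 v $ 1 = v $ 1" "fst6 v $ 2 = v $ 2" "fst6 v $ 3 = v $ 3"
  by (simp_all add: fst6_def)

lemma snd6_component [simp]: "snd6 v $ 1 = v $ 4" "snd6 v $ 2 = v $ 5" "snd6 v $ 3 = v $ 6"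
  by (simp_all add: snd6_def)

lemma join6_fst6_snd6 [simp]: "join6 (fst6 v) (snd6 v) = v"
  by (simp add: vec_eq_iff forall_6)

lemma fst6_join6 [simp]: "fst6 (join6 x y) = x" and snd6_join6 [simp]: "snd6 (join6 x y) = y"
  by (simp_all add: vec_eq_iff forall_3)

lemma join6_eq_0_iff: "join6 x y = 0 \<longleftrightarrow> x = 0 \<and> y = 0"
  by (auto simp: vec_eq_iff forall_6 forall_3)

lemma fst6_linear: "fst6 (v + v') = fst6 v + fst6 v'" "fst6 (v - v') = fst6 v - fst6 v'"
    "fst6 (t *s v) = t *s fst6 v" "fst6 0 = 0"
  and snd6_linear: "snd6 (v + v') = snd6 v + snd6 v'" "snd6 (v - v') = snd6 v - snd6 v'"
    "snd6 (t *s v) = t *s snd6 v" "snd6 0 = 0"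
  by (simp_all add: vec_eq_iff forall_3)

lemma sum_join6: "(\<Sum>j\<in>UNIV. join6 x y $ j * v $ j) = x \<odot> fst6 v + y \<odot> snd6 v"
  by (simp add: sum_6 cdot_def sum_3)

section \<open>Singular configurations and screws\<close>

abbreviation base_pt :: "architecture \<Rightarrow> 6 \<Rightarrow> complex^3" where
  "base_pt a i \<equiv> complex_vec (fst a $ i)"

abbreviation plat_pt :: "architecture \<Rightarrow> 6 \<Rightarrow> complex^3" where
  "plat_pt a i \<equiv> complex_vec (snd a $ i)"

text \<open>\<open>u + complex_cross3 w A\<close> is the velocity at the base point A of the twist
  with angular part \<open>w\<close> and velocity \<open>u\<close> at the origin. Reciprocity says
  that each limb is orthogonal to this velocity at its base point.\<close>

definition reciprocal :: "architecture \<Rightarrow> complex^3^3 \<Rightarrow> complex^3 \<Rightarrow> complex^3 \<Rightarrow> complex^3 \<Rightarrow> bool" where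
  "reciprocal a R P u w \<longleftrightarrow> (\<forall>i. limb a R P i \<odot> (u + complex_cross3 w (base_pt a i)) = 0)"

lemma Jac_row: "Jac a R P $ i = join6 (limb a R P i) (complex_cross3 (base_pt a i) (limb a R P i))"
  by (simp add: Jac_def Let_def join6_def)

lemma Jac_kernel: "Jac a R P *v k = 0 \<longleftrightarrow> reciprocal a R P (fst6 k) (snd6 k)"
  by (simp add: vec_eq_iff[where 'b = 6] matrix_vector_mult_def Jac_row sum_join6 reciprocal_def cdot_add cdot_cross)

lemma singular_iff:
  "det (Jac a R P) = 0 \<longleftrightarrow> (\<exists>u w. (u \<noteq> 0 \<or> w \<noteq> 0) \<and> reciprocal a R P u w)"
proof -
  have "det (Jac a R P) = 0 \<longleftrightarrow> (\<exists>k. k \<noteq> 0 \<and> reciprocal a R P (fst6 k) (snd6 k))"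
    by (simp add: det_eq_0_iff_kernel Jac_kernel)
  also have "\<dots> \<longleftrightarrow> (\<exists>u w. (u \<noteq> 0 \<or> w \<noteq> 0) \<and> reciprocal a R P u w)"
    by (metis join6_eq_0_iff join6_fst6_snd6 fst6_join6 snd6_join6)
  finally show ?thesis .
qed

lemma complex_quadratic_root:
  fixes a b c :: complex
  assumes "a \<noteq> 0"
  shows "\<exists>t. a * t^2 + b * t + c = 0"
proof -
  define d where "d = csqrt (b^2 - 4 * a * c)"
  have d: "d^2 = b^2 - 4 * a * c" by (simp add: d_def)
  have "a * ((d - b) / (2 * a))^2 + b * ((d - b) / (2 * a)) + c = (d^2 - b^2 + 4 * a * c) / (4 * a)"
    using assms by (simp add: field_simps power2_eq_square)
  also have "\<dots> = 0" using d by simp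
  finally show ?thesis by blast
qed

text \<open>A kernel of dimension at least two contains a screw of pitch zero, since the pitch form
  \<open>u \<odot> w\<close> is quadratic.\<close>

lemma row_cofactors_Jac_nonzero:
  assumes "det (Jac a R P) = 0"
    and pitch: "\<And>u w. (u \<noteq> 0 \<or> w \<noteq> 0) \<Longrightarrow> reciprocal a R P u w \<Longrightarrow> u \<odot> w \<noteq> 0"
  shows "\<exists>i. row_cofactors (Jac a R P) i \<noteq> 0"
proof -
  obtain k where k: "k \<noteq> 0" "Jac a R P *v k = 0"
    using assms(1) det_eq_0_iff_kernel by blast
  have Q: "fst6 l \<odot> snd6 l \<noteq> 0" if "l \<noteq> 0" "Jac a R P *v l = 0" for l
    using pitch[of "fst6 l" "snd6 l"] that by (metis Jac_kernel join6_eq_0_iff join6_fst6_snd6)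
  show ?thesis
  proof (rule row_cofactors_nonzero[OF k(2,1)])
    fix l assume l: "Jac a R P *v l = 0"
    obtain t where t: "(fst6 k \<odot> snd6 k) * t^2 + (fst6 l \<odot> snd6 k + fst6 k \<odot> snd6 l) * t + fst6 l \<odot> snd6 l = 0"
      using complex_quadratic_root[OF Q[OF k]] by blast
    have "fst6 (l + t *s k) \<odot> snd6 (l + t *s k) = 0"
      using t by (simp add: fst6_linear snd6_linear cdot_linear algebra_simps power2_eq_square)
    moreover have "Jac a R P *v (l + t *s k) = 0"
      using k l by (simp add: matrix_vector_right_distrib vector_scalar_commute)
    ultimately have "l + t *s k = 0" using Q by blast
    then have "l = (- t) *s k" by (simp add: add_eq_0_iff2)
    then show "\<exists>t. l = t *s k" by blast
  qed
qed

section \<open>Parametrization by rotations and directions\<close>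

text \<open>Everything is expressed in the frames in which the first joint centers are the origins.\<close>

definition base_vec :: "architecture \<Rightarrow> 6 \<Rightarrow> complex^3" where
  "base_vec a i = base_pt a i - base_pt a 1"

definition plat_vec :: "architecture \<Rightarrow> 6 \<Rightarrow> complex^3" where
  "plat_vec a i = plat_pt a i - plat_pt a 1"

text \<open>Moving the reference point to the first base joint adds a multiple of the form w x A_1
  to \<open>u\<close>; the direction \<open>w\<close> and the pitch form u.w do not change.\<close>

lemma reciprocal_first_joint:
  "reciprocal a R P u w \<longleftrightarrow>
    (\<forall>i. (R *v plat_vec a i - base_vec a i + (P + R *v plat_pt a 1 - base_pt a 1))
       \<odot> ((u + complex_cross3 w (base_pt a 1)) + complex_cross3 w (base_vec a i)) = 0)"
proof -
  have l: "limb a R P i = R *v plat_vec a i - base_vec a i + (P + R *v plat_pt a 1 - base_pt a 1)" for i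
    by (simp add: limb_def plat_vec_def base_vec_def matrix_vector_mult_diff_distrib algebra_simps)
  have m: "u + complex_cross3 w (base_pt a i)
      = (u + complex_cross3 w (base_pt a 1)) + complex_cross3 w (base_vec a i)" for i
    by (simp add: vec3_simps base_vec_def algebra_simps)
  have "limb a R P i \<odot> (u + complex_cross3 w (base_pt a i)) =
      (R *v plat_vec a i - base_vec a i + (P + R *v plat_pt a 1 - base_pt a 1))
       \<odot> ((u + complex_cross3 w (base_pt a 1)) + complex_cross3 w (base_vec a i))" for i
    by (subst l[of i], subst m[of i]) (rule refl)
  then show ?thesis unfolding reciprocal_def by presburger
qed

text \<open>Rows 2 to 6 are the coefficients of the limb equations in the unknowns (R^T u, T - u),
  where they depend neither on \<open>R\<close> nor on \<open>w\<close>. Row 1 is free because both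
  vectors of the first joint are zero.\<close>

definition arch_matrix :: "architecture \<Rightarrow> complex^6 \<Rightarrow> complex^6^6" where
  "arch_matrix a v = (\<chi> i. if i = 1 then v else join6 (plat_vec a i) (base_vec a i))"

definition arch_minors :: "architecture \<Rightarrow> complex^6" where
  "arch_minors a = row_cofactors (arch_matrix a 0) 1"

definition minor_p :: "architecture \<Rightarrow> complex^3" where
  "minor_p a = fst6 (arch_minors a)"

definition minor_r :: "architecture \<Rightarrow> complex^3" where
  "minor_r a = snd6 (arch_minors a)"

definition triple_rhs :: "architecture \<Rightarrow> complex^3^3 \<Rightarrow> complex^3 \<Rightarrow> complex^6" where
  "triple_rhs a R w = (\<chi> i. if i = 1 then 0 else - (w \<odot> complex_cross3 (base_vec a i) (R *v plat_vec a i)))"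

text \<open>The minors are orthogonal to rows 2 to 6. Placing them in row 1 makes the determinant
  the sum of their squares, and together with the right-hand side 0 in row 1 it singles out the
  particular solution orthogonal to them.\<close>

definition frame :: "architecture \<Rightarrow> complex^6^6" where
  "frame a = arch_matrix a (arch_minors a)"

text \<open>Cramer's rule for the system with matrix \<^term>\<open>frame a\<close>.\<close>

definition particular :: "architecture \<Rightarrow> complex^3^3 \<Rightarrow> complex^3 \<Rightarrow> complex^6" where
  "particular a R w = (\<chi> k. det (\<chi> i j. if j = k then triple_rhs a R w $ i else frame a $ i $ j) / det (frame a))"

text \<open>Along the line of solutions with parameter t the condition T.w = 0 reads
  \<open>quad_c + t * quad_g = 0\<close>. The first form is quadratic in \<open>w\<close>, the
  second linear.\<close>

definition quad_c :: "architecture \<Rightarrow> complex^3^3 \<Rightarrow> complex^3 \<Rightarrow> complex" where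
  "quad_c a R w = w \<odot> (R *v fst6 (particular a R w) + snd6 (particular a R w))"

definition axis_vec :: "architecture \<Rightarrow> complex^3^3 \<Rightarrow> complex^3" where
  "axis_vec a R = R *v minor_p a + minor_r a"

definition quad_g :: "architecture \<Rightarrow> complex^3^3 \<Rightarrow> complex^3 \<Rightarrow> complex" where
  "quad_g a R w = w \<odot> axis_vec a R"

definition screw_u :: "architecture \<Rightarrow> complex^3^3 \<Rightarrow> complex^3 \<Rightarrow> complex \<Rightarrow> complex^3" where
  "screw_u a R w t = R *v (fst6 (particular a R w) + t *s minor_p a)"

definition screw_T :: "architecture \<Rightarrow> complex^3^3 \<Rightarrow> complex^3 \<Rightarrow> complex \<Rightarrow> complex^3" where
  "screw_T a R w t = snd6 (particular a R w) + t *s minor_r a + screw_u a R w t"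

text \<open>The quotient (u x T) / (u.w) solves the problem in the frames with origin at the first
  joints; the other two terms undo the change of origins.\<close>

definition position :: "architecture \<Rightarrow> complex^3^3 \<Rightarrow> complex^3 \<Rightarrow> complex \<Rightarrow> complex^3" where
  "position a R w t = (1 / (screw_u a R w t \<odot> w)) *s complex_cross3 (screw_u a R w t) (screw_T a R w t)
     - R *v plat_pt a 1 + base_pt a 1"

lemma frame_mult_minors: "frame a *v arch_minors a = det (frame a) *s axis 1 1"
proof -
  have "arch_matrix a (arch_minors a) = (\<chi> r. if r = 1 then arch_minors a else arch_matrix a 0 $ r)"
    by (simp add: arch_matrix_def vec_eq_iff)
  then have "row_cofactors (frame a) 1 = arch_minors a"
    by (simp add: frame_def row_cofactors_replace arch_minors_def)
  then show ?thesis using mult_row_cofactors[of "frame a" 1] by simp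
qed

lemma det_arch_matrix: "det (arch_matrix a (join6 x y)) = x \<odot> minor_p a + y \<odot> minor_r a"
proof -
  have "arch_matrix a (join6 x y) = (\<chi> r. if r = 1 then join6 x y else arch_matrix a 0 $ r)"
    by (simp add: arch_matrix_def vec_eq_iff)
  then show ?thesis
    by (simp add: det_replace_row sum_join6 minor_p_def minor_r_def arch_minors_def)
qed

lemma det_frame: "det (frame a) = minor_p a \<odot> minor_p a + minor_r a \<odot> minor_r a"
  using det_arch_matrix[of a "minor_p a" "minor_r a"] by (simp add: frame_def minor_p_def minor_r_def)

lemma frame_mult_particular:
  assumes "det (frame a) \<noteq> 0"
  shows "frame a *v particular a R w = triple_rhs a R w"
  using cramer[OF assms, of "particular a R w" "triple_rhs a R w"] by (simp add: particular_def)

lemma frame_mult_component: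
  "i \<noteq> 1 \<Longrightarrow> (frame a *v v) $ i = plat_vec a i \<odot> fst6 v + base_vec a i \<odot> snd6 v"
  by (simp add: frame_def arch_matrix_def matrix_vector_mult_def sum_join6)

text \<open>The difference from the particular solution is annihilated by rows 2 to 6. A multiple of
  the minors corrects row 1 without affecting these rows, and what remains is zero because the frame
  is regular.\<close>

lemma limb_equations_solution:
  assumes "det (frame a) \<noteq> 0"
  shows "(\<forall>i. i \<noteq> 1 \<longrightarrow> plat_vec a i \<odot> x + base_vec a i \<odot> y
            = - (w \<odot> complex_cross3 (base_vec a i) (R *v plat_vec a i)))
     \<longleftrightarrow> (\<exists>t. x = fst6 (particular a R w) + t *s minor_p a \<and> y = snd6 (particular a R w) + t *s minor_r a)"
    (is "?L \<longleftrightarrow> ?R")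
proof
  assume L: ?L
  define d where "d = join6 x y - particular a R w"
  define t where "t = (frame a *v d) $ 1 / det (frame a)"
  have "(frame a *v d) $ i = 0" if "i \<noteq> 1" for i
  proof -
    have "(frame a *v particular a R w) $ i = (frame a *v join6 x y) $ i"
      using L that by (simp add: frame_mult_particular[OF assms] frame_mult_component triple_rhs_def)
    then show ?thesis by (simp add: d_def matrix_vector_mult_diff_distrib)
  qed
  then have "frame a *v (d - t *s arch_minors a) = 0"
    using assms
    by (simp add: matrix_vector_mult_diff_distrib vector_scalar_commute frame_mult_minors t_def
        vec_eq_iff axis_def)
  then have "d - t *s arch_minors a = 0"
    using assms det_eq_0_iff_kernel by blast
  then have e: "join6 x y = particular a R w + t *s arch_minors a"
    by (simp add: d_def algebra_simps)
  have "x = fst6 (join6 x y)" "y = snd6 (join6 x y)" by simp_all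
  then show ?R
    unfolding e by (intro exI[of _ t]) (simp add: fst6_linear snd6_linear minor_p_def minor_r_def)
next
  assume ?R
  then obtain t where t: "x = fst6 (particular a R w) + t *s minor_p a" "y = snd6 (particular a R w) + t *s minor_r a"
    by blast
  show ?L
  proof (intro allI impI)
    fix i :: 6 assume i: "i \<noteq> 1"
    have "plat_vec a i \<odot> x + base_vec a i \<odot> y = (frame a *v (particular a R w + t *s arch_minors a)) $ i"
      unfolding t using i
      by (simp add: frame_mult_component fst6_linear snd6_linear minor_p_def minor_r_def)
    also have "\<dots> = triple_rhs a R w $ i"
      using i by (simp add: matrix_vector_right_distrib vector_scalar_commute frame_mult_minors
          frame_mult_particular[OF assms] axis_def)
    finally show "plat_vec a i \<odot> x + base_vec a i \<odot> y
            = - (w \<odot> complex_cross3 (base_vec a i) (R *v plat_vec a i))"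
      using i by (simp add: triple_rhs_def)
  qed
qed

text \<open>The first limb contributes only Q.v = 0. Subtracting this from the other equations
  removes their term in \<open>Q\<close> alone, so \<open>Q\<close> survives only through Q x w and
  the system becomes linear in (R^T v, Q x w - v).\<close>

lemma reciprocal_reduced:
  assumes R: "orthogonal_matrix R"
    and Q: "Q = P + R *v plat_pt a 1 - base_pt a 1"
    and v: "v = u + complex_cross3 w (base_pt a 1)"
  shows "reciprocal a R P u w \<longleftrightarrow> Q \<odot> v = 0 \<and>
    (\<forall>i. i \<noteq> 1 \<longrightarrow> plat_vec a i \<odot> (transpose R *v v) + base_vec a i \<odot> (complex_cross3 Q w - v)
            = - (w \<odot> complex_cross3 (base_vec a i) (R *v plat_vec a i)))"
proof -
  have eq: "(R *v plat_vec a i - base_vec a i + Q) \<odot> (v + complex_cross3 w (base_vec a i)) =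
    Q \<odot> v + (plat_vec a i \<odot> (transpose R *v v) + base_vec a i \<odot> (complex_cross3 Q w - v)
            + w \<odot> complex_cross3 (base_vec a i) (R *v plat_vec a i))" for i
  proof -
    have "plat_vec a i \<odot> (transpose R *v v) = (R *v plat_vec a i) \<odot> v"
      by (simp add: cdot_matrix)
    then show ?thesis by (simp add: vec3_simps algebra_simps)
  qed
  have zero: "base_vec a 1 = 0" "plat_vec a 1 = 0" by (simp_all add: base_vec_def plat_vec_def)
  have first: "plat_vec a 1 \<odot> (transpose R *v v) + base_vec a 1 \<odot> (complex_cross3 Q w - v)
            + w \<odot> complex_cross3 (base_vec a 1) (R *v plat_vec a 1) = 0"
    by (simp add: zero vec3_simps)
  have "reciprocal a R P u w \<longleftrightarrow> (\<forall>i. Q \<odot> v + (plat_vec a i \<odot> (transpose R *v v)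
      + base_vec a i \<odot> (complex_cross3 Q w - v)
            + w \<odot> complex_cross3 (base_vec a i) (R *v plat_vec a i)) = 0)"
    unfolding reciprocal_first_joint Q[symmetric] v[symmetric] eq ..
  also have "\<dots> \<longleftrightarrow> Q \<odot> v = 0 \<and> (\<forall>i. i \<noteq> 1 \<longrightarrow> plat_vec a i \<odot> (transpose R *v v)
      + base_vec a i \<odot> (complex_cross3 Q w - v)
            + w \<odot> complex_cross3 (base_vec a i) (R *v plat_vec a i) = 0)"
    (is "(\<forall>i. ?q + ?e i = 0) \<longleftrightarrow> _")
  proof
    assume all: "\<forall>i. ?q + ?e i = 0"
    then have "?q + ?e 1 = 0" ..
    then have "?q = 0" by (simp only: first add_0_right)
    then show "?q = 0 \<and> (\<forall>i. i \<noteq> 1 \<longrightarrow> ?e i = 0)" using all by simp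
  next
    assume h: "?q = 0 \<and> (\<forall>i. i \<noteq> 1 \<longrightarrow> ?e i = 0)"
    have "?e i = 0" for i using first h by (cases "i = 1") blast+
    then show "\<forall>i. ?q + ?e i = 0" using h by simp
  qed
  finally show ?thesis by (simp add: eq_neg_iff_add_eq_0)
qed

text \<open>Since T.w = 0, the identity (v x T) x w = (v.w) T - (T.w) v gives Q x w = T for Q = (v x
  T) / (v.w).\<close>

lemma reciprocal_position:
  assumes R: "orthogonal_matrix R" and G: "det (frame a) \<noteq> 0"
    and quad: "quad_c a R w + t * quad_g a R w = 0" and pitch: "screw_u a R w t \<odot> w \<noteq> 0"
  shows "reciprocal a R (position a R w t) (screw_u a R w t - complex_cross3 w (base_pt a 1)) w"
proof -
  define v where "v = screw_u a R w t"
  define T where "T = screw_T a R w t"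
  define Q where "Q = (1 / (v \<odot> w)) *s complex_cross3 v T"
  have Tw: "T \<odot> w = 0"
    using quad by (simp add: T_def screw_T_def screw_u_def quad_c_def quad_g_def axis_vec_def
        matrix_vector_right_distrib vector_scalar_commute cdot_linear cdot_commute[of _ w] algebra_simps)
  have "complex_cross3 Q w = (1 / (v \<odot> w)) *s complex_cross3 (complex_cross3 v T) w"
    by (simp add: Q_def cross_smult)
  also have "\<dots> = T"
    using pitch by (simp add: cross_cross Tw v_def vector_smult_assoc)
  finally have QT: "complex_cross3 Q w = T" .
  have Qv: "Q \<odot> v = 0" by (simp add: Q_def cdot_smult)
  have x: "transpose R *v v = fst6 (particular a R w) + t *s minor_p a"
    by (simp only: v_def screw_u_def orthogonal_matrix_cancel[OF R])
  have y: "complex_cross3 Q w - v = snd6 (particular a R w) + t *s minor_r a"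
    by (simp add: QT T_def screw_T_def v_def)
  have "reciprocal a R (position a R w t) (v - complex_cross3 w (base_pt a 1)) w \<longleftrightarrow> Q \<odot> v = 0 \<and>
    (\<forall>i. i \<noteq> 1 \<longrightarrow> plat_vec a i \<odot> (transpose R *v v) + base_vec a i \<odot> (complex_cross3 Q w - v)
            = - (w \<odot> complex_cross3 (base_vec a i) (R *v plat_vec a i)))"
    by (rule reciprocal_reduced[OF R]) (simp_all add: position_def Q_def v_def T_def)
  then show ?thesis
    using Qv limb_equations_solution[OF G, of "transpose R *v v" "complex_cross3 Q w - v" w R] x y
    unfolding v_def by blast
qed

text \<open>The converse rests on v x (Q x w) = (v.w) Q - (Q.v) w, where Q.v = 0. The equations for
  \<open>t\<close> and for the screw hold at pitch zero too; only the recovery of \<open>P\<close>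
  divides by the pitch form.\<close>

lemma position_of_reciprocal:
  assumes R: "orthogonal_matrix R" and G: "det (frame a) \<noteq> 0" and rec: "reciprocal a R P u w"
  shows "\<exists>t. quad_c a R w + t * quad_g a R w = 0
    \<and> screw_u a R w t = u + complex_cross3 w (base_pt a 1)
    \<and> screw_T a R w t = complex_cross3 (P + R *v plat_pt a 1 - base_pt a 1) w
    \<and> (u \<odot> w \<noteq> 0 \<longrightarrow> position a R w t = P)"
proof -
  define v where "v = u + complex_cross3 w (base_pt a 1)"
  define Q where "Q = P + R *v plat_pt a 1 - base_pt a 1"
  have Qv: "Q \<odot> v = 0" and eqs: "\<forall>i. i \<noteq> 1 \<longrightarrow> plat_vec a i \<odot> (transpose R *v v) + base_vec a i \<odot> (complex_cross3 Q w - v)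
            = - (w \<odot> complex_cross3 (base_vec a i) (R *v plat_vec a i))"
    using reciprocal_reduced[OF R Q_def v_def] rec by auto
  then obtain t where t: "transpose R *v v = fst6 (particular a R w) + t *s minor_p a"
      "complex_cross3 Q w - v = snd6 (particular a R w) + t *s minor_r a"
    using limb_equations_solution[OF G, of "transpose R *v v" "complex_cross3 Q w - v" w R] by blast
  have u: "screw_u a R w t = v"
    by (simp only: screw_u_def t(1)[symmetric] orthogonal_matrix_cancel[OF R])
  have T: "screw_T a R w t = complex_cross3 Q w"
    using t(2)[symmetric] by (simp add: screw_T_def u)
  have "screw_T a R w t \<odot> w = quad_c a R w + t * quad_g a R w"
    by (simp add: screw_T_def screw_u_def quad_c_def quad_g_def axis_vec_def
        matrix_vector_right_distrib vector_scalar_commute cdot_linear cdot_commute[of _ w] algebra_simps)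
  then have quad: "quad_c a R w + t * quad_g a R w = 0" by (simp add: T)
  have vw: "v \<odot> w = u \<odot> w" by (simp add: v_def cdot_linear)
  have "position a R w t = P" if "u \<odot> w \<noteq> 0"
  proof -
    have "complex_cross3 v (complex_cross3 Q w) = (v \<odot> w) *s Q - (Q \<odot> v) *s w"
      by (simp add: vec3_simps algebra_simps)
    then have "(1 / (v \<odot> w)) *s complex_cross3 v (complex_cross3 Q w) = Q"
      using that by (simp add: Qv vw vector_smult_assoc)
    then show ?thesis by (simp add: position_def u T Q_def)
  qed
  then show ?thesis using quad u T unfolding v_def Q_def by blast
qed

text \<open>Two conditions in one: p.p + r.r is nonzero, which makes the frame regular, and p.p
  differs from r.r, which keeps R p + r from vanishing for every orthogonal R.\<close>

definition nondegenerate :: "architecture \<Rightarrow> bool" where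
  "nondegenerate a \<longleftrightarrow> (minor_p a \<odot> minor_p a)^2 \<noteq> (minor_r a \<odot> minor_r a)^2"

lemma nondegenerate_det_frame: "nondegenerate a \<Longrightarrow> det (frame a) \<noteq> 0"
  unfolding nondegenerate_def det_frame by (metis add_eq_0_iff power2_minus)

lemma axis_vec_nonzero:
  assumes "orthogonal_matrix R" "nondegenerate a"
  shows "axis_vec a R \<noteq> 0"
proof
  assume "axis_vec a R = 0"
  then have r: "minor_r a = - (R *v minor_p a)" by (simp add: axis_vec_def add_eq_0_iff)
  have "minor_r a \<odot> minor_r a = minor_p a \<odot> minor_p a"
    unfolding r by (simp add: cdot_uminus cdot_orthogonal[OF assms(1)])
  then show False using assms(2) by (simp add: nondegenerate_def)
qed

text \<open>For \<open>w = 0\<close> the linear system is homogeneous, so T = t (R p + r), while T =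
  Q x w = 0. Hence t = 0 and \<open>u = 0\<close>.\<close>

lemma reciprocal_direction_nonzero:
  assumes R: "orthogonal_matrix R" and a: "nondegenerate a" and rec: "reciprocal a R P u 0"
  shows "u = 0"
proof -
  note G = nondegenerate_det_frame[OF a]
  have "triple_rhs a R 0 = 0" by (simp add: triple_rhs_def vec_eq_iff)
  then have "frame a *v particular a R 0 = 0" by (simp add: frame_mult_particular[OF G])
  then have part: "particular a R 0 = 0" using G det_eq_0_iff_kernel by blast
  have c0: "complex_cross3 0 x = 0" "complex_cross3 x 0 = 0" for x by (simp_all add: vec_eq_iff forall_3)
  obtain t where t: "screw_u a R 0 t = u" "screw_T a R 0 t = 0"
    using position_of_reciprocal[OF R G rec] by (auto simp: c0)
  have "t *s axis_vec a R = 0"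
    using t(2) by (simp add: screw_T_def screw_u_def part fst6_linear snd6_linear axis_vec_def
        vector_scalar_commute vector_add_ldistrib add.commute)
  then have "t = 0" using axis_vec_nonzero[OF R a] by simp
  then show ?thesis using t(1) by (simp add: screw_u_def part fst6_linear)
qed

section \<open>The Cayley parametrization of rotations\<close>

text \<open>The unnormalised rotation matrix of the quaternion 1 + q_1 i + q_2 j + q_3 k;
  \<open>cayley_den\<close> is the squared norm of that quaternion.\<close>

definition cayley_num :: "complex^3 \<Rightarrow> complex^3^3" where
  "cayley_num q = vector [
     vector [1 + q$1^2 - q$2^2 - q$3^2, 2 * (q$1 * q$2 - q$3), 2 * (q$1 * q$3 + q$2)],
     vector [2 * (q$1 * q$2 + q$3), 1 - q$1^2 + q$2^2 - q$3^2, 2 * (q$2 * q$3 - q$1)],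
     vector [2 * (q$1 * q$3 - q$2), 2 * (q$2 * q$3 + q$1), 1 - q$1^2 - q$2^2 + q$3^2]]"

definition cayley_den :: "complex^3 \<Rightarrow> complex" where
  "cayley_den q = 1 + q$1^2 + q$2^2 + q$3^2"

definition cayley :: "complex^3 \<Rightarrow> complex^3^3" where
  "cayley q = (\<chi> i j. cayley_num q $ i $ j / cayley_den q)"

definition rotation :: "complex^3^3 \<Rightarrow> bool" where
  "rotation R \<longleftrightarrow> orthogonal_matrix R \<and> det R = 1"

lemma rotation_orthogonal: "rotation R \<Longrightarrow> orthogonal_matrix R"
  by (simp add: rotation_def)

text \<open>The half turn about the \<open>k\<close>-th axis. Multiplying by it reaches rotations
  with 1 + trace = 0, which have no Cayley coordinates.\<close>

definition flip :: "3 \<Rightarrow> complex^3^3" where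
  "flip k = (\<chi> i j. if i = j then (if i = k then 1 else -1) else 0)"

definition cayley_coords :: "complex^3^3 \<Rightarrow> complex^3" where
  "cayley_coords R = vector [(R$3$2 - R$2$3) / (1 + trace R), (R$1$3 - R$3$1) / (1 + trace R),
     (R$2$1 - R$1$2) / (1 + trace R)]"

lemmas mat3_simps = vec_eq_iff[where 'b = 3] forall_3 matrix_matrix_mult_def transpose_def sum_3 mat_def

lemma cayley_num_orthogonal: "transpose (cayley_num q) ** cayley_num q = mat (cayley_den q ^ 2)"
  by (simp add: mat3_simps cayley_num_def cayley_den_def power2_eq_square algebra_simps)

lemma det_cayley_num: "det (cayley_num q) = cayley_den q ^ 3"
  by (simp add: det_3 cayley_num_def cayley_den_def power2_eq_square power3_eq_cube algebra_simps)

lemma cayley_eq: "cayley q = mat (1 / cayley_den q) ** cayley_num q"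
  by (simp add: cayley_def mat3_simps)

lemma rotation_cayley:
  assumes "cayley_den q \<noteq> 0"
  shows "rotation (cayley q)"
proof -
  have "(\<Sum>k\<in>UNIV. cayley_num q $ k $ i / cayley_den q * (cayley_num q $ k $ j / cayley_den q)) = (if i = j then 1 else 0)"
    for i j
  proof -
    have "(\<Sum>k\<in>UNIV. cayley_num q $ k $ i * cayley_num q $ k $ j) = (if i = j then cayley_den q ^ 2 else 0)"
      using cayley_num_orthogonal[of q]
      by (simp add: vec_eq_iff[where 'b = 3] matrix_matrix_mult_def transpose_def mat_def)
    then show ?thesis using assms
      by (simp add: sum_divide_distrib[symmetric] power2_eq_square)
  qed
  then have "transpose (cayley q) ** cayley q = mat 1"
    by (simp add: vec_eq_iff[where 'b = 3] matrix_matrix_mult_def transpose_def mat_def cayley_def)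
  then have "orthogonal_matrix (cayley q)"
    by (simp add: orthogonal_matrix_def matrix_left_right_inverse)
  moreover have "det (cayley q) = det (cayley_num q) / cayley_den q ^ 3"
    using assms by (simp add: det_3 cayley_def power3_eq_cube field_simps)
  ultimately show ?thesis using assms by (simp add: rotation_def det_cayley_num)
qed

lemma trace_cayley:
  assumes "cayley_den q \<noteq> 0"
  shows "1 + trace (cayley q) = 4 / cayley_den q"
proof -
  have "cayley_den q + (cayley_num q $ 1 $ 1 + cayley_num q $ 2 $ 2 + cayley_num q $ 3 $ 3) = 4"
    by (simp add: cayley_num_def cayley_den_def)
  moreover have "1 + trace (cayley q) =
      (cayley_den q + (cayley_num q $ 1 $ 1 + cayley_num q $ 2 $ 2 + cayley_num q $ 3 $ 3)) / cayley_den q"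
    using assms by (simp add: trace_def sum_3 cayley_def add_divide_distrib)
  ultimately show ?thesis by simp
qed

text \<open>In the chart turned by \<open>flip k\<close> the rotations without Cayley coordinates
  form the hyperplane \<open>q $ k = 0\<close>, so they can be avoided by
  \<open>zero_near_off_hyperplane\<close>.\<close>

lemma trace_flip_cayley:
  assumes "cayley_den q \<noteq> 0"
  shows "1 + trace (flip k ** cayley q) = 4 * q $ k ^ 2 / cayley_den q"
proof -
  have "cayley_den q + (flip k $ 1 $ 1 * cayley_num q $ 1 $ 1 + flip k $ 2 $ 2 * cayley_num q $ 2 $ 2
      + flip k $ 3 $ 3 * cayley_num q $ 3 $ 3) = 4 * q $ k ^ 2"
    using exhaust_3[of k] by (auto simp: cayley_num_def cayley_den_def flip_def)
  moreover have "1 + trace (flip k ** cayley q) =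
      (cayley_den q + (flip k $ 1 $ 1 * cayley_num q $ 1 $ 1 + flip k $ 2 $ 2 * cayley_num q $ 2 $ 2
      + flip k $ 3 $ 3 * cayley_num q $ 3 $ 3)) / cayley_den q"
    using assms
    by (simp add: trace_def sum_3 matrix_matrix_mult_def cayley_def add_divide_distrib)
       (simp add: flip_def)
  ultimately show ?thesis by simp
qed

lemma cayley_coords_cayley:
  assumes "cayley_den q \<noteq> 0"
  shows "cayley_coords (cayley q) = q"
  unfolding cayley_coords_def trace_cayley[OF assms]
  using assms by (simp add: vec_eq_iff forall_3 cayley_def cayley_num_def field_simps)

text \<open>Applying \<open>R\<close> to a cross product of two of its rows lists triple products of
  rows, which form a unit vector because \<open>det R = 1\<close>; orthogonality then inverts
  \<open>R\<close>.\<close>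

lemma rotation_cross_rows:
  assumes "rotation R"
  shows "complex_cross3 (R $ 2) (R $ 3) = R $ 1" "complex_cross3 (R $ 3) (R $ 1) = R $ 2"
    "complex_cross3 (R $ 1) (R $ 2) = R $ 3"
proof -
  have d: "det R = 1" and o: "orthogonal_matrix R" using assms by (auto simp: rotation_def)
  have *: "complex_cross3 (R $ i) (R $ j) = R $ k" if "R *v complex_cross3 (R $ i) (R $ j) = axis k 1" for i j k
  proof -
    have "complex_cross3 (R $ i) (R $ j) = transpose R *v axis k 1"
      using that orthogonal_matrix_cancel(2)[OF o] by metis
    also have "\<dots> = R $ k"
      by (simp del: transpose_matrix_vector add: matrix_vector_mult_def transpose_def vec_eq_iff axis_def
          if_distrib[of "\<lambda>x. _ * x"] sum.delta cong: if_cong)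
    finally show ?thesis .
  qed
  show "complex_cross3 (R $ 2) (R $ 3) = R $ 1" "complex_cross3 (R $ 3) (R $ 1) = R $ 2"
    "complex_cross3 (R $ 1) (R $ 2) = R $ 3"
    by (rule *, use d in \<open>simp add: vec_eq_iff forall_3 matrix_vector_mult_def sum_3 axis_def det_3 algebra_simps\<close>)+
qed

lemma rotation_cofactors:
  assumes "rotation R"
  shows "R$1$1 = R$2$2 * R$3$3 - R$2$3 * R$3$2" "R$1$2 = R$2$3 * R$3$1 - R$2$1 * R$3$3"
    "R$1$3 = R$2$1 * R$3$2 - R$2$2 * R$3$1"
    "R$2$1 = R$3$2 * R$1$3 - R$3$3 * R$1$2" "R$2$2 = R$3$3 * R$1$1 - R$3$1 * R$1$3"
    "R$2$3 = R$3$1 * R$1$2 - R$3$2 * R$1$1"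
    "R$3$1 = R$1$2 * R$2$3 - R$1$3 * R$2$2" "R$3$2 = R$1$3 * R$2$1 - R$1$1 * R$2$3"
    "R$3$3 = R$1$1 * R$2$2 - R$1$2 * R$2$1"
  using rotation_cross_rows[OF assms] by (simp_all add: vec_eq_iff forall_3)

text \<open>Says that (t, x, y, z) is a quaternion of squared norm 4t representing the rotation. The
  entries are separate scalars so that the identities are ideal memberships, proved by
  \<open>algebra\<close> from the few relations that each one needs.\<close>

lemma rotation_polynomials:
  fixes a b c d e f g h i :: complex
  assumes rows: "a*a + b*b + c*c = 1" "d*d + e*e + f*f = 1" "g*g + h*h + i*i = 1"
      "a*d + b*e + c*f = 0" "a*g + b*h + c*i = 0" "d*g + e*h + f*i = 0"
    and cols: "a*a + d*d + g*g = 1" "b*b + e*e + h*h = 1" "c*c + f*f + i*i = 1"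
      "a*b + d*e + g*h = 0" "a*c + d*f + g*i = 0" "b*c + e*f + h*i = 0"
    and cof: "a = e*i - f*h" "b = f*g - d*i" "c = d*h - e*g" "d = h*c - i*b" "e = i*a - g*c"
      "f = g*b - h*a" "g = b*f - c*e" "h = c*d - a*f" "i = a*e - b*d"
    and t: "t = 1 + a + e + i" and v: "x = h - f" "y = c - g" "z = d - b"
  shows "t*t + x*x + y*y + z*z = 4*t"
    "t*t + x*x - y*y - z*z = 4*t*a" "t*t - x*x + y*y - z*z = 4*t*e" "t*t - x*x - y*y + z*z = 4*t*i"
    "2*(x*y - t*z) = 4*t*b" "2*(x*y + t*z) = 4*t*d" "2*(x*z + t*y) = 4*t*c" "2*(x*z - t*y) = 4*t*g"
    "2*(y*z - t*x) = 4*t*f" "2*(y*z + t*x) = 4*t*h"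
proof -
  show 1: "t*t + x*x + y*y + z*z = 4*t" unfolding t v using rows(1-3) cof(1,5,9) by algebra
  show "t*t + x*x - y*y - z*z = 4*t*a"
    using 1 unfolding t v using rows(1) cols(1) cof(5,9) by algebra
  show "t*t - x*x + y*y - z*z = 4*t*e"
    using 1 unfolding t v using rows(2) cols(2) cof(1,9) by algebra
  show "t*t - x*x - y*y + z*z = 4*t*i"
    using 1 unfolding t v using rows(3) cols(3) cof(1,5) by algebra
  show "2*(x*y - t*z) = 4*t*b" "2*(x*y + t*z) = 4*t*d"
    unfolding t v using rows(4) cols(4) cof(2,4) by algebra+
  show "2*(x*z + t*y) = 4*t*c" "2*(x*z - t*y) = 4*t*g"
    unfolding t v using rows(5) cols(5) cof(3,7) by algebra+
  show "2*(y*z - t*x) = 4*t*f" "2*(y*z + t*x) = 4*t*h"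
    unfolding t v using rows(6) cols(6) cof(6,8) by algebra+
qed

lemma cayley_cayley_coords:
  assumes R: "rotation R" and tr: "1 + trace R \<noteq> 0"
  shows "cayley_den (cayley_coords R) = 4 / (1 + trace R)" "cayley (cayley_coords R) = R"
proof -
  define t where "t = 1 + trace R"
  have t: "t = 1 + R$1$1 + R$2$2 + R$3$3" by (simp add: t_def trace_def sum_3)
  have t0: "t \<noteq> 0" using tr by (simp add: t_def)
  define x y z where v: "x = R$3$2 - R$2$3" "y = R$1$3 - R$3$1" "z = R$2$1 - R$1$2"
  have q: "cayley_coords R = vector [x / t, y / t, z / t]"
    by (simp add: cayley_coords_def t_def v)
  have o: "transpose R ** R = mat 1" "R ** transpose R = mat 1"
    using R by (auto simp: rotation_def orthogonal_matrix_def)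
  have rows: "R$1$1*R$1$1 + R$1$2*R$1$2 + R$1$3*R$1$3 = 1" "R$2$1*R$2$1 + R$2$2*R$2$2 + R$2$3*R$2$3 = 1"
      "R$3$1*R$3$1 + R$3$2*R$3$2 + R$3$3*R$3$3 = 1" "R$1$1*R$2$1 + R$1$2*R$2$2 + R$1$3*R$2$3 = 0"
      "R$1$1*R$3$1 + R$1$2*R$3$2 + R$1$3*R$3$3 = 0" "R$2$1*R$3$1 + R$2$2*R$3$2 + R$2$3*R$3$3 = 0"
    using o(2) by (simp_all add: mat3_simps)
  have cols: "R$1$1*R$1$1 + R$2$1*R$2$1 + R$3$1*R$3$1 = 1" "R$1$2*R$1$2 + R$2$2*R$2$2 + R$3$2*R$3$2 = 1"
      "R$1$3*R$1$3 + R$2$3*R$2$3 + R$3$3*R$3$3 = 1" "R$1$1*R$1$2 + R$2$1*R$2$2 + R$3$1*R$3$2 = 0"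
      "R$1$1*R$1$3 + R$2$1*R$2$3 + R$3$1*R$3$3 = 0" "R$1$2*R$1$3 + R$2$2*R$2$3 + R$3$2*R$3$3 = 0"
    using o(1) by (simp_all add: mat3_simps)
  note poly = rotation_polynomials[OF rows cols rotation_cofactors[OF R] t v]
  have "cayley_den (cayley_coords R) = (t*t + x*x + y*y + z*z) / (t * t)"
    using t0 by (simp add: cayley_den_def q power2_eq_square field_simps)
  then have den: "cayley_den (cayley_coords R) = 4 / t"
    using t0 by (simp add: poly(1))
  then show "cayley_den (cayley_coords R) = 4 / (1 + trace R)" by (simp add: t_def)
  have diag: "cayley_num (cayley_coords R) $ 1 $ 1 = (t*t + x*x - y*y - z*z) / (t * t)"
    "cayley_num (cayley_coords R) $ 2 $ 2 = (t*t - x*x + y*y - z*z) / (t * t)"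
    "cayley_num (cayley_coords R) $ 3 $ 3 = (t*t - x*x - y*y + z*z) / (t * t)"
    "cayley_num (cayley_coords R) $ 1 $ 2 = (2*(x*y - t*z)) / (t * t)"
    "cayley_num (cayley_coords R) $ 2 $ 1 = (2*(x*y + t*z)) / (t * t)"
    "cayley_num (cayley_coords R) $ 1 $ 3 = (2*(x*z + t*y)) / (t * t)"
    "cayley_num (cayley_coords R) $ 3 $ 1 = (2*(x*z - t*y)) / (t * t)"
    "cayley_num (cayley_coords R) $ 2 $ 3 = (2*(y*z - t*x)) / (t * t)"
    "cayley_num (cayley_coords R) $ 3 $ 2 = (2*(y*z + t*x)) / (t * t)"
    using t0 by (simp_all add: cayley_num_def q power2_eq_square field_simps)
  show "cayley (cayley_coords R) = R"
    unfolding cayley_def den vec_eq_iff[where 'b = 3] forall_3 vec_lambda_beta diag poly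
    using t0 by simp
qed

lemma flip_flip: "flip k ** flip k = mat 1"
  and transpose_flip: "transpose (flip k) = flip k"
  using exhaust_3[of k] by (auto simp: mat3_simps flip_def)

lemma det_flip: "det (flip k) = 1"
  using exhaust_3[of k] by (auto simp: det_3 flip_def)

lemma rotation_mult: "rotation R \<Longrightarrow> rotation S \<Longrightarrow> rotation (R ** S)"
  unfolding rotation_def orthogonal_matrix_def det_mul matrix_transpose_mul
  by (metis matrix_mul_assoc matrix_mul_lid mult_1)

lemma rotation_flip: "rotation (flip k)"
  by (simp add: rotation_def orthogonal_matrix_def transpose_flip flip_flip det_flip)

text \<open>The four numbers 1 + trace, for \<open>R\<close> and its three turned copies, add up to
  4.\<close>

lemma exists_flip_trace: "\<exists>k. 1 + trace (flip k ** R) \<noteq> 0" if "1 + trace R = 0"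
proof (rule ccontr)
  assume "\<not> ?thesis"
  then have *: "1 + trace (flip k ** R) = 0" for k by blast
  show False using that *[of 1] *[of 2] *[of 3]
    by (simp add: trace_def matrix_matrix_mult_def sum_3 flip_def) algebra
qed

lemma cayley_0: "cayley_num 0 = mat 1" "cayley_den 0 = 1"
  by (simp_all add: cayley_num_def cayley_den_def mat3_simps)

section \<open>Configurations reciprocal to a screw of pitch zero\<close>

context real_function_algebra
begin

lemma cdot_mem:
  "(\<And>i. (\<lambda>x. u x $ i) \<in> S) \<Longrightarrow> (\<And>i. (\<lambda>x. v x $ i) \<in> S) \<Longrightarrow> (\<lambda>x. u x \<odot> v x) \<in> S"
  unfolding cdot_def by (intro sum_mem mult_mem)

lemma cross_mem:
  assumes "\<And>i. (\<lambda>x. u x $ i) \<in> S" "\<And>i. (\<lambda>x. v x $ i) \<in> S"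
  shows "(\<lambda>x. complex_cross3 (u x) (v x) $ i) \<in> S"
  using exhaust_3[of i] by (auto intro!: diff_mem mult_mem assms)

lemma matrix_vector_mem:
  fixes M :: "'x \<Rightarrow> complex^'n^'m"
  assumes "\<And>i j. (\<lambda>x. M x $ i $ j) \<in> S" "\<And>i. (\<lambda>x. v x $ i) \<in> S"
  shows "(\<lambda>x. (M x *v v x) $ i) \<in> S"
  unfolding matrix_vector_mult_def by (simp, intro sum_mem mult_mem assms)

lemma matrix_matrix_mem:
  fixes M :: "'x \<Rightarrow> complex^'n^'m"
  assumes "\<And>i j. (\<lambda>x. M x $ i $ j) \<in> S" "\<And>i j. (\<lambda>x. N x $ i $ j) \<in> S"
  shows "(\<lambda>x. (M x ** N x) $ i $ j) \<in> S"
  unfolding matrix_matrix_mult_def by (simp, intro sum_mem mult_mem assms)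

lemma join6_mem:
  assumes "\<And>i. (\<lambda>x. u x $ i) \<in> S" "\<And>i. (\<lambda>x. v x $ i) \<in> S"
  shows "(\<lambda>x. join6 (u x) (v x) $ i) \<in> S"
  using exhaust_6[of i] by (auto intro: assms)

lemma fst6_mem:
  assumes "\<And>i. (\<lambda>x. u x $ i) \<in> S"
  shows "(\<lambda>x. fst6 (u x) $ i) \<in> S"
  using exhaust_3[of i] by (auto intro: assms)

lemma snd6_mem:
  assumes "\<And>i. (\<lambda>x. u x $ i) \<in> S"
  shows "(\<lambda>x. snd6 (u x) $ i) \<in> S"
  using exhaust_3[of i] by (auto intro: assms)

lemma cayley_den_mem: "(\<And>i. (\<lambda>x. q x $ i) \<in> S) \<Longrightarrow> (\<lambda>x. cayley_den (q x)) \<in> S"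
  unfolding cayley_den_def by (intro mem_intros)

lemma cayley_num_mem:
  assumes "\<And>i. (\<lambda>x. q x $ i) \<in> S"
  shows "(\<lambda>x. cayley_num (q x) $ i $ j) \<in> S"
  using exhaust_3[of i] exhaust_3[of j]
  by (elim disjE) (simp_all add: cayley_num_def, (intro mem_intros assms)+)

lemma row_cofactors_mem:
  assumes "\<And>i j. (\<lambda>x. M x $ i $ j) \<in> S"
  shows "(\<lambda>x. row_cofactors (M x :: complex^'n^'n) i $ j) \<in> S"
proof -
  have "(\<lambda>x. (\<chi> r. if r = i then axis j 1 else M x $ r) $ r $ c) \<in> S" for r c
    by (cases "r = i") (auto simp: axis_def intro: assms mem_intros)
  then show ?thesis unfolding row_cofactors_def by (simp add: det_mem)
qed

end

text \<open>On the complex line X + tY through the real and imaginary parts, the real values of t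
  give real points, and t = \<i> gives \<open>z\<close>.\<close>

lemma poly_over_reals_real_point:
  assumes "poly_over_reals f" "f z \<noteq> 0"
  shows "\<exists>x. f (complex_vec x) \<noteq> 0"
proof (rule ccontr)
  assume no: "\<not> ?thesis"
  define X where "X = complex_vec (\<chi> i. Re (z $ i))"
  define Y where "Y = complex_vec (\<chi> i. Im (z $ i))"
  obtain p where p: "\<And>t. f (X + t *s Y) = poly p t"
    using poly_over_reals_line[OF assms(1)] by blast
  have "poly p (of_real t) = 0" for t
  proof -
    have "X + of_real t *s Y = complex_vec (\<chi> i. Re (z $ i) + t * Im (z $ i))"
      by (simp add: X_def Y_def complex_vec_def vec_eq_iff)
    then show ?thesis using no p by metis
  qed
  then have "range complex_of_real \<subseteq> {t. poly p t = 0}" by auto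
  moreover have "infinite (range complex_of_real)"
    by (simp add: finite_image_iff inj_on_def infinite_UNIV_char_0)
  ultimately have "p = 0" using poly_roots_finite finite_subset by blast
  moreover have "z = X + \<i> *s Y"
    by (simp add: X_def Y_def complex_vec_def vec_eq_iff complex_eq)
  ultimately show False using p[of \<i>] assms(2) by simp
qed

section \<open>Affine charts for lines and for planes through a line\<close>

definition nxt :: "3 \<Rightarrow> 3" where
  "nxt i = (if i = 1 then 2 else if i = 2 then 3 else 1)"

lemma nxt_cases: "nxt 1 = 2" "nxt 2 = 3" "nxt 3 = 1"
  by (simp_all add: nxt_def)

lemma nxt_exhaust: "i = k \<or> i = nxt k \<or> i = nxt (nxt k)"
  using exhaust_3[of i] exhaust_3[of k] by (auto simp: nxt_cases)

lemma nxt_neq [simp]: "nxt k \<noteq> k" "k \<noteq> nxt k" "nxt (nxt k) \<noteq> k" "k \<noteq> nxt (nxt k)"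
  using exhaust_3[of k] by (auto simp: nxt_cases)

definition cyc_vec :: "3 \<Rightarrow> complex \<Rightarrow> complex \<Rightarrow> complex \<Rightarrow> complex^3" where
  "cyc_vec k a b c = (\<chi> i. if i = k then a else if i = nxt k then b else c)"

lemma cyc_vec_eta: "cyc_vec k (v $ k) (v $ nxt k) (v $ nxt (nxt k)) = v"
  using nxt_exhaust[of _ k] by (auto simp: cyc_vec_def vec_eq_iff)

text \<open>The planes through a line whose direction has \<open>k\<close>-th coordinate 1 form a
  projective line; \<open>\<sigma>\<close> selects one of its two affine charts, with coordinate
  \<open>m\<close>.\<close>

definition slope_vec :: "3 \<Rightarrow> bool \<Rightarrow> complex \<Rightarrow> complex^3" where
  "slope_vec k \<sigma> m = cyc_vec k 0 (if \<sigma> then 1 else m) (if \<sigma> then m else 1)"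

lemma slope_vec_component [simp]:
  "slope_vec k \<sigma> m $ k = 0" "slope_vec k \<sigma> m $ nxt k = (if \<sigma> then 1 else m)"
  "slope_vec k \<sigma> m $ nxt (nxt k) = (if \<sigma> then m else 1)"
  by (simp_all add: slope_vec_def cyc_vec_def)

lemma rank_one_chart:
  fixes x1 x2 y1 y2 :: complex
  assumes "x1 * y2 = x2 * y1"
  shows "\<exists>\<sigma> m s t. x1 = s * (if \<sigma> then 1 else m) \<and> x2 = s * (if \<sigma> then m else 1)
    \<and> y1 = t * (if \<sigma> then 1 else m) \<and> y2 = t * (if \<sigma> then m else 1)"
proof -
  consider "x1 \<noteq> 0" | "x1 = 0" "x2 \<noteq> 0" | "x1 = 0" "x2 = 0" "y1 \<noteq> 0" | "x1 = 0" "x2 = 0" "y1 = 0" by blast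
  then show ?thesis
  proof cases
    case 1
    then show ?thesis using assms by (intro exI[of _ True] exI[of _ "x2 / x1"] exI[of _ x1] exI[of _ y1]) (simp add: field_simps)
  next
    case 2
    then show ?thesis using assms by (intro exI[of _ False] exI[of _ 0] exI[of _ x2] exI[of _ y2]) simp
  next
    case 3
    then show ?thesis by (intro exI[of _ True] exI[of _ "y2 / y1"] exI[of _ 0] exI[of _ y1]) simp
  next
    case 4
    then show ?thesis by (intro exI[of _ False] exI[of _ 0] exI[of _ 0] exI[of _ y2]) simp
  qed
qed

text \<open>The vanishing triple product puts \<open>x\<close>, \<open>y\<close> and
  \<open>w\<close> in one plane. Subtracting multiples of \<open>w\<close> to clear coordinate
  \<open>k\<close> leaves two proportional vectors in dimension two, so five scalars describe the
  six coordinates of \<open>x\<close> and \<open>y\<close>.\<close>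

lemma coplanar_chart:
  assumes w: "w $ k = 1" and det0: "y \<odot> complex_cross3 w x = 0"
  shows "\<exists>\<sigma> m \<alpha> s \<beta> t. x = \<alpha> *s w + s *s slope_vec k \<sigma> m \<and> y = \<beta> *s w + t *s slope_vec k \<sigma> m"
proof -
  define x1 x2 y1 y2 where d: "x1 = x $ nxt k - x $ k * w $ nxt k"
    "x2 = x $ nxt (nxt k) - x $ k * w $ nxt (nxt k)"
    "y1 = y $ nxt k - y $ k * w $ nxt k"
    "y2 = y $ nxt (nxt k) - y $ k * w $ nxt (nxt k)"
  have "x1 * y2 - x2 * y1 = y \<odot> complex_cross3 w x"
  proof -
    consider "k = 1" | "k = 2" | "k = 3" using exhaust_3[of k] by blast
    then show ?thesis
    proof cases
      case 1
      show ?thesis using w unfolding d 1 nxt_cases by (simp add: cdot_def sum_3 algebra_simps)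
    next
      case 2
      show ?thesis using w unfolding d 2 nxt_cases by (simp add: cdot_def sum_3 algebra_simps)
    next
      case 3
      show ?thesis using w unfolding d 3 nxt_cases by (simp add: cdot_def sum_3 algebra_simps)
    qed
  qed
  then have "x1 * y2 = x2 * y1" using det0 by simp
  then obtain \<sigma> m s t where *: "x1 = s * (if \<sigma> then 1 else m)" "x2 = s * (if \<sigma> then m else 1)"
     "y1 = t * (if \<sigma> then 1 else m)" "y2 = t * (if \<sigma> then m else 1)"
    using rank_one_chart by blast
  have e: "x $ nxt k = x $ k * w $ nxt k + s * (if \<sigma> then 1 else m)"
    "x $ nxt (nxt k) = x $ k * w $ nxt (nxt k) + s * (if \<sigma> then m else 1)"
    "y $ nxt k = y $ k * w $ nxt k + t * (if \<sigma> then 1 else m)"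
    "y $ nxt (nxt k) = y $ k * w $ nxt (nxt k) + t * (if \<sigma> then m else 1)"
    unfolding *[symmetric] d by simp_all
  have "x $ i = (x $ k *s w + s *s slope_vec k \<sigma> m) $ i" for i
    using nxt_exhaust[of i k]
  proof (elim disjE)
    assume "i = k" then show ?thesis by (simp add: w)
  next
    assume i: "i = nxt k" show ?thesis unfolding i by (simp add: e(1))
  next
    assume i: "i = nxt (nxt k)" show ?thesis unfolding i by (simp add: e(2))
  qed
  moreover have "y $ i = (y $ k *s w + t *s slope_vec k \<sigma> m) $ i" for i
    using nxt_exhaust[of i k]
  proof (elim disjE)
    assume "i = k" then show ?thesis by (simp add: w)
  next
    assume i: "i = nxt k" show ?thesis unfolding i by (simp add: e(3))
  next
    assume i: "i = nxt (nxt k)" show ?thesis unfolding i by (simp add: e(4))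
  qed
  ultimately have x: "x = x $ k *s w + s *s slope_vec k \<sigma> m" and y: "y = y $ k *s w + t *s slope_vec k \<sigma> m"
    by (blast intro: iffD2[OF vec_eq_iff])+
  show ?thesis using x y by blast
qed

text \<open>A screw of pitch zero is a line: \<open>u\<close> is the moment of the direction
  \<open>w\<close> at a point, made unique by letting its \<open>k\<close>-th coordinate be
  zero.\<close>

lemma pitch_zero_cross:
  assumes w: "w $ k = 1" and "u \<odot> w = 0"
  shows "u = complex_cross3 (cyc_vec k 0 (- u $ nxt (nxt k)) (u $ nxt k)) w"
proof -
  have *: "u $ 1 * w $ 1 + u $ 2 * w $ 2 + u $ 3 * w $ 3 = 0"
    using assms(2) by (simp add: cdot_def sum_3)
  consider "k = 1" | "k = 2" | "k = 3" using exhaust_3[of k] by blast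
  then show ?thesis
  proof cases
    case 1
    have "u $ 1 = - (u $ 3 * w $ 3) - u $ 2 * w $ 2" using * w unfolding 1 by algebra
    then show ?thesis using w by (simp add: 1 nxt_cases vec3_simps cyc_vec_def)
  next
    case 2
    have "u $ 2 = - (u $ 1 * w $ 1) - u $ 3 * w $ 3" using * w unfolding 2 by algebra
    then show ?thesis using w by (simp add: 2 nxt_cases vec3_simps cyc_vec_def)
  next
    case 3
    have "u $ 3 = - (u $ 2 * w $ 2) - u $ 1 * w $ 1" using * w unfolding 3 by algebra
    then show ?thesis using w by (simp add: 3 nxt_cases vec3_simps cyc_vec_def)
  qed
qed

section \<open>Parameter count for screws of pitch zero\<close>

type_synonym chart_coords = "complex^(3 + 3)"

definition rot_part :: "chart_coords \<Rightarrow> complex^3" where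
  "rot_part z = (\<chi> i. z $ Inl i)"

definition transl_part :: "chart_coords \<Rightarrow> complex^3" where
  "transl_part z = (\<chi> i. z $ Inr i)"

type_synonym arch_coords = "complex^(((6 \<times> 3) + (6 \<times> 3)) + (3 + 3))"

definition encode :: "architecture \<Rightarrow> chart_coords \<Rightarrow> arch_coords" where
  "encode a z = (\<chi> n. case n of
     Inl m \<Rightarrow> (case m of Inl (i, l) \<Rightarrow> complex_of_real (fst a $ i $ l)
                      | Inr (i, l) \<Rightarrow> complex_of_real (snd a $ i $ l))
   | Inr l \<Rightarrow> z $ l)"

definition replace_coord :: "complex^'n \<Rightarrow> 'n \<Rightarrow> complex \<Rightarrow> complex^'n" where
  "replace_coord z j t = (\<chi> l. if l = j then t else z $ l)"

text \<open>The line met by all limbs passes through \<open>line_pt\<close> with direction \<open>line_dir\<close>; the \<open>i\<close>-th limb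
  lies in the plane spanned by the line and a vector of given slope. The last parameter is the
  freely chosen \<open>j\<close>-th chart coordinate.\<close>

type_synonym params = "complex^((3 + 3) + ((2 + 2) + ((6 \<times> 5) + 1)))"

definition line_dir :: "3 \<Rightarrow> params \<Rightarrow> complex^3" where
  "line_dir k p = cyc_vec k 1 (p $ Inr (Inl (Inl 1))) (p $ Inr (Inl (Inl 2)))"

definition line_pt :: "3 \<Rightarrow> params \<Rightarrow> complex^3" where
  "line_pt k p = cyc_vec k 0 (p $ Inr (Inl (Inr 1))) (p $ Inr (Inl (Inr 2)))"

definition limb_param :: "params \<Rightarrow> 6 \<Rightarrow> 5 \<Rightarrow> complex" where
  "limb_param p i c = p $ Inr (Inr (Inl (i, c)))"

definition rot_param :: "params \<Rightarrow> complex^3" where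
  "rot_param p = (\<chi> i. p $ Inl (Inl i))"

definition transl_param :: "params \<Rightarrow> complex^3" where
  "transl_param p = (\<chi> i. p $ Inl (Inr i))"

text \<open>Denominators are absorbed into the parameters to keep the map polynomial: with \<delta>
  = \<open>cayley_den\<close>, the parameter \<open>transl_param\<close> stands for (c - P) /
  \<delta>, where c is \<open>line_pt\<close>, and the platform coefficients are divided by \<delta>
  as well. Since the inverse rotation is the transpose of \<open>cayley_num\<close> over \<delta>,
  the platform points come out without division.\<close>

definition pitch_zero_map :: "3 \<Rightarrow> (6 \<Rightarrow> bool) \<Rightarrow> (3 + 3) \<Rightarrow> params \<Rightarrow> arch_coords" where
  "pitch_zero_map k \<sigma> j p = (\<chi> n. case n of
     Inl m \<Rightarrow> (case m of
         Inl (i, l) \<Rightarrow> (line_pt k p + limb_param p i 1 *s line_dir k p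
                        + limb_param p i 2 *s slope_vec k (\<sigma> i) (limb_param p i 5)) $ l
       | Inr (i, l) \<Rightarrow> (\<Sum>r\<in>UNIV. cayley_num (rot_param p) $ r $ l
            * (transl_param p + limb_param p i 3 *s line_dir k p
                        + limb_param p i 4 *s slope_vec k (\<sigma> i) (limb_param p i 5)) $ r))
   | Inr l \<Rightarrow> if l = j then p $ Inr (Inr (Inr 1)) else
      (case l of Inl l \<Rightarrow> rot_param p $ l
               | Inr l \<Rightarrow> (line_pt k p - cayley_den (rot_param p) *s transl_param p) $ l))"

context
  notes [intro] = poly.mem_intros poly_over_reals.coord
begin

lemma poly_pitch_zero_map: "poly_over_reals (\<lambda>p. pitch_zero_map k \<sigma> j p $ n)"
proof -
  have 1: "poly_over_reals (\<lambda>p. line_dir k p $ i)" "poly_over_reals (\<lambda>p. line_pt k p $ i)" for i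
    using nxt_exhaust[of i k] by (auto simp: line_dir_def line_pt_def cyc_vec_def)
  have 2: "poly_over_reals (\<lambda>p. limb_param p i c)" for i c
    by (auto simp: limb_param_def)
  have 3: "poly_over_reals (\<lambda>p. rot_param p $ i)" "poly_over_reals (\<lambda>p. transl_param p $ i)" for i
    by (auto simp: rot_param_def transl_param_def)
  have 4: "poly_over_reals (\<lambda>p. slope_vec k s (limb_param p i c) $ l)" for s i c l
    using nxt_exhaust[of l k] by (cases s) (auto simp: slope_vec_def cyc_vec_def intro: 2)
  have 5: "poly_over_reals (\<lambda>p. cayley_num (rot_param p) $ r $ l)" "poly_over_reals (\<lambda>p. cayley_den (rot_param p))" for r l
    by (rule poly.cayley_num_mem[OF 3(1)] poly.cayley_den_mem[OF 3(1)])+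
  show ?thesis
  proof (cases n)
    case (Inl m)
    obtain i l where "m = Inl (i, l) \<or> m = Inr (i, l)" by (cases m) auto
    then show ?thesis
      by (elim disjE) (auto simp: pitch_zero_map_def Inl intro!: 1 2 3 4 5 poly.mem_intros)
  next
    case (Inr l)
    then show ?thesis
      by (cases "l = j"; cases l) (auto simp: pitch_zero_map_def intro!: 1 2 3 4 5 poly.mem_intros)
  qed
qed

end

lemma reciprocal_scale:
  assumes "reciprocal a R P u w"
  shows "reciprocal a R P (t *s u) (t *s w)"
  unfolding reciprocal_def
proof
  fix i
  have "t *s u + complex_cross3 (t *s w) (base_pt a i) = t *s (u + complex_cross3 w (base_pt a i))"
    by (simp add: cross_smult vector_add_ldistrib)
  then have "limb a R P i \<odot> (t *s u + complex_cross3 (t *s w) (base_pt a i))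
      = t * (limb a R P i \<odot> (u + complex_cross3 w (base_pt a i)))"
    by (simp only: cdot_smult)
  then show "limb a R P i \<odot> (t *s u + complex_cross3 (t *s w) (base_pt a i)) = 0"
    using assms by (simp add: reciprocal_def)
qed

text \<open>A reciprocal limb meets the line of the screw, so both its joint centers lie in one
  plane through that line. The charts \<open>k\<close> and \<open>\<sigma>\<close> are fixed before
  \<open>j\<close> and \<open>t\<close>: they depend only on the configuration, whereas the
  overwritten coordinate is arbitrary.\<close>

lemma pitch_zero_in_image:
  assumes den: "cayley_den (rot_part z) \<noteq> 0"
    and rec: "reciprocal a (cayley (rot_part z)) (transl_part z) u w" and "w \<noteq> 0" "u \<odot> w = 0"
  shows "\<exists>k \<sigma>. \<forall>j t. \<exists>p. pitch_zero_map k \<sigma> j p = encode a (replace_coord z j t)"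
proof -
  let ?q = "rot_part z" and ?P = "transl_part z"
  let ?R = "cayley ?q" and ?\<delta> = "cayley_den ?q"
  obtain k where k: "w $ k \<noteq> 0" using \<open>w \<noteq> 0\<close> by (auto simp: vec_eq_iff)
  define w' u' where "w' = inverse (w $ k) *s w" and "u' = inverse (w $ k) *s u"
  have w': "w' $ k = 1" using k by (simp add: w'_def)
  have rec': "reciprocal a ?R ?P u' w'" unfolding w'_def u'_def by (rule reciprocal_scale[OF rec])
  have "u' \<odot> w' = 0" using assms(4) by (simp add: w'_def u'_def cdot_smult)
  define c where "c = cyc_vec k 0 (- u' $ nxt (nxt k)) (u' $ nxt k)"
  have u': "u' = complex_cross3 c w'"
    unfolding c_def by (rule pitch_zero_cross[OF w' \<open>u' \<odot> w' = 0\<close>])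
  have "\<exists>\<sigma> m \<alpha> s \<beta> t. base_pt a i - c = \<alpha> *s w' + s *s slope_vec k \<sigma> m
      \<and> ?R *v plat_pt a i + ?P - c = \<beta> *s w' + t *s slope_vec k \<sigma> m" for i
  proof (rule coplanar_chart[OF w'])
    have "u' + complex_cross3 w' (base_pt a i) = complex_cross3 w' (base_pt a i - c)"
      unfolding u' by (simp add: vec3_simps algebra_simps)
    then have "0 = limb a ?R ?P i \<odot> complex_cross3 w' (base_pt a i - c)"
      by (metis rec' reciprocal_def)
    also have "limb a ?R ?P i = (?R *v plat_pt a i + ?P - c) - (base_pt a i - c)"
      by (simp add: limb_def)
    also have "\<dots> \<odot> complex_cross3 w' (base_pt a i - c)
       = (?R *v plat_pt a i + ?P - c) \<odot> complex_cross3 w' (base_pt a i - c)"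
      by (simp only: cdot_diff(2)[where y = "?R *v plat_pt a i + ?P - c"] cdot_cross_self diff_0_right)
    finally show "(?R *v plat_pt a i + ?P - c) \<odot> complex_cross3 w' (base_pt a i - c) = 0" ..
  qed
  then obtain \<sigma> m \<alpha> s \<beta> t where
    A: "\<And>i. base_pt a i - c = \<alpha> i *s w' + s i *s slope_vec k (\<sigma> i) (m i)" and
    B: "\<And>i. ?R *v plat_pt a i + ?P - c = \<beta> i *s w' + t i *s slope_vec k (\<sigma> i) (m i)" by metis
  have R: "orthogonal_matrix ?R" using rotation_cayley[OF den] by (simp add: rotation_def)
  have b: "plat_pt a i $ l = (\<Sum>r\<in>UNIV. cayley_num ?q $ r $ l
            * (inverse ?\<delta> *s (c - ?P) + (\<beta> i / ?\<delta>) *s w' + (t i / ?\<delta>) *s slope_vec k (\<sigma> i) (m i)) $ r)" for i l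
  proof -
    define y where "y = c - ?P + \<beta> i *s w' + t i *s slope_vec k (\<sigma> i) (m i)"
    have "?R *v plat_pt a i = y" using B[of i] by (simp add: y_def algebra_simps)
    then have "plat_pt a i = transpose ?R *v y" using orthogonal_matrix_cancel(2)[OF R] by metis
    then have "plat_pt a i $ l = (\<Sum>r\<in>UNIV. cayley_num ?q $ r $ l / ?\<delta> * y $ r)"
      by (simp del: transpose_matrix_vector add: matrix_vector_mult_def transpose_def cayley_def)
    also have "\<dots> = (\<Sum>r\<in>UNIV. cayley_num ?q $ r $ l
            * (inverse ?\<delta> *s (c - ?P) + (\<beta> i / ?\<delta>) *s w' + (t i / ?\<delta>) *s slope_vec k (\<sigma> i) (m i)) $ r)"
      by (intro sum.cong refl) (simp add: y_def divide_inverse algebra_simps)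
    finally show ?thesis .
  qed
  have "\<exists>p. pitch_zero_map k \<sigma> j p = encode a (replace_coord z j f)" for j f
  proof -
    define p :: params where "p = (\<chi> n. case n of
        Inl n \<Rightarrow> (case n of Inl i \<Rightarrow> ?q $ i | Inr i \<Rightarrow> (inverse ?\<delta> *s (c - ?P)) $ i)
      | Inr n \<Rightarrow> (case n of
          Inl n \<Rightarrow> (case n of Inl i \<Rightarrow> w' $ (if i = 1 then nxt k else nxt (nxt k))
                            | Inr i \<Rightarrow> c $ (if i = 1 then nxt k else nxt (nxt k)))
        | Inr n \<Rightarrow> (case n of
            Inl (i, e) \<Rightarrow> if e = 1 then \<alpha> i else if e = 2 then s i else if e = 3 then \<beta> i / ?\<delta>
                         else if e = 4 then t i / ?\<delta> else m i
          | Inr _ \<Rightarrow> f)))"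
    have p1: "rot_param p = ?q" "transl_param p = inverse ?\<delta> *s (c - ?P)"
      by (simp_all add: p_def rot_param_def transl_param_def vec_eq_iff)
    have p2: "line_dir k p = w'" using w' cyc_vec_eta[of k w'] by (simp add: p_def line_dir_def)
    have p3: "line_pt k p = c" using cyc_vec_eta[of k c] by (simp add: p_def line_pt_def c_def cyc_vec_def)
    have p4: "limb_param p i 1 = \<alpha> i" "limb_param p i 2 = s i" "limb_param p i 3 = \<beta> i / ?\<delta>"
      "limb_param p i 4 = t i / ?\<delta>" "limb_param p i 5 = m i" for i
      by (simp_all add: limb_param_def p_def)
    have p5: "p $ Inr (Inr (Inr 1)) = f" by (simp add: p_def)
    have A': "complex_of_real (fst a $ i $ l) = (c + \<alpha> i *s w' + s i *s slope_vec k (\<sigma> i) (m i)) $ l" for i l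
    proof -
      have "base_pt a i = c + \<alpha> i *s w' + s i *s slope_vec k (\<sigma> i) (m i)"
        using A[of i] by (simp add: algebra_simps)
      then show ?thesis by (metis complex_vec_def vec_lambda_beta)
    qed
    have b': "complex_of_real (snd a $ i $ l) = (\<Sum>r\<in>UNIV. cayley_num ?q $ r $ l
            * (inverse ?\<delta> *s (c - ?P) + (\<beta> i / ?\<delta>) *s w' + (t i / ?\<delta>) *s slope_vec k (\<sigma> i) (m i)) $ r)" for i l
      using b[of i l] by (simp add: complex_vec_def)
    have P': "(c - ?\<delta> *s (inverse ?\<delta> *s (c - ?P))) $ l = z $ Inr l" for l
      using den by (simp add: vector_smult_assoc transl_part_def)
    have "pitch_zero_map k \<sigma> j p $ n = encode a (replace_coord z j f) $ n" for n
      unfolding pitch_zero_map_def encode_def replace_coord_def vec_lambda_beta p1 p2 p3 p4 p5 P' A' b'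
      by (auto simp: rot_part_def split: sum.splits prod.splits)
    then show ?thesis by (metis vec_eq_iff)
  qed
  then show ?thesis by blast
qed

text \<open>For each of the finitely many charts (k, \<sigma>) the map goes from 6 + 4 + 30 + 1 = 41
  parameters to 36 + 6 = 42 coordinates, so its image satisfies a nontrivial relation.
  \<open>\<Psi> j\<close> is the product of these relations and does not depend on the
  architecture.\<close>

lemma pitch_zero_thin:
  "\<exists>\<Psi> :: (3 + 3) \<Rightarrow> arch_coords \<Rightarrow> complex. \<forall>j. poly_over_reals (\<Psi> j) \<and> (\<exists>x. \<Psi> j x \<noteq> 0) \<and>
    (\<forall>a z u w t. cayley_den (rot_part z) \<noteq> 0 \<longrightarrow> reciprocal a (cayley (rot_part z)) (transl_part z) u w
       \<longrightarrow> w \<noteq> 0 \<longrightarrow> u \<odot> w = 0 \<longrightarrow> \<Psi> j (encode a (replace_coord z j t)) = 0)"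
proof -
  have "\<exists>\<Phi>. poly_over_reals \<Phi> \<and> (\<exists>x. \<Phi> (complex_vec x) \<noteq> 0) \<and> (\<forall>p. \<Phi> (pitch_zero_map k \<sigma> j p) = 0)"
    for k \<sigma> j
    by (rule algebraic_dependence[OF poly_pitch_zero_map]) simp
  then obtain \<Phi> where \<Phi>: "\<And>k \<sigma> j. poly_over_reals (\<Phi> k \<sigma> j)" "\<And>k \<sigma> j. \<exists>x. \<Phi> k \<sigma> j (complex_vec x) \<noteq> 0"
    "\<And>k \<sigma> j p. \<Phi> k \<sigma> j (pitch_zero_map k \<sigma> j p) = 0" by metis
  then have ex: "\<exists>x. \<Phi> k \<sigma> j x \<noteq> 0" for k \<sigma> j by blast
  define \<Psi> where "\<Psi> = (\<lambda>j x. \<Prod>(k, \<sigma>)\<in>UNIV. \<Phi> k \<sigma> j x)"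
  show ?thesis
  proof (intro exI[of _ \<Psi>] allI conjI impI)
    fix j
    show "poly_over_reals (\<Psi> j)"
      unfolding \<Psi>_def by (intro poly.prod_mem) (auto simp: \<Phi>)
    show "\<exists>x. \<Psi> j x \<noteq> 0"
      unfolding \<Psi>_def case_prod_unfold
      by (rule poly_over_reals_prod_nonzero) (simp_all add: \<Phi> ex)
    fix a z u w t
    assume "cayley_den (rot_part z) \<noteq> 0" "reciprocal a (cayley (rot_part z)) (transl_part z) u w" "w \<noteq> 0" "u \<odot> w = 0"
    then obtain k \<sigma> p where "pitch_zero_map k \<sigma> j p = encode a (replace_coord z j t)"
      using pitch_zero_in_image by blast
    then have "\<Phi> k \<sigma> j (encode a (replace_coord z j t)) = 0" by (metis \<Phi>(3))
    then show "\<Psi> j (encode a (replace_coord z j t)) = 0"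
      unfolding \<Psi>_def by (intro prod_zero bexI[of _ "(k, \<sigma>)"]) auto
  qed
qed

section \<open>Generic architectures\<close>

definition arch_poly :: "(architecture \<Rightarrow> complex) \<Rightarrow> bool" where
  "arch_poly h \<longleftrightarrow> (\<exists>f. real_polynomial_function f \<and> h = (\<lambda>a. complex_of_real (f a)))"

global_interpretation arch: real_function_algebra "{h. arch_poly h}"
  rewrites "\<And>h. h \<in> {h. arch_poly h} \<longleftrightarrow> arch_poly h"
proof unfold_locales
  show "(\<lambda>x. complex_of_real c) \<in> {h. arch_poly h}" for c
    unfolding arch_poly_def by (auto intro!: exI[of _ "\<lambda>_. c"] real_polynomial_function.intros)
next
  fix f g assume "f \<in> {h. arch_poly h}" "g \<in> {h. arch_poly h}"
  then obtain f' g' where "real_polynomial_function f'" "f = (\<lambda>a. complex_of_real (f' a))"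
    "real_polynomial_function g'" "g = (\<lambda>a. complex_of_real (g' a))"
    unfolding arch_poly_def by blast
  then have "real_polynomial_function (\<lambda>x. f' x + g' x)" "real_polynomial_function (\<lambda>x. f' x * g' x)"
    "(\<lambda>x. f x + g x) = (\<lambda>x. complex_of_real (f' x + g' x))"
    "(\<lambda>x. f x * g x) = (\<lambda>x. complex_of_real (f' x * g' x))"
    by (auto intro: real_polynomial_function.intros)
  then show "(\<lambda>x. f x + g x) \<in> {h. arch_poly h}" "(\<lambda>x. f x * g x) \<in> {h. arch_poly h}"
    unfolding arch_poly_def by blast+
qed simp

lemma arch_poly_coord: "arch_poly (\<lambda>a. complex_of_real (fst a $ i $ l))" "arch_poly (\<lambda>a. complex_of_real (snd a $ i $ l))"
proof -
  have "bounded_linear (\<lambda>a :: architecture. fst a $ i $ l)" "bounded_linear (\<lambda>a :: architecture. snd a $ i $ l)"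
    by (rule bounded_linear_compose[OF bounded_linear_vec_nth bounded_linear_compose[OF bounded_linear_vec_nth]],
        rule bounded_linear_fst bounded_linear_snd)+
  then have "real_polynomial_function (\<lambda>a :: architecture. fst a $ i $ l)"
      "real_polynomial_function (\<lambda>a :: architecture. snd a $ i $ l)"
    by (simp_all add: real_polynomial_function.intros)
  then show "arch_poly (\<lambda>a. complex_of_real (fst a $ i $ l))" "arch_poly (\<lambda>a. complex_of_real (snd a $ i $ l))"
    unfolding arch_poly_def by blast+
qed

lemma arch_poly_points:
  "arch_poly (\<lambda>a. base_pt a i $ l)" "arch_poly (\<lambda>a. plat_pt a i $ l)"
  "arch_poly (\<lambda>a. base_vec a i $ l)" "arch_poly (\<lambda>a. plat_vec a i $ l)"
  by (auto simp: complex_vec_def base_vec_def plat_vec_def intro: arch_poly_coord arch.diff_mem)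

lemma real_polynomial_function_line:
  assumes "real_polynomial_function f"
  shows "\<exists>p. \<forall>t. f (x + t *\<^sub>R v) = poly p t"
  using assms
proof induction
  case (linear f)
  then show ?case by (intro exI[of _ "[:f x, f v:]"]) (simp add: linear_simps)
next
  case (const c)
  show ?case by (intro exI[of _ "[:c:]"]) simp
next
  case (add f g)
  then show ?case by (metis poly_add)
next
  case (mult f g)
  then show ?case by (metis poly_mult)
qed

text \<open>The parameter space is irreducible: on the real line joining a point of \<open>V\<close>
  to a point of \<open>W\<close> both conditions become nonzero polynomials in one variable, and so
  does their product.\<close>

lemma zariski_open_architectures_Int:
  assumes "zariski_open_architectures V" "zariski_open_architectures W" "V \<noteq> {}" "W \<noteq> {}"
  shows "zariski_open_architectures (V \<inter> W)" "V \<inter> W \<noteq> {}"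
proof -
  obtain F G where F: "\<And>f. f \<in> F \<Longrightarrow> real_polynomial_function f" "V = {a. \<exists>f\<in>F. f a \<noteq> 0}"
    and G: "\<And>g. g \<in> G \<Longrightarrow> real_polynomial_function g" "W = {a. \<exists>g\<in>G. g a \<noteq> 0}"
    using assms unfolding zariski_open_architectures_def by blast
  show "zariski_open_architectures (V \<inter> W)"
    unfolding zariski_open_architectures_def
  proof (intro exI conjI ballI)
    show "real_polynomial_function h" if "h \<in> (\<lambda>(f, g) a. f a * g a) ` (F \<times> G)" for h
      using that F(1) G(1) by (auto intro: real_polynomial_function.intros)
    show "V \<inter> W = {a. \<exists>h\<in>(\<lambda>(f, g) a. f a * g a) ` (F \<times> G). h a \<noteq> 0}"
      unfolding F(2) G(2) by auto
  qed
  obtain a f where a: "f \<in> F" "f a \<noteq> 0" using assms(3) F(2) by blast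
  obtain b g where b: "g \<in> G" "g b \<noteq> 0" using assms(4) G(2) by blast
  obtain p q where p: "\<And>t. f (a + t *\<^sub>R (b - a)) = poly p t" and q: "\<And>t. g (a + t *\<^sub>R (b - a)) = poly q t"
    using real_polynomial_function_line F(1)[OF a(1)] G(1)[OF b(1)] by metis
  have "poly p 0 \<noteq> 0" "poly q 1 \<noteq> 0" using p[of 0] q[of 1] a b by simp_all
  then have "p * q \<noteq> 0" by auto
  then obtain t where "poly (p * q) t \<noteq> 0" using poly_all_0_iff_0 by blast
  then have "f (a + t *\<^sub>R (b - a)) \<noteq> 0" "g (a + t *\<^sub>R (b - a)) \<noteq> 0" by (simp_all add: p q)
  then show "V \<inter> W \<noteq> {}" using a(1) b(1) F(2) G(2) by blast
qed

lemma zariski_open_architectures_UNIV: "zariski_open_architectures UNIV"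
  unfolding zariski_open_architectures_def
  by (rule exI[of _ "{\<lambda>_. 1}"]) (auto intro: real_polynomial_function.intros)

lemma zariski_open_architectures_INT:
  assumes "finite I" "\<And>i. i \<in> I \<Longrightarrow> zariski_open_architectures (W i) \<and> W i \<noteq> {}"
  shows "zariski_open_architectures (\<Inter>i\<in>I. W i) \<and> (\<Inter>i\<in>I. W i) \<noteq> {}"
  using assms
proof (induction rule: finite_induct)
  case empty
  then show ?case by (simp add: zariski_open_architectures_UNIV)
next
  case (insert i I)
  then show ?case
    using zariski_open_architectures_Int[of "W i" "\<Inter>i\<in>I. W i"] by simp
qed

lemma zariski_open_architecturesI:
  assumes "\<And>y. arch_poly (h y)"
  shows "zariski_open_architectures {a. \<exists>y. h y a \<noteq> 0}"
proof -
  obtain f where "\<And>y. real_polynomial_function (f y)" "\<And>y. h y = (\<lambda>a. complex_of_real (f y a))"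
    using assms unfolding arch_poly_def by metis
  then show ?thesis
    unfolding zariski_open_architectures_def by (intro exI[of _ "range f"]) auto
qed

lemma arch_poly_arch_matrix:
  assumes "\<And>i. arch_poly (\<lambda>a. v a $ i)"
  shows "arch_poly (\<lambda>a. arch_matrix a (v a) $ i $ j)"
  by (cases "i = 1") (auto simp: arch_matrix_def intro: assms arch.join6_mem arch_poly_points)

lemma arch_poly_minors: "arch_poly (\<lambda>a. minor_p a $ i)" "arch_poly (\<lambda>a. minor_r a $ i)"
  unfolding minor_p_def minor_r_def arch_minors_def
  by (intro arch.fst6_mem arch.snd6_mem arch.row_cofactors_mem arch_poly_arch_matrix; simp add: arch.zero_mem)+

lemma arch_poly_triple_rhs:
  assumes "\<And>i. arch_poly (\<lambda>a. w a $ i)" "\<And>i j. R $ i $ j \<in> \<real>"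
  shows "arch_poly (\<lambda>a. triple_rhs a R (w a) $ i)"
proof -
  have R: "arch_poly (\<lambda>a. R $ i $ j)" for i j
    using arch.const_mem assms(2)[of i j] by (metis Reals_cases)
  show ?thesis
    by (cases "i = 1")
       (auto simp: triple_rhs_def intro!: arch.mem_intros arch.cdot_mem arch.cross_mem arch.matrix_vector_mem
          assms(1) arch_poly_points R)
qed

lemma minors_orthogonal:
  assumes "i \<noteq> 1"
  shows "plat_vec a i \<odot> minor_p a + base_vec a i \<odot> minor_r a = 0"
proof -
  have "(arch_matrix a 0 *v arch_minors a) $ i = 0"
    using assms unfolding arch_minors_def mult_row_cofactors by (simp add: axis_def)
  then show ?thesis using assms
    by (simp add: matrix_vector_mult_def arch_matrix_def sum_join6 minor_p_def minor_r_def)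
qed

lemma complex_vec_component [simp]: "complex_vec v $ i = complex_of_real (v $ i)"
  by (simp add: complex_vec_def)

text \<open>Guarantees that the equation of \<open>Sing a\<close> does not vanish identically in the
  chart centred at \<open>R\<close>; needed for the identity and for the three half turns.\<close>

definition nonsingular_at :: "complex^3^3 \<Rightarrow> architecture \<Rightarrow> bool" where
  "nonsingular_at R a \<longleftrightarrow> (\<exists>P. det (Jac a R (complex_vec P)) \<noteq> 0)"

definition sign_matrix :: "(3 \<Rightarrow> real) \<Rightarrow> complex^3^3" where
  "sign_matrix d = (\<chi> i j. if i = j then complex_of_real (d i) else 0)"

lemma flip_sign_matrix: "flip k = sign_matrix (\<lambda>i. if i = k then 1 else -1)"
  and mat_sign_matrix: "mat 1 = sign_matrix (\<lambda>_. 1)"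
  by (auto simp: flip_def sign_matrix_def mat_def vec_eq_iff)

text \<open>In the witness the six limbs are the edges of a tetrahedron.\<close>

lemma nonsingular_at_open:
  assumes d: "\<And>i. d i * d i = 1"
  shows "zariski_open_architectures {a. nonsingular_at (sign_matrix d) a}" "{a. nonsingular_at (sign_matrix d) a} \<noteq> {}"
proof -
  have R: "arch_poly (\<lambda>a. sign_matrix d $ i $ j)" for i j
    using arch.const_mem[of "if i = j then d i else 0"] by (simp add: sign_matrix_def if_distrib cong: if_cong)
  have l: "arch_poly (\<lambda>a. limb a (sign_matrix d) (complex_vec P) i $ j)" for i P j
    unfolding limb_def
    by (simp, intro arch.mem_intros arch.matrix_vector_mem R arch_poly_points)
       (use arch_poly_coord in simp_all)
  have "arch_poly (\<lambda>a. det (Jac a (sign_matrix d) (complex_vec P)))" for P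
    by (intro arch.det_mem) (unfold Jac_row, intro arch.join6_mem arch.cross_mem l arch_poly_points)
  then show "zariski_open_architectures {a. nonsingular_at (sign_matrix d) a}"
    unfolding nonsingular_at_def by (rule zariski_open_architecturesI)
  define A L :: "(real^3)^6" where
    "A = vector [0, 0, 0, vector [0,1,0], vector [0,0,1], vector [1,0,0]]" and
    "L = vector [vector [1,0,0], vector [0,1,0], vector [0,0,1], vector [0,0,1], vector [1,0,0], vector [0,1,0]]"
  \<comment> \<open>As \<open>d l * d l = 1\<close>, the signs cancel in
    \<open>sign_matrix d\<close> applied to the platform points, so at P = 0 the limbs are the rows
    of \<open>L\<close> whatever \<open>d\<close> is.\<close>
  define a :: architecture where "a = (A, \<chi> i l. d l * (L $ i $ l + A $ i $ l))"
  have lim: "limb a (sign_matrix d) (complex_vec 0) i = complex_vec (L $ i)" for i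
  proof -
    have "(\<Sum>j\<in>UNIV. sign_matrix d $ l $ j * complex_vec (snd a $ i) $ j) = complex_of_real (L $ i $ l + A $ i $ l)" for l
    proof -
      have "(\<Sum>j\<in>UNIV. sign_matrix d $ l $ j * complex_vec (snd a $ i) $ j)
          = complex_of_real (d l * d l * (L $ i $ l + A $ i $ l))"
        by (simp add: sign_matrix_def a_def if_distrib[of "\<lambda>x. x * _"] sum.delta' cong: if_cong)
      then show ?thesis by (simp add: d)
    qed
    then show ?thesis by (simp add: limb_def vec_eq_iff matrix_vector_mult_def a_def)
  qed
  have "det (Jac a (sign_matrix d) (complex_vec 0)) \<noteq> 0"
  proof
    assume "det (Jac a (sign_matrix d) (complex_vec 0)) = 0"
    then obtain u w where uw: "u \<noteq> 0 \<or> w \<noteq> 0" "reciprocal a (sign_matrix d) (complex_vec 0) u w"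
      unfolding singular_iff by blast
    have *: "u $ 1 = 0 \<and> u $ 2 = 0 \<and> u $ 3 = 0 \<and> u $ 3 + w $ 1 = 0 \<and> u $ 1 + w $ 2 = 0 \<and> u $ 2 + w $ 3 = 0"
      using uw(2) unfolding reciprocal_def lim
      by (auto simp: forall_6 vec3_simps L_def A_def a_def)
    then have "w $ 1 = 0" "w $ 2 = 0" "w $ 3 = 0" by auto
    with * show False using uw(1) by (simp add: vec3_simps)
  qed
  then show "{a. nonsingular_at (sign_matrix d) a} \<noteq> {}" unfolding nonsingular_at_def by blast
qed

text \<open>At the identity rotation this direction is orthogonal to R p + r, so
  \<open>quad_g\<close> vanishes on it.\<close>

definition ruling_dir :: "architecture \<Rightarrow> real^3 \<Rightarrow> complex^3" where
  "ruling_dir a e = complex_cross3 (minor_p a + minor_r a) (complex_vec e)"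

text \<open>The numerator of Cramer's rule for the limb equations with (w, w) in the free row, which
  at R = 1 encodes \<open>quad_c = 0\<close>. Unlike \<open>quad_c\<close> it is polynomial in the
  architecture. Where it is nonzero, \<open>quad_c\<close> does not vanish identically on the plane
  \<open>quad_g = 0\<close>.\<close>

definition obstruction :: "architecture \<Rightarrow> (real^3) \<times> 6 \<Rightarrow> complex" where
  "obstruction a = (\<lambda>(e, k). let w = ruling_dir a e in
     det (\<chi> i j. if j = k then triple_rhs a (mat 1) w $ i else arch_matrix a (join6 w w) $ i $ j))"

text \<open>By Cramer's rule, if the form \<open>quad_c\<close> vanished at this direction orthogonal to
  \<open>axis_vec a (mat 1)\<close>, then the linear system with the given singular matrix would be solvable.\<close>

lemma obstruction_quad_c:
  assumes "obstruction a (e, k) \<noteq> 0" "det (frame a) \<noteq> 0"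
  shows "quad_c a (mat 1) (ruling_dir a e) \<noteq> 0"
proof
  define w where "w = ruling_dir a e"
  assume "quad_c a (mat 1) (ruling_dir a e) = 0"
  then have c: "w \<odot> (fst6 (particular a (mat 1) w) + snd6 (particular a (mat 1) w)) = 0"
    by (simp add: quad_c_def w_def)
  have "(arch_matrix a (join6 w w) *v particular a (mat 1) w) $ i = triple_rhs a (mat 1) w $ i" for i
  proof (cases "i = 1")
    case True
    then show ?thesis using c
      by (simp add: arch_matrix_def matrix_vector_mult_def sum_join6 triple_rhs_def cdot_linear)
  next
    case False
    have "(arch_matrix a (join6 w w) *v particular a (mat 1) w) $ i = (frame a *v particular a (mat 1) w) $ i"
      using False by (simp add: arch_matrix_def frame_def matrix_vector_mult_def)
    then show ?thesis by (simp add: frame_mult_particular[OF assms(2)])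
  qed
  then have Mx: "arch_matrix a (join6 w w) *v particular a (mat 1) w = triple_rhs a (mat 1) w"
    by (blast intro: iffD2[OF vec_eq_iff])
  have "obstruction a (e, k) =
      det (\<chi> i j. if j = k then triple_rhs a (mat 1) w $ i else arch_matrix a (join6 w w) $ i $ j)"
    by (simp only: obstruction_def w_def Let_def prod.case)
  also have "\<dots> = particular a (mat 1) w $ k * det (arch_matrix a (join6 w w))"
    using cramer_lemma[of k "arch_matrix a (join6 w w)" "particular a (mat 1) w"]
    unfolding Mx .
  also have "det (arch_matrix a (join6 w w)) = w \<odot> (minor_p a + minor_r a)"
    by (simp add: det_arch_matrix cdot_linear)
  also have "\<dots> = 0" by (simp add: w_def ruling_dir_def)
  finally show False using assms(1) by simp
qed

lemma nondegenerate_obstruction_open: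
  "zariski_open_architectures {a. nondegenerate a}" "{a. nondegenerate a} \<noteq> {}"
  "zariski_open_architectures {a. \<exists>y. obstruction a y \<noteq> 0}" "{a. \<exists>y. obstruction a y \<noteq> 0} \<noteq> {}"
proof -
  have "arch_poly (\<lambda>a. (minor_p a \<odot> minor_p a)^2 - (minor_r a \<odot> minor_r a)^2)"
    by (intro arch.mem_intros arch.cdot_mem arch_poly_minors)
  then show "zariski_open_architectures {a. nondegenerate a}"
    using zariski_open_architecturesI[of "\<lambda>_ :: unit. \<lambda>a. (minor_p a \<odot> minor_p a)^2 - (minor_r a \<odot> minor_r a)^2"]
    by (simp add: nondegenerate_def)
  have "arch_poly (\<lambda>a. obstruction a (e, k))" for e k
  proof -
    have w: "arch_poly (\<lambda>a. ruling_dir a e $ i)" for i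
      unfolding ruling_dir_def
      by (intro arch.cross_mem) (auto intro: arch.mem_intros arch_poly_minors)
    have "arch_poly (\<lambda>a. (if j = k then triple_rhs a (mat 1) (ruling_dir a e) $ i
        else arch_matrix a (join6 (ruling_dir a e) (ruling_dir a e)) $ i $ j))" for i j
      by (cases "j = k") (auto intro!: arch_poly_triple_rhs arch_poly_arch_matrix arch.join6_mem w simp: mat_def)
    then show ?thesis unfolding obstruction_def Let_def prod.case by (intro arch.det_mem) simp
  qed
  then show "zariski_open_architectures {a. \<exists>y. obstruction a y \<noteq> 0}"
    by (intro zariski_open_architecturesI) (metis surj_pair)
  \<comment> \<open>Joints 4, 5 and 6 have zero platform vectors and independent base vectors, which
    forces \<open>minor_r a = 0\<close>. Joints 2 and 3 then leave \<open>minor_p a\<close> on the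
    first axis, so that \<open>ruling_dir\<close> for the second axis is a multiple of the
    third.\<close>
  define a :: architecture where
    "a = (vector [0, vector [1,0,0], vector [-1,0,1], vector [1,0,0], vector [0,1,0], vector [0,0,1]],
          vector [0, vector [0,1,0], vector [0,-1,1], 0, 0, 0])"
  note d = base_vec_def plat_vec_def a_def
  have r: "minor_r a $ 1 = 0" "minor_r a $ 2 = 0" "minor_r a $ 3 = 0"
    using minors_orthogonal[of 4 a] minors_orthogonal[of 5 a] minors_orthogonal[of 6 a]
    by (simp_all add: cdot_def sum_3 d)
  have p: "minor_p a $ 2 = 0" "minor_p a $ 3 = 0"
    using minors_orthogonal[of 2 a] minors_orthogonal[of 3 a] r
    by (simp_all add: cdot_def sum_3 d)
  have "det (arch_matrix a (join6 (axis 1 1) 0)) \<noteq> 0"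
  proof
    assume "det (arch_matrix a (join6 (axis 1 1) 0)) = 0"
    then obtain x where "x \<noteq> 0" "arch_matrix a (join6 (axis 1 1) 0) *v x = 0"
      using det_eq_0_iff_kernel by blast
    then show False
      by (auto simp: vec_eq_iff[where 'b = 6] forall_6 matrix_vector_mult_def sum_6 arch_matrix_def axis_def d)
  qed
  then have p1: "minor_p a $ 1 \<noteq> 0"
    unfolding det_arch_matrix by (simp add: cdot_def sum_3 axis_def)
  then have "nondegenerate a" by (simp add: nondegenerate_def cdot_def sum_3 p r)
  then show "{a. nondegenerate a} \<noteq> {}" by blast
  define w where "w = ruling_dir a (vector [0,1,0])"
  have w: "w $ 1 = 0" "w $ 2 = 0" "w $ 3 = minor_p a $ 1"
    by (simp_all add: w_def ruling_dir_def p r)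
  have "obstruction a (vector [0,1,0], 1) \<noteq> 0"
  proof
    assume "obstruction a (vector [0,1,0], 1) = 0"
    then have "det (\<chi> i j. if j = 1 then triple_rhs a (mat 1) w $ i else arch_matrix a (join6 w w) $ i $ j) = 0"
      by (simp only: obstruction_def w_def Let_def prod.case)
    then obtain x where x: "x \<noteq> 0"
      "(\<chi> i j. if j = 1 then triple_rhs a (mat 1) w $ i else arch_matrix a (join6 w w) $ i $ j) *v x = 0"
      using det_eq_0_iff_kernel by blast
    obtain \<mu> where \<mu>: "w $ 3 = \<mu>" "\<mu> \<noteq> 0" using w(3) p1 by blast
    define \<rho> where "\<rho> = triple_rhs a (mat 1) w"
    have rhs: "\<rho> $ 1 = 0" "\<rho> $ 2 = - \<mu>" "\<rho> $ 3 = - \<mu>"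
      "\<rho> $ 4 = 0" "\<rho> $ 5 = 0" "\<rho> $ 6 = 0"
      by (simp_all add: \<rho>_def triple_rhs_def cdot_def sum_3 w(1,2) \<mu>(1) d)
    have K: "(\<Sum>j\<in>UNIV. (if j = 1 then \<rho> $ i else arch_matrix a (join6 w w) $ i $ j) * x $ j) = 0" for i
      using x(2) unfolding \<rho>_def by (simp add: vec_eq_iff[where 'b = 6] matrix_vector_mult_def)
    have x456: "x $ 4 = 0" "x $ 5 = 0" "x $ 6 = 0"
      using K[of 4] K[of 5] K[of 6] by (simp_all add: sum_6 arch_matrix_def rhs d)
    have x3: "x $ 3 = 0"
      using K[of 1] \<mu> by (simp add: sum_6 arch_matrix_def rhs w(1,2) x456)
    have e2: "- (\<mu> * x $ 1) + x $ 2 = 0"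
      using K[of 2] by (simp add: sum_6 arch_matrix_def rhs d x456 x3)
    have e3: "- (\<mu> * x $ 1) - x $ 2 = 0"
      using K[of 3] by (simp add: sum_6 arch_matrix_def rhs d x456 x3)
    have "\<mu> * x $ 1 = 0" "x $ 2 = 0" using e2 e3 by algebra+
    then have "x = 0" using \<mu>(2) by (simp add: vec_eq_iff forall_6 x456 x3)
    then show False using x(1) by simp
  qed
  then show "{a. \<exists>y. obstruction a y \<noteq> 0} \<noteq> {}" by blast
qed

text \<open>A real point of the coordinate space is a real architecture together with real chart
  coordinates, so nonvanishing at one real point already provides the witness.\<close>

lemma encode_open:
  assumes "poly_over_reals \<Psi>" "\<Psi> x \<noteq> 0"
  shows "zariski_open_architectures {a. \<exists>z. \<Psi> (encode a (complex_vec z)) \<noteq> 0}"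
    "{a. \<exists>z. \<Psi> (encode a (complex_vec z)) \<noteq> 0} \<noteq> {}"
proof -
  have "arch_poly (\<lambda>a. encode a (complex_vec z) $ n)" for z n
  proof (cases n)
    case (Inl m)
    obtain i l where "m = Inl (i, l) \<or> m = Inr (i, l)" by (cases m) auto
    then show ?thesis
      by (elim disjE) (auto simp: encode_def Inl intro: arch_poly_coord)
  next
    case (Inr l)
    then show ?thesis by (simp add: encode_def arch.const_mem)
  qed
  then have "arch_poly (\<lambda>a. \<Psi> (encode a (complex_vec z)))" for z
    by (rule arch.poly_compose_mem[OF assms(1)])
  then show "zariski_open_architectures {a. \<exists>z. \<Psi> (encode a (complex_vec z)) \<noteq> 0}"
    by (rule zariski_open_architecturesI)
  obtain y where y: "\<Psi> (complex_vec y) \<noteq> 0" using poly_over_reals_real_point[OF assms] by blast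
  define a :: architecture where "a = (\<chi> i l. y $ Inl (Inl (i, l)), \<chi> i l. y $ Inl (Inr (i, l)))"
  have "encode a (complex_vec (\<chi> l. y $ Inr l)) = complex_vec y"
    by (auto simp: encode_def a_def vec_eq_iff split: sum.splits prod.splits)
  then show "{a. \<exists>z. \<Psi> (encode a (complex_vec z)) \<noteq> 0} \<noteq> {}" using y by (metis (mono_tags, lifting) empty_iff mem_Collect_eq)
qed

text \<open>Each assumption guards one step of the density proof: the nonsingularity conditions keep
  the equation of \<open>Sing a\<close> nontrivial in the charts, \<open>thin_nonzero\<close> and
  \<open>thin_zero\<close> allow leaving pitch zero, and \<open>obstructed\<close> allows leaving
  \<open>quad_g = 0\<close>.\<close>

locale generic_architecture =
  fixes a :: architecture and \<Psi> :: "(3 + 3) \<Rightarrow> arch_coords \<Rightarrow> complex"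
  assumes nondeg: "nondegenerate a"
    and nonsingular_1: "nonsingular_at (mat 1) a"
    and nonsingular_flip: "nonsingular_at (flip k) a"
    and obstructed: "\<exists>y. obstruction a y \<noteq> 0"
    and thin_poly: "poly_over_reals (\<Psi> j)"
    and thin_nonzero: "\<exists>z. \<Psi> j (encode a (complex_vec z)) \<noteq> 0"
    and thin_zero: "cayley_den (rot_part z) \<noteq> 0 \<Longrightarrow> reciprocal a (cayley (rot_part z)) (transl_part z) u w
       \<Longrightarrow> w \<noteq> 0 \<Longrightarrow> u \<odot> w = 0 \<Longrightarrow> \<Psi> j (encode a (replace_coord z j t)) = 0"

lemma exists_generic:
  "\<exists>W \<Psi>. zariski_open_architectures W \<and> W \<noteq> {} \<and> (\<forall>a\<in>W. generic_architecture a \<Psi>)"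
proof -
  obtain \<Psi> :: "(3 + 3) \<Rightarrow> arch_coords \<Rightarrow> complex" where \<Psi>: "\<And>j. poly_over_reals (\<Psi> j)" "\<And>j. \<exists>x. \<Psi> j x \<noteq> 0"
    "\<And>j a z u w t. cayley_den (rot_part z) \<noteq> 0 \<Longrightarrow> reciprocal a (cayley (rot_part z)) (transl_part z) u w
       \<Longrightarrow> w \<noteq> 0 \<Longrightarrow> u \<odot> w = 0 \<Longrightarrow> \<Psi> j (encode a (replace_coord z j t)) = 0"
    using pitch_zero_thin by metis
  have 2: "zariski_open_architectures {a. nonsingular_at (mat 1) a}" "{a. nonsingular_at (mat 1) a} \<noteq> {}"
    unfolding mat_sign_matrix by (rule nonsingular_at_open; simp)+
  have "zariski_open_architectures {a. nonsingular_at (flip k) a} \<and> {a. nonsingular_at (flip k) a} \<noteq> {}" for k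
    unfolding flip_sign_matrix by (intro conjI nonsingular_at_open) auto
  then have "zariski_open_architectures (\<Inter>k\<in>UNIV. {a. nonsingular_at (flip k) a})
      \<and> (\<Inter>k\<in>UNIV. {a. nonsingular_at (flip k) a}) \<noteq> {}"
    by (intro zariski_open_architectures_INT finite)
  then have 3: "zariski_open_architectures (\<Inter>k. {a. nonsingular_at (flip k) a})" "(\<Inter>k. {a. nonsingular_at (flip k) a}) \<noteq> {}"
    by blast+
  have "zariski_open_architectures {a. \<exists>z. \<Psi> j (encode a (complex_vec z)) \<noteq> 0} \<and>
      {a. \<exists>z. \<Psi> j (encode a (complex_vec z)) \<noteq> 0} \<noteq> {}" for j
  proof -
    obtain x where "\<Psi> j x \<noteq> 0" using \<Psi>(2) by blast
    then show ?thesis by (intro conjI encode_open[OF \<Psi>(1)])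
  qed
  then have "zariski_open_architectures (\<Inter>j\<in>UNIV. {a. \<exists>z. \<Psi> j (encode a (complex_vec z)) \<noteq> 0})
      \<and> (\<Inter>j\<in>UNIV. {a. \<exists>z. \<Psi> j (encode a (complex_vec z)) \<noteq> 0}) \<noteq> {}"
    by (intro zariski_open_architectures_INT finite)
  then have 4: "zariski_open_architectures (\<Inter>j. {a. \<exists>z. \<Psi> j (encode a (complex_vec z)) \<noteq> 0})"
      "(\<Inter>j. {a. \<exists>z. \<Psi> j (encode a (complex_vec z)) \<noteq> 0}) \<noteq> {}"
    by blast+
  note I = zariski_open_architectures_Int
  note c = I[OF 2(1) 3(1) 2(2) 3(2)]
  note c' = I[OF c(1) 4(1) c(2) 4(2)]
  note c'' = I[OF c'(1) nondegenerate_obstruction_open(3) c'(2) nondegenerate_obstruction_open(4)]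
  note c''' = I[OF c''(1) nondegenerate_obstruction_open(1) c''(2) nondegenerate_obstruction_open(2)]
  show ?thesis
  proof (intro exI conjI ballI, rule c'''(1), rule c'''(2))
    fix a
    assume a: "a \<in> {a. nonsingular_at (mat 1) a} \<inter> (\<Inter>k. {a. nonsingular_at (flip k) a})
      \<inter> (\<Inter>j. {a. \<exists>z. \<Psi> j (encode a (complex_vec z)) \<noteq> 0}) \<inter> {a. \<exists>y. obstruction a y \<noteq> 0}
      \<inter> {a. nondegenerate a}"
    show "generic_architecture a \<Psi>"
    proof
      show "nondegenerate a" "nonsingular_at (mat 1) a" "\<exists>y. obstruction a y \<noteq> 0" using a by blast+
      show "nonsingular_at (flip k) a" for k using a by blast
      show "poly_over_reals (\<Psi> j)" for j by (rule \<Psi>(1))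
      show "\<exists>z. \<Psi> j (encode a (complex_vec z)) \<noteq> 0" for j using a by blast
      show "\<Psi> j (encode a (replace_coord z j t)) = 0"
        if "cayley_den (rot_part z) \<noteq> 0" "reciprocal a (cayley (rot_part z)) (transl_part z) u w"
          "w \<noteq> 0" "u \<odot> w = 0" for z u w j t
        using that by (rule \<Psi>(3))
    qed
  qed
qed

section \<open>Quotients of polynomials\<close>

text \<open>The values of \<open>f\<close> at the zeros of \<open>s\<close> do not matter.\<close>

definition frac_poly :: "(complex^'n \<Rightarrow> complex) \<Rightarrow> (complex^'n \<Rightarrow> complex) \<Rightarrow> bool" where
  "frac_poly s f \<longleftrightarrow> (\<exists>p N. poly_over_reals p \<and> (\<forall>v. s v \<noteq> 0 \<longrightarrow> f v * s v ^ N = p v))"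

lemma frac_poly_of_poly: "poly_over_reals f \<Longrightarrow> frac_poly s f"
  unfolding frac_poly_def by (intro exI[of _ f] exI[of _ 0]) simp

lemma real_function_algebra_frac_poly:
  assumes s: "poly_over_reals s"
  shows "real_function_algebra {f. frac_poly s f}"
proof
  show "(\<lambda>x. complex_of_real c) \<in> {f. frac_poly s f}" for c
    by (auto intro: frac_poly_of_poly poly_over_reals.const)
next
  fix f g assume "f \<in> {f. frac_poly s f}" "g \<in> {f. frac_poly s f}"
  then obtain p N q M where p: "poly_over_reals p" "\<And>v. s v \<noteq> 0 \<Longrightarrow> f v * s v ^ N = p v"
    and q: "poly_over_reals q" "\<And>v. s v \<noteq> 0 \<Longrightarrow> g v * s v ^ M = q v"
    unfolding frac_poly_def by blast
  have "poly_over_reals (\<lambda>v. p v * s v ^ M + q v * s v ^ N)"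
    by (intro poly.mem_intros p q s)
  moreover have "(f v + g v) * s v ^ (N + M) = p v * s v ^ M + q v * s v ^ N" if "s v \<noteq> 0" for v
    unfolding p(2)[OF that, symmetric] q(2)[OF that, symmetric] by (simp add: power_add algebra_simps)
  ultimately show "(\<lambda>x. f x + g x) \<in> {f. frac_poly s f}" unfolding frac_poly_def by blast
  have "poly_over_reals (\<lambda>v. p v * q v)"
    by (intro poly.mem_intros p q)
  moreover have "(f v * g v) * s v ^ (N + M) = p v * q v" if "s v \<noteq> 0" for v
    unfolding p(2)[OF that, symmetric] q(2)[OF that, symmetric] by (simp add: power_add algebra_simps)
  ultimately show "(\<lambda>x. f x * g x) \<in> {f. frac_poly s f}" unfolding frac_poly_def by blast
qed

lemma frac_poly_extend:
  assumes "frac_poly s f" "poly_over_reals e"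
  shows "frac_poly (\<lambda>v. s v * e v) f"
proof -
  obtain p N where p: "poly_over_reals p" "\<And>v. s v \<noteq> 0 \<Longrightarrow> f v * s v ^ N = p v"
    using assms(1) unfolding frac_poly_def by blast
  have "poly_over_reals (\<lambda>v. p v * e v ^ N)" by (intro poly.mem_intros p assms)
  moreover have "f v * (s v * e v) ^ N = p v * e v ^ N" if "s v * e v \<noteq> 0" for v
    using p(2)[of v] that by (simp add: power_mult_distrib flip: mult.assoc)
  ultimately show ?thesis unfolding frac_poly_def by blast
qed

text \<open>Inverting \<open>g\<close> multiplies the denominator by the numerator \<open>e\<close>
  of \<open>g\<close>. The last clause records that, away from the zeros of \<open>s\<close>,
  exactly the zeros of \<open>g\<close> are lost, so domains of nested quotients can be described
  exactly.\<close>

lemma frac_poly_inverse: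
  assumes "frac_poly s g" "poly_over_reals s"
  shows "\<exists>e. poly_over_reals e \<and> frac_poly (\<lambda>v. s v * e v) (\<lambda>v. 1 / g v) \<and> (\<forall>v. s v \<noteq> 0 \<longrightarrow> (e v = 0 \<longleftrightarrow> g v = 0))"
proof -
  obtain p N where p: "poly_over_reals p" "\<And>v. s v \<noteq> 0 \<Longrightarrow> g v * s v ^ N = p v"
    using assms(1) unfolding frac_poly_def by blast
  have "poly_over_reals (\<lambda>v. s v ^ Suc N)" by (intro poly.mem_intros assms)
  moreover have "1 / g v * (s v * p v) ^ 1 = s v ^ Suc N" if "s v * p v \<noteq> 0" for v
    using p(2)[of v] that by (auto simp flip: p(2))
  ultimately have "frac_poly (\<lambda>v. s v * p v) (\<lambda>v. 1 / g v)" unfolding frac_poly_def by blast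
  moreover have "\<forall>v. s v \<noteq> 0 \<longrightarrow> (p v = 0 \<longleftrightarrow> g v = 0)" using p(2) by (metis mult_eq_0_iff power_eq_0_iff)
  ultimately show ?thesis using p(1) by blast
qed

lemma frac_poly_continuous:
  assumes "frac_poly s f" "poly_over_reals s"
  shows "continuous_on {v. s v \<noteq> 0} f"
proof -
  obtain p N where p: "poly_over_reals p" "\<And>v. s v \<noteq> 0 \<Longrightarrow> f v * s v ^ N = p v"
    using assms(1) unfolding frac_poly_def by blast
  have "continuous_on {v. s v \<noteq> 0} (\<lambda>v. p v / s v ^ N)"
    by (intro continuous_intros continuous_on_poly_over_reals p assms(2)) auto
  moreover have "p v / s v ^ N = f v" if "v \<in> {v. s v \<noteq> 0}" for v
    using p(2)[of v] that by (auto simp: field_simps)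
  ultimately show ?thesis by (rule continuous_on_eq)
qed

lemma frac_poly_regular:
  assumes "frac_poly s f" "poly_over_reals s" "\<And>v. v \<in> V \<Longrightarrow> s v \<noteq> 0"
  shows "regular_function_on V f"
proof -
  obtain p N where p: "poly_over_reals p" "\<And>v. s v \<noteq> 0 \<Longrightarrow> f v * s v ^ N = p v"
    using assms(1) unfolding frac_poly_def by blast
  have "poly_over_reals (\<lambda>v. s v ^ N)" by (intro poly.mem_intros assms)
  moreover have "f v = p v / s v ^ N" if "v \<in> V" for v
    using p(2)[of v] assms(3)[OF that] by (simp add: field_simps)
  ultimately show ?thesis
    using p(1) assms(3) unfolding regular_function_on_def by (metis power_not_zero)
qed

lemma open_nonzero_poly: "poly_over_reals s \<Longrightarrow> open {v. s v \<noteq> 0}"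
  by (intro open_Collect_neq continuous_on_poly_over_reals continuous_on_const)

section \<open>Closure properties of the kinematic maps\<close>

definition config_of :: "complex^3^3 \<Rightarrow> complex^3 \<Rightarrow> config" where
  "config_of R P = (\<chi> n. case n of Inl (i, j) \<Rightarrow> R $ i $ j | Inr i \<Rightarrow> P $ i)"

lemma rot_config_of [simp]: "rot (config_of R P) = R" and transl_config_of [simp]: "transl (config_of R P) = P"
  by (simp_all add: rot_def transl_def config_of_def vec_eq_iff)

lemma config_of_rot_transl [simp]: "config_of (rot X) (transl X) = X"
  by (auto simp: rot_def transl_def config_of_def vec_eq_iff split: sum.splits)

lemma Sing_iff: "X \<in> Sing a \<longleftrightarrow> rotation (rot X) \<and> det (Jac a (rot X) (transl X)) = 0"
  by (simp add: Sing_def SE3_def rotation_def)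

context real_function_algebra
begin

lemma points_mem: "(\<lambda>x. base_pt a i $ l) \<in> S" "(\<lambda>x. plat_pt a i $ l) \<in> S"
  "(\<lambda>x. base_vec a i $ l) \<in> S" "(\<lambda>x. plat_vec a i $ l) \<in> S"
  by (auto simp: base_vec_def plat_vec_def intro: mem_intros)

lemma config_of_mem:
  assumes "\<And>i j. (\<lambda>x. R x $ i $ j) \<in> S" "\<And>i. (\<lambda>x. P x $ i) \<in> S"
  shows "(\<lambda>x. config_of (R x) (P x) $ n) \<in> S"
  by (cases n) (auto simp: config_of_def intro: assms split: prod.splits)

lemma Jac_mem:
  assumes "\<And>i j. (\<lambda>x. R x $ i $ j) \<in> S" "\<And>i. (\<lambda>x. P x $ i) \<in> S"
  shows "(\<lambda>x. Jac a (R x) (P x) $ i $ j) \<in> S"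
proof -
  have l: "(\<lambda>x. limb a (R x) (P x) i $ l) \<in> S" for l
  proof -
    have "(\<lambda>x. (R x *v plat_pt a i) $ l - base_pt a i $ l + P x $ l) \<in> S"
      by (intro mem_intros assms matrix_vector_mem points_mem)
    then show ?thesis by (simp add: limb_def)
  qed
  show ?thesis unfolding Jac_row by (intro join6_mem cross_mem points_mem l)
qed

lemma arch_matrix_mem: "(\<And>i. (\<lambda>x. v x $ i) \<in> S) \<Longrightarrow> (\<lambda>x. arch_matrix a (v x) $ i $ j) \<in> S"
  by (cases "i = 1") (auto simp: arch_matrix_def intro!: join6_mem points_mem)

lemma minors_mem: "(\<lambda>x. arch_minors a $ i) \<in> S" "(\<lambda>x. minor_p a $ l) \<in> S" "(\<lambda>x. minor_r a $ l) \<in> S"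
proof -
  show 1: "(\<lambda>x. arch_minors a $ i) \<in> S" for i
    unfolding arch_minors_def by (intro row_cofactors_mem arch_matrix_mem) (simp add: zero_mem)
  show "(\<lambda>x. minor_p a $ l) \<in> S" "(\<lambda>x. minor_r a $ l) \<in> S"
    unfolding minor_p_def minor_r_def by (intro fst6_mem snd6_mem 1)+
qed

lemma frame_mem: "(\<lambda>x. frame a $ i $ j) \<in> S"
  unfolding frame_def by (intro arch_matrix_mem minors_mem)

end

text \<open>The closure lemmas are applied to functions on a single point with real value. Reality
  of this determinant makes division by it admissible over the reals.\<close>

lemma det_frame_real: "det (frame a) \<in> \<real>"
proof -
  interpret R: real_function_algebra "{f :: unit \<Rightarrow> complex. f () \<in> \<real>}"
    by unfold_locales auto
  show ?thesis using R.det_mem[OF R.frame_mem] by simp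
qed

context real_function_algebra
begin

lemma axis_vec_mem:
  assumes "\<And>i j. (\<lambda>x. R x $ i $ j) \<in> S"
  shows "(\<lambda>x. axis_vec a (R x) $ i) \<in> S"
proof -
  have "(\<lambda>x. (R x *v minor_p a) $ i + minor_r a $ i) \<in> S"
    by (intro mem_intros matrix_vector_mem assms minors_mem)
  then show ?thesis by (simp add: axis_vec_def)
qed

context
  fixes R :: "'x \<Rightarrow> complex^3^3" and w :: "'x \<Rightarrow> complex^3"
  assumes R: "\<And>i j. (\<lambda>x. R x $ i $ j) \<in> S"
    and w: "\<And>i. (\<lambda>x. w x $ i) \<in> S"
begin

lemma particular_mem: "(\<lambda>x. particular a (R x) (w x) $ k) \<in> S"
proof -
  have rhs: "(\<lambda>x. triple_rhs a (R x) (w x) $ i) \<in> S" for i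
    by (cases "i = 1")
       (auto simp: triple_rhs_def intro!: mem_intros cdot_mem cross_mem matrix_vector_mem points_mem R w)
  have "(\<lambda>x. if j = k then triple_rhs a (R x) (w x) $ i else frame a $ i $ j) \<in> S" for i j
    by (cases "j = k") (auto intro: rhs frame_mem)
  then have "(\<lambda>x. det (\<chi> i j. if j = k then triple_rhs a (R x) (w x) $ i else frame a $ i $ j)) \<in> S"
    by (intro det_mem) simp
  moreover have "(\<lambda>x. inverse (det (frame a))) \<in> S"
    using const_mem det_frame_real[of a] by (metis Reals_cases Reals_inverse)
  ultimately show ?thesis
    unfolding particular_def divide_inverse by (simp add: mult_mem)
qed

lemma quad_g_mem: "(\<lambda>x. quad_g a (R x) (w x)) \<in> S"
  unfolding quad_g_def by (intro cdot_mem w axis_vec_mem R)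

lemma quad_c_mem: "(\<lambda>x. quad_c a (R x) (w x)) \<in> S"
proof -
  have "(\<lambda>x. (R x *v fst6 (particular a (R x) (w x))) $ i + snd6 (particular a (R x) (w x)) $ i) \<in> S" for i
    by (intro mem_intros matrix_vector_mem R fst6_mem snd6_mem particular_mem)
  then show ?thesis unfolding quad_c_def by (intro cdot_mem w) simp
qed

lemma screw_mem:
  assumes t: "t \<in> S"
  shows "(\<lambda>x. screw_u a (R x) (w x) (t x) $ i) \<in> S" "(\<lambda>x. screw_T a (R x) (w x) (t x) $ i) \<in> S"
proof -
  have "(\<lambda>x. fst6 (particular a (R x) (w x)) $ i + t x * minor_p a $ i) \<in> S" for i
    by (intro mem_intros fst6_mem particular_mem t minors_mem)
  then show 1: "(\<lambda>x. screw_u a (R x) (w x) (t x) $ i) \<in> S" for i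
    unfolding screw_u_def by (intro matrix_vector_mem R) simp
  have "(\<lambda>x. snd6 (particular a (R x) (w x)) $ i + t x * minor_r a $ i + screw_u a (R x) (w x) (t x) $ i) \<in> S"
    by (intro mem_intros snd6_mem particular_mem t minors_mem 1)
  then show "(\<lambda>x. screw_T a (R x) (w x) (t x) $ i) \<in> S" by (simp add: screw_T_def)
qed

lemma position_mem:
  assumes t: "t \<in> S" and inv: "(\<lambda>x. 1 / (screw_u a (R x) (w x) (t x) \<odot> w x)) \<in> S"
  shows "(\<lambda>x. position a (R x) (w x) (t x) $ i) \<in> S"
proof -
  have "(\<lambda>x. (1 / (screw_u a (R x) (w x) (t x) \<odot> w x))
      * complex_cross3 (screw_u a (R x) (w x) (t x)) (screw_T a (R x) (w x) (t x)) $ i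
      - (R x *v plat_pt a 1) $ i + base_pt a 1 $ i) \<in> S"
    by (intro mem_intros inv cross_mem screw_mem t matrix_vector_mem R points_mem)
  then show ?thesis by (simp add: position_def)
qed

end

lemma cayley_mem:
  assumes "\<And>i. (\<lambda>x. q x $ i) \<in> S" "(\<lambda>x. 1 / cayley_den (q x)) \<in> S"
  shows "(\<lambda>x. cayley (q x) $ i $ j) \<in> S"
  using mult_mem[OF cayley_num_mem[OF assms(1), of i j] assms(2)] by (simp add: cayley_def)

end

lemma frac_poly_inverse_self: "frac_poly s (\<lambda>v. 1 / s v)"
  unfolding frac_poly_def by (intro exI[of _ "\<lambda>_. 1"] exI[of _ 1]) (auto intro: poly.one_mem)

section \<open>Density of the good configurations\<close>

lemma norm_le_box:
  fixes v :: "complex^'n"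
  assumes "\<And>i. norm (v $ i) < \<delta> / CARD('n)"
  shows "norm v < \<delta>"
proof -
  have "norm v \<le> (\<Sum>i\<in>UNIV. norm (v $ i))"
    unfolding norm_vec_def by (rule L2_set_le_sum) simp
  also have "\<dots> < (\<Sum>i\<in>(UNIV :: 'n set). \<delta> / CARD('n))"
    by (intro sum_strict_mono) (use assms in auto)
  finally show ?thesis by simp
qed

lemma norm_axis_complex: "norm (axis j 1 :: complex^'n) = 1"
  by (simp add: norm_vec_def L2_set_def axis_def if_distrib[of "\<lambda>x. (norm x)\<^sup>2"] sum.delta cong: if_cong)

text \<open>\<open>vanishes_on_box\<close> yields a nearby zero and an axis \<open>j\<close> along
  which \<open>p\<close> is not constantly zero. Perturb this zero until \<open>\<psi> j\<close> is
  nonzero, then return to the zeros of \<open>p\<close> along the axis \<open>j\<close>. The return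
  changes only coordinate \<open>j\<close>, so restoring that coordinate recovers the point where
  \<open>\<psi> j\<close> is nonzero.\<close>

lemma zero_near_off_thin_set:
  fixes p :: "complex^'n \<Rightarrow> complex" and \<psi> :: "'n \<Rightarrow> complex^'n \<Rightarrow> complex"
  assumes p: "poly_over_reals p" "p x \<noteq> 0" and z0: "p z0 = 0" and \<delta>: "\<delta> > 0"
    and \<psi>: "\<And>j. poly_over_reals (\<psi> j)" "\<And>j. \<exists>y. \<psi> j y \<noteq> 0"
  shows "\<exists>z. dist z z0 < \<delta> \<and> p z = 0 \<and> (\<exists>j t. \<psi> j (replace_coord z j t) \<noteq> 0)"
proof -
  have "\<exists>z j t. (\<forall>i. norm (z $ i - z0 $ i) < \<delta> / CARD('n)) \<and> p z = 0 \<and> p (z + t *s axis j 1) \<noteq> 0"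
  proof (rule ccontr)
    assume no: "\<not> ?thesis"
    have "p z = 0" if "\<And>i. norm (z $ i - z0 $ i) < \<delta> / CARD('n)" for z
      by (rule vanishes_on_box[of p z0 UNIV "\<delta> / CARD('n)"]) (use z0 no that in auto)
    moreover obtain z where z: "dist z z0 < \<delta> / CARD('n)" "p z \<noteq> 0"
      using poly_over_reals_nonzero_near[OF p, of "\<delta> / CARD('n)" z0] \<delta> by auto
    moreover have "norm (z $ i - z0 $ i) < \<delta> / CARD('n)" for i
      using z(1) Finite_Cartesian_Product.norm_nth_le[of "z - z0" i] by (simp add: dist_norm)
    ultimately show False by blast
  qed
  then obtain z1 j t where z1: "\<And>i. norm (z1 $ i - z0 $ i) < \<delta> / CARD('n)" "p z1 = 0" "p (z1 + t *s axis j 1) \<noteq> 0"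
    by blast
  have d1: "dist z1 z0 < \<delta>"
    unfolding dist_norm by (rule norm_le_box) (use z1(1) in simp)
  obtain \<eta> where \<eta>: "\<eta> > 0"
    "\<And>z. dist z z1 < \<eta> \<Longrightarrow> \<exists>s. p (z + s *s axis j 1) = 0 \<and> dist (z + s *s axis j 1) z0 < \<delta>"
    using root_near_within[OF p(1) z1(2,3) d1] by blast
  obtain y where "\<psi> j y \<noteq> 0" using \<psi>(2) by blast
  then obtain z where z: "dist z z1 < \<eta>" "\<psi> j z \<noteq> 0"
    using poly_over_reals_nonzero_near[OF \<psi>(1) _ \<eta>(1)] by blast
  then obtain s where s: "p (z + s *s axis j 1) = 0" "dist (z + s *s axis j 1) z0 < \<delta>" using \<eta>(2) by blast
  have "replace_coord (z + s *s axis j 1) j (z $ j) = z"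
    by (auto simp: replace_coord_def vec_eq_iff axis_def)
  then show ?thesis using s z(2) by metis
qed

text \<open>Suppose that all nearby zeros lie on the hyperplane. Then at such a zero
  \<open>p\<close> is constant along every axis \<open>j\<close> other than \<open>k\<close>:
  otherwise one could nudge the point off the hyperplane and return along \<open>j\<close>, which
  keeps coordinate \<open>k\<close> nonzero. So \<open>p\<close> vanishes on a box in the
  hyperplane, hence on all of it, against the choice of \<open>x\<close>.\<close>

lemma zero_near_off_hyperplane:
  fixes p :: "complex^'n \<Rightarrow> complex"
  assumes p: "poly_over_reals p" "p x \<noteq> 0" "x $ k = 0" and z0: "p z0 = 0" and \<delta>: "\<delta> > 0"
  shows "\<exists>z. dist z z0 < \<delta> \<and> p z = 0 \<and> z $ k \<noteq> 0"
proof (rule ccontr)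
  assume no: "\<not> ?thesis"
  let ?r = "\<delta> / CARD('n)"
  have r: "?r > 0" using \<delta> by simp
  have zk: "z $ k = 0" if "dist z z0 < \<delta>" "p z = 0" for z using no that by blast
  have z0k: "z0 $ k = 0" using zk[of z0] z0 \<delta> by simp
  have step: "p (z + t *s axis j 1) = 0"
    if z: "\<And>i. norm (z $ i - z0 $ i) < ?r" "p z = 0" "j \<in> UNIV - {k}" for z j t
  proof (rule ccontr)
    assume nz: "p (z + t *s axis j 1) \<noteq> 0"
    have dz: "dist z z0 < \<delta>"
      unfolding dist_norm by (rule norm_le_box) (use z(1) in simp)
    obtain \<eta> where \<eta>: "\<eta> > 0"
      "\<And>z'. dist z' z < \<eta> \<Longrightarrow> \<exists>t. p (z' + t *s axis j 1) = 0 \<and> dist (z' + t *s axis j 1) z0 < \<delta>"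
      using root_near_within[OF p(1) z(2) nz dz] by blast
    define z' where "z' = z + complex_of_real (\<eta> / 2) *s axis k 1"
    have "dist z' z < \<eta>" using \<eta>(1) unfolding z'_def dist_add_smult norm_axis_complex by simp
    then obtain t' where t': "p (z' + t' *s axis j 1) = 0" "dist (z' + t' *s axis j 1) z0 < \<delta>" using \<eta>(2) by blast
    then have "(z' + t' *s axis j 1) $ k = 0" by (intro zk)
    moreover have "(z' + t' *s axis j 1) $ k = of_real (\<eta> / 2)"
      using z(3) zk[OF dz z(2)] by (simp add: z'_def axis_def)
    ultimately show False using \<eta>(1) by simp
  qed
  have box: "p z = 0" if "\<And>i. norm (z $ i - z0 $ i) < ?r" "z $ k = 0" for z
    by (rule vanishes_on_box[of p z0 "UNIV - {k}" ?r]) (use z0 step that z0k in auto)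
  have "poly_over_reals (\<lambda>z. replace_coord z k 0 $ i)" for i :: 'n
    by (cases "i = k") (auto simp: replace_coord_def intro: poly.zero_mem poly_over_reals.coord)
  then have "poly_over_reals (\<lambda>z. p (replace_coord z k 0))"
    by (rule poly.poly_compose_mem[OF p(1)])
  moreover have "replace_coord x k 0 = x" using p(3) by (simp add: replace_coord_def vec_eq_iff)
  ultimately obtain z where z: "dist z z0 < ?r" "p (replace_coord z k 0) \<noteq> 0"
    using poly_over_reals_nonzero_near[of "\<lambda>z. p (replace_coord z k 0)" x ?r z0] p(2) r by auto
  have "norm (z $ i - z0 $ i) < ?r" for i
    using z(1) Finite_Cartesian_Product.norm_nth_le[of "z - z0" i] by (simp add: dist_norm)
  then have "p (replace_coord z k 0) = 0"
    using r z0k by (intro box) (auto simp: replace_coord_def)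
  then show False using z(2) by simp
qed

section \<open>Charts of SE(3) and the equation of the singular locus\<close>

definition chart :: "complex^3^3 \<Rightarrow> chart_coords \<Rightarrow> config" where
  "chart F z = config_of (F ** cayley (rot_part z)) (transl_part z)"

definition join_parts :: "complex^3 \<Rightarrow> complex^3 \<Rightarrow> chart_coords" where
  "join_parts q P = (\<chi> n. case n of Inl i \<Rightarrow> q $ i | Inr i \<Rightarrow> P $ i)"

lemma join_parts [simp]: "rot_part (join_parts q P) = q" "transl_part (join_parts q P) = P"
  by (simp_all add: join_parts_def rot_part_def transl_part_def vec_eq_iff)

lemma poly_parts: "poly_over_reals (\<lambda>z. rot_part z $ i)" "poly_over_reals (\<lambda>z. transl_part z $ i)"
  by (simp_all add: rot_part_def transl_part_def poly_over_reals.coord)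

abbreviation "part_den \<equiv> \<lambda>z. cayley_den (rot_part z)"

lemma poly_part_den: "poly_over_reals part_den"
  by (intro poly.cayley_den_mem poly_parts)

lemma frac_cayley_part: "frac_poly part_den (\<lambda>z. (F ** cayley (rot_part z)) $ i $ j)" if "\<And>i j. F $ i $ j \<in> \<real>"
proof -
  interpret A: real_function_algebra "{f. frac_poly part_den f}"
    by (rule real_function_algebra_frac_poly[OF poly_part_den])
  have F: "(\<lambda>z. F $ i $ j) \<in> {f. frac_poly part_den f}" for i j
    using A.const_mem that[of i j] by (metis Reals_cases)
  show ?thesis
    using A.matrix_matrix_mem[OF F A.cayley_mem, of rot_part i j] frac_poly_inverse_self frac_poly_of_poly[OF poly_parts(1)]
    by blast
qed

lemma chart_continuous:
  assumes "\<And>i j. F $ i $ j \<in> \<real>"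
  shows "continuous_on {z. part_den z \<noteq> 0} (chart F)"
proof -
  interpret A: real_function_algebra "{f. frac_poly part_den f}"
    by (rule real_function_algebra_frac_poly[OF poly_part_den])
  have "frac_poly part_den (\<lambda>z. chart F z $ n)" for n
    unfolding chart_def
    using A.config_of_mem[of "\<lambda>z. F ** cayley (rot_part z)" transl_part n] frac_cayley_part[OF assms]
      frac_poly_of_poly[OF poly_parts(2)] by blast
  then have "continuous_on {z. part_den z \<noteq> 0} (\<lambda>z. \<chi> n. chart F z $ n)"
    by (intro continuous_on_vec_lambda frac_poly_continuous poly_part_den)
  then show ?thesis by simp
qed

lemma chart_near:
  assumes F: "\<And>i j. F $ i $ j \<in> \<real>" and "part_den z0 \<noteq> 0" "\<epsilon> > 0"
  shows "\<exists>\<delta>>0. \<forall>z. dist z z0 < \<delta> \<longrightarrow> part_den z \<noteq> 0 \<and> dist (chart F z) (chart F z0) < \<epsilon>"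
proof -
  have o: "open {z. part_den z \<noteq> 0}" by (rule open_nonzero_poly[OF poly_part_den])
  then have "isCont (chart F) z0"
    using chart_continuous[OF F] assms(2) by (simp add: continuous_on_eq_continuous_at)
  then obtain \<delta> where \<delta>: "\<delta> > 0" "\<And>z. dist z z0 < \<delta> \<Longrightarrow> dist (chart F z) (chart F z0) < \<epsilon>"
    using assms(3) unfolding continuous_at_eps_delta by blast
  obtain \<delta>' where "\<delta>' > 0" "ball z0 \<delta>' \<subseteq> {z. part_den z \<noteq> 0}"
    using o assms(2) open_contains_ball by blast
  then show ?thesis using \<delta>
    by (intro exI[of _ "min \<delta> \<delta>'"]) (auto simp: subset_iff dist_commute)
qed

lemma chart_det:
  assumes "\<And>i j. F $ i $ j \<in> \<real>"
  shows "\<exists>p. poly_over_reals p \<and>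
    (\<forall>z. part_den z \<noteq> 0 \<longrightarrow> (p z = 0 \<longleftrightarrow> det (Jac a (F ** cayley (rot_part z)) (transl_part z)) = 0))"
proof -
  interpret A: real_function_algebra "{f. frac_poly part_den f}"
    by (rule real_function_algebra_frac_poly[OF poly_part_den])
  have "(\<lambda>z. det (Jac a (F ** cayley (rot_part z)) (transl_part z))) \<in> {f. frac_poly part_den f}"
    by (intro A.det_mem A.Jac_mem) (simp_all add: frac_cayley_part[OF assms] frac_poly_of_poly[OF poly_parts(2)])
  then obtain p N where "poly_over_reals p"
    "\<And>z. part_den z \<noteq> 0 \<Longrightarrow> det (Jac a (F ** cayley (rot_part z)) (transl_part z)) * part_den z ^ N = p z"
    unfolding frac_poly_def by blast
  then show ?thesis by (metis mult_eq_0_iff power_eq_0_iff)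
qed

lemma flip_real: "flip k $ i $ j \<in> \<real>" and mat_1_real: "(mat 1 :: complex^3^3) $ i $ j \<in> \<real>"
  by (auto simp: flip_def mat_def)

lemma part_den_0: "part_den (join_parts 0 P) = 1" and cayley_zero: "cayley 0 = mat 1"
  by (simp_all add: cayley_0 cayley_eq mat3_simps)

text \<open>The point where \<open>p\<close> is nonzero has rotation coordinates 0, that is,
  rotation \<open>F\<close>. For \<open>F = flip k\<close> it therefore lies on the hyperplane of
  vanishing coordinate \<open>k\<close>, as \<open>zero_near_off_hyperplane\<close>
  requires.\<close>

lemma chart_setup:
  assumes F: "\<And>i j. F $ i $ j \<in> \<real>" "F ** F = mat 1" "rotation F"
    and X: "X \<in> Sing a" "1 + trace (F ** rot X) \<noteq> 0" and ns: "nonsingular_at F a" and \<epsilon>: "\<epsilon> > 0"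
  shows "\<exists>z0 \<delta> p P. \<delta> > 0 \<and> poly_over_reals p \<and> p z0 = 0 \<and> p (join_parts 0 P) \<noteq> 0 \<and>
    (\<forall>z. dist z z0 < \<delta> \<longrightarrow> part_den z \<noteq> 0 \<and> dist (chart F z) X < \<epsilon>) \<and>
    (\<forall>z. part_den z \<noteq> 0 \<longrightarrow> (p z = 0 \<longleftrightarrow> chart F z \<in> Sing a))"
proof -
  define z0 where "z0 = join_parts (cayley_coords (F ** rot X)) (transl X)"
  have r: "rotation (F ** rot X)" using X(1) by (intro rotation_mult F) (simp add: Sing_iff)
  have den0: "part_den z0 \<noteq> 0" using cayley_cayley_coords(1)[OF r X(2)] X(2) by (simp add: z0_def)
  have "F ** cayley (rot_part z0) = rot X"
    by (simp add: z0_def cayley_cayley_coords(2)[OF r X(2)] matrix_mul_assoc F(2))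
  then have X0: "chart F z0 = X" by (simp add: chart_def) (simp add: z0_def)
  obtain p where p: "poly_over_reals p"
    "\<And>z. part_den z \<noteq> 0 \<Longrightarrow> p z = 0 \<longleftrightarrow> det (Jac a (F ** cayley (rot_part z)) (transl_part z)) = 0"
    using chart_det[of F a, OF F(1)] by blast
  have pS: "p z = 0 \<longleftrightarrow> chart F z \<in> Sing a" if "part_den z \<noteq> 0" for z
    using p(2)[OF that] that by (simp add: Sing_iff chart_def rotation_mult F(3) rotation_cayley)
  obtain P where P: "det (Jac a F (complex_vec P)) \<noteq> 0" using ns unfolding nonsingular_at_def by blast
  have "p (join_parts 0 (complex_vec P)) \<noteq> 0"
    using p(2)[of "join_parts 0 (complex_vec P)"] P by (simp only: part_den_0) (simp add: cayley_zero)
  moreover have "p z0 = 0" using pS[OF den0] X(1) by (simp add: X0)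
  moreover obtain \<delta> where "\<delta> > 0" "\<And>z. dist z z0 < \<delta> \<Longrightarrow> part_den z \<noteq> 0 \<and> dist (chart F z) X < \<epsilon>"
    using chart_near[of F z0 \<epsilon>, OF F(1) den0 \<epsilon>] unfolding X0 by blast
  ultimately show ?thesis using p(1) pS by blast
qed

context generic_architecture
begin

lemma near_cayley_chart:
  assumes X: "X \<in> Sing a" and \<epsilon>: "\<epsilon> > 0"
  shows "\<exists>Y. dist Y X < \<epsilon> \<and> Y \<in> Sing a \<and> 1 + trace (rot Y) \<noteq> 0"
proof (cases "1 + trace (rot X) = 0")
  case False
  then show ?thesis using X \<epsilon> by (intro exI[of _ X]) simp
next
  case True
  obtain k where k: "1 + trace (flip k ** rot X) \<noteq> 0" using exists_flip_trace[OF True] by blast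
  obtain z0 \<delta> p P where *: "\<delta> > 0" "poly_over_reals p" "p z0 = 0" "p (join_parts 0 P) \<noteq> 0"
    "\<And>z. dist z z0 < \<delta> \<Longrightarrow> part_den z \<noteq> 0 \<and> dist (chart (flip k) z) X < \<epsilon>"
    "\<And>z. part_den z \<noteq> 0 \<Longrightarrow> p z = 0 \<longleftrightarrow> chart (flip k) z \<in> Sing a"
    using chart_setup[OF flip_real flip_flip rotation_flip X k nonsingular_flip \<epsilon>] by blast
  have "join_parts 0 P $ Inl k = 0" by (simp add: join_parts_def)
  then obtain z where z: "dist z z0 < \<delta>" "p z = 0" "z $ Inl k \<noteq> 0"
    using zero_near_off_hyperplane[OF *(2,4) _ *(3,1)] by blast
  have "1 + trace (rot (chart (flip k) z)) \<noteq> 0"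
    using z(3) *(5)[OF z(1)] by (simp add: chart_def trace_flip_cayley rot_part_def)
  then show ?thesis using *(5)[OF z(1)] *(6) z(2) by blast
qed

definition tame :: "config \<Rightarrow> bool" where
  "tame Y \<longleftrightarrow> Y \<in> Sing a \<and> 1 + trace (rot Y) \<noteq> 0 \<and>
    (\<forall>u w. u \<noteq> 0 \<or> w \<noteq> 0 \<longrightarrow> reciprocal a (rot Y) (transl Y) u w \<longrightarrow> u \<odot> w \<noteq> 0)"

text \<open>\<open>thin_zero\<close> is read backwards: a singular configuration at which
  \<open>\<Psi> j\<close> is nonzero after overwriting coordinate \<open>j\<close> is reciprocal to
  no screw of pitch zero with \<open>w \<noteq> 0\<close>, and nondegeneracy excludes
  \<open>w = 0\<close>.\<close>

lemma near_tame:
  assumes X: "X \<in> Sing a" "1 + trace (rot X) \<noteq> 0" and \<epsilon>: "\<epsilon> > 0"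
  shows "\<exists>Y. dist Y X < \<epsilon> \<and> tame Y"
proof -
  have "1 + trace (mat 1 ** rot X) \<noteq> 0" using X(2) by simp
  then obtain z0 \<delta> p P where *: "\<delta> > 0" "poly_over_reals p" "p z0 = 0" "p (join_parts 0 P) \<noteq> 0"
    "\<And>z. dist z z0 < \<delta> \<Longrightarrow> part_den z \<noteq> 0 \<and> dist (chart (mat 1) z) X < \<epsilon>"
    "\<And>z. part_den z \<noteq> 0 \<Longrightarrow> p z = 0 \<longleftrightarrow> chart (mat 1) z \<in> Sing a"
    using chart_setup[OF mat_1_real matrix_mul_lid _ X(1) _ nonsingular_1 \<epsilon>]
    by (auto simp: rotation_def orthogonal_matrix_def)
  have e: "poly_over_reals (\<lambda>z. encode a z $ n)" for n
    by (cases n) (auto simp: encode_def split: sum.splits prod.splits intro: poly_over_reals.intros)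
  have \<psi>: "poly_over_reals (\<lambda>z. \<Psi> j (encode a z))" for j
    by (rule poly.poly_compose_mem[OF thin_poly e])
  have \<psi>0: "\<exists>y. \<Psi> j (encode a y) \<noteq> 0" for j using thin_nonzero[of j] by blast
  obtain z j t where z: "dist z z0 < \<delta>" "p z = 0" "\<Psi> j (encode a (replace_coord z j t)) \<noteq> 0"
    using zero_near_off_thin_set[OF *(2,4,3,1), of "\<lambda>j z. \<Psi> j (encode a z)", OF \<psi> \<psi>0] by blast
  have den: "part_den z \<noteq> 0" using *(5)[OF z(1)] by blast
  have rot: "rotation (cayley (rot_part z))" by (rule rotation_cayley[OF den])
  define Y where "Y = chart (mat 1) z"
  have Y: "rot Y = cayley (rot_part z)" "transl Y = transl_part z" by (simp_all add: Y_def chart_def)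
  have "tame Y"
    unfolding tame_def
  proof (intro conjI allI impI)
    show "Y \<in> Sing a" using *(6)[OF den] z(2) by (simp add: Y_def)
    show "1 + trace (rot Y) \<noteq> 0" using den by (simp add: Y trace_cayley)
    fix u w assume uw: "u \<noteq> 0 \<or> w \<noteq> 0" "reciprocal a (rot Y) (transl Y) u w"
    then have "w \<noteq> 0"
      using reciprocal_direction_nonzero[OF rotation_orthogonal[OF rot] nondeg] unfolding Y by blast
    then show "u \<odot> w \<noteq> 0" using thin_zero[OF den] uw(2) z(3) unfolding Y by blast
  qed
  then show ?thesis using *(5)[OF z(1)] unfolding Y_def by blast
qed

end

section \<open>The hypersurface T.w = 0 over rotations, directions and the parameter t\<close>

type_synonym quad_coords = "complex^(3 + (3 + 1))"

definition q_part :: "quad_coords \<Rightarrow> complex^3" where "q_part \<zeta> = (\<chi> i. \<zeta> $ Inl i)"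
definition w_part :: "quad_coords \<Rightarrow> complex^3" where "w_part \<zeta> = (\<chi> i. \<zeta> $ Inr (Inl i))"
definition t_part :: "quad_coords \<Rightarrow> complex" where "t_part \<zeta> = \<zeta> $ Inr (Inr 1)"

definition quad_pt :: "complex^3 \<Rightarrow> complex^3 \<Rightarrow> complex \<Rightarrow> quad_coords" where
  "quad_pt q w t = (\<chi> n. case n of Inl i \<Rightarrow> q $ i | Inr m \<Rightarrow> (case m of Inl i \<Rightarrow> w $ i | Inr _ \<Rightarrow> t))"

lemma quad_pt_parts [simp]: "q_part (quad_pt q w t) = q" "w_part (quad_pt q w t) = w" "t_part (quad_pt q w t) = t"
  by (simp_all add: quad_pt_def q_part_def w_part_def t_part_def vec_eq_iff)

lemma quad_pt_line [simp]:
  "q_part (\<zeta> + s *s \<zeta>') = q_part \<zeta> + s *s q_part \<zeta>'" "w_part (\<zeta> + s *s \<zeta>') = w_part \<zeta> + s *s w_part \<zeta>'"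
  "t_part (\<zeta> + s *s \<zeta>') = t_part \<zeta> + s * t_part \<zeta>'"
  by (simp_all add: q_part_def w_part_def t_part_def vec_eq_iff)

definition quad_rot :: "quad_coords \<Rightarrow> complex^3^3" where "quad_rot \<zeta> = cayley (q_part \<zeta>)"
definition quad_den :: "quad_coords \<Rightarrow> complex" where "quad_den \<zeta> = cayley_den (q_part \<zeta>)"

text \<open>The direction \<open>w\<close> is not normalised here, because the screw of a tame
  configuration may have \<open>w $ 3 = 0\<close>.\<close>

definition quad :: "architecture \<Rightarrow> quad_coords \<Rightarrow> complex" where
  "quad a \<zeta> = quad_c a (quad_rot \<zeta>) (w_part \<zeta>) + t_part \<zeta> * quad_g a (quad_rot \<zeta>) (w_part \<zeta>)"

lemma poly_quad_parts:
  "poly_over_reals (\<lambda>\<zeta>. q_part \<zeta> $ i)" "poly_over_reals (\<lambda>\<zeta>. w_part \<zeta> $ i)" "poly_over_reals t_part"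
  by (simp_all add: q_part_def w_part_def t_part_def[abs_def] poly_over_reals.coord)

lemma poly_quad_den: "poly_over_reals quad_den"
  unfolding quad_den_def[abs_def] by (intro poly.cayley_den_mem poly_quad_parts)

lemma frac_quad_rot: "frac_poly quad_den (\<lambda>\<zeta>. quad_rot \<zeta> $ i $ j)"
proof -
  interpret A: real_function_algebra "{f. frac_poly quad_den f}"
    by (rule real_function_algebra_frac_poly[OF poly_quad_den])
  show ?thesis
    using A.cayley_mem[of q_part i j] frac_poly_inverse_self[of quad_den] frac_poly_of_poly[OF poly_quad_parts(1)]
    by (simp add: quad_rot_def quad_den_def)
qed

lemma frac_poly_numerator:
  "frac_poly s f \<Longrightarrow> \<exists>p. poly_over_reals p \<and> (\<forall>v. s v \<noteq> 0 \<longrightarrow> (p v = 0 \<longleftrightarrow> f v = 0))"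
  unfolding frac_poly_def by (metis mult_eq_0_iff power_eq_0_iff)

lemma quad_numerator:
  "\<exists>p. poly_over_reals p \<and> (\<forall>\<zeta>. quad_den \<zeta> \<noteq> 0 \<longrightarrow> (p \<zeta> = 0 \<longleftrightarrow> quad a \<zeta> = 0))"
proof -
  interpret A: real_function_algebra "{f. frac_poly quad_den f}"
    by (rule real_function_algebra_frac_poly[OF poly_quad_den])
  have "quad a \<in> {f. frac_poly quad_den f}"
    unfolding quad_def[abs_def]
    by (intro A.mem_intros A.quad_c_mem A.quad_g_mem)
       (simp_all add: frac_quad_rot frac_poly_of_poly poly_quad_parts)
  then show ?thesis using frac_poly_numerator by blast
qed

lemma quad_g_linear: "quad_g a R (w + w') = quad_g a R w + quad_g a R w'"
  "quad_g a R (w - w') = quad_g a R w - quad_g a R w'" "quad_g a R (t *s w) = t * quad_g a R w"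
  by (simp_all add: quad_g_def cdot_linear)

lemma quad_g_nonzero:
  assumes "rotation R" "nondegenerate a"
  shows "\<exists>n. quad_g a R n \<noteq> 0"
proof -
  obtain i where "axis_vec a R $ i \<noteq> 0"
    using axis_vec_nonzero[OF rotation_orthogonal[OF assms(1)] assms(2)] by (auto simp: vec_eq_iff)
  then have "quad_g a R (axis i 1) \<noteq> 0"
    by (simp add: quad_g_def cdot_def axis_def if_distrib[of "\<lambda>x. x * _"] sum.delta cong: if_cong)
  then show ?thesis by blast
qed

lemma quad_rot_rotation: "quad_den \<zeta> \<noteq> 0 \<Longrightarrow> rotation (quad_rot \<zeta>)"
  by (simp add: quad_rot_def quad_den_def rotation_cayley)

lemma quad_g_numerator:
  "\<exists>p. poly_over_reals p \<and> (\<forall>\<zeta>. quad_den \<zeta> \<noteq> 0 \<longrightarrow> (p \<zeta> = 0 \<longleftrightarrow> quad_g a (quad_rot \<zeta>) (w_part \<zeta>) = 0))"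
proof -
  interpret A: real_function_algebra "{f. frac_poly quad_den f}"
    by (rule real_function_algebra_frac_poly[OF poly_quad_den])
  have "(\<lambda>\<zeta>. quad_g a (quad_rot \<zeta>) (w_part \<zeta>)) \<in> {f. frac_poly quad_den f}"
    by (intro A.quad_g_mem) (simp_all add: frac_quad_rot frac_poly_of_poly poly_quad_parts)
  then show ?thesis using frac_poly_numerator by blast
qed

text \<open>The return moves only \<open>w\<close> and t, so the rotation gained by a perturbation
  is kept and the denominator \<open>quad_den\<close> cannot become zero on the way.\<close>

lemma quad_root_near:
  assumes den: "quad_den \<zeta> \<noteq> 0" and q: "quad a \<zeta> = 0" and near: "dist \<zeta> \<zeta>0 < \<delta>"
    and nz: "quad a (\<zeta> + quad_pt 0 v t) \<noteq> 0"
  shows "\<exists>\<eta>>0. \<forall>z. dist z \<zeta> < \<eta> \<longrightarrow> quad_den z \<noteq> 0 \<longrightarrow>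
    (\<exists>s. quad a (z + s *s quad_pt 0 v t) = 0 \<and> dist (z + s *s quad_pt 0 v t) \<zeta>0 < \<delta>)"
proof -
  obtain p where p: "poly_over_reals p" "\<And>\<zeta>. quad_den \<zeta> \<noteq> 0 \<Longrightarrow> p \<zeta> = 0 \<longleftrightarrow> quad a \<zeta> = 0"
    using quad_numerator by blast
  have same: "quad_den (z + s *s quad_pt 0 v t) = quad_den z" for z s by (simp add: quad_den_def)
  have "quad_den (\<zeta> + 1 *s quad_pt 0 v t) \<noteq> 0" using den unfolding same .
  then have "p (\<zeta> + 1 *s quad_pt 0 v t) \<noteq> 0" using nz p(2) by simp
  then show ?thesis
    using root_near_within[OF p(1) _ _ near] p(2)[OF den] p(2) q same by metis
qed

text \<open>Where \<open>quad_g\<close> is nonzero the equation is nonconstant in t, so rotation and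
  direction can be perturbed freely and t alone is readjusted.\<close>

lemma quad_near_third_coordinate:
  assumes den: "quad_den \<zeta> \<noteq> 0" and q: "quad a \<zeta> = 0" and g: "quad_g a (quad_rot \<zeta>) (w_part \<zeta>) \<noteq> 0"
    and \<epsilon>: "\<epsilon> > 0"
  shows "\<exists>\<xi>. dist \<xi> \<zeta> < \<epsilon> \<and> quad_den \<xi> \<noteq> 0 \<and> quad a \<xi> = 0
    \<and> quad_g a (quad_rot \<xi>) (w_part \<xi>) \<noteq> 0 \<and> w_part \<xi> $ 3 \<noteq> 0"
proof -
  obtain p where p: "poly_over_reals p"
    "\<And>\<zeta>. quad_den \<zeta> \<noteq> 0 \<Longrightarrow> p \<zeta> = 0 \<longleftrightarrow> quad_g a (quad_rot \<zeta>) (w_part \<zeta>) = 0"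
    using quad_g_numerator by blast
  have "quad a (\<zeta> + 1 *s quad_pt 0 0 1) = quad a \<zeta> + quad_g a (quad_rot \<zeta>) (w_part \<zeta>)"
    unfolding quad_def quad_rot_def quad_pt_line by (simp add: distrib_right)
  then have "quad a (\<zeta> + quad_pt 0 0 1) \<noteq> 0" using q g by simp
  moreover have near: "dist \<zeta> \<zeta> < \<epsilon>" using \<epsilon> by simp
  ultimately obtain \<eta> where \<eta>: "\<eta> > 0" "\<And>z. dist z \<zeta> < \<eta> \<Longrightarrow> quad_den z \<noteq> 0 \<Longrightarrow>
      \<exists>s. quad a (z + s *s quad_pt 0 0 1) = 0 \<and> dist (z + s *s quad_pt 0 0 1) \<zeta> < \<epsilon>"
    using quad_root_near[OF den q near] by blast
  have pd: "poly_over_reals (\<lambda>\<zeta>. p \<zeta> * quad_den \<zeta>)" by (intro poly.mult_mem p(1) poly_quad_den)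
  have nz: "p \<zeta> * quad_den \<zeta> \<noteq> 0" using p(2)[OF den] g den by simp
  have "w_part (quad_pt 0 (axis 3 1) 0) $ 3 \<noteq> 0" by simp
  then obtain y where "p y * quad_den y * w_part y $ 3 \<noteq> 0"
    using poly_over_reals_mult_nonzero[OF pd poly_quad_parts(2) nz] by blast
  then obtain z where z: "dist z \<zeta> < \<eta>" "p z * quad_den z * w_part z $ 3 \<noteq> 0"
    using poly_over_reals_nonzero_near[OF poly.mult_mem[OF pd poly_quad_parts(2)] _ \<eta>(1)] by blast
  then obtain s where s: "quad a (z + s *s quad_pt 0 0 1) = 0" "dist (z + s *s quad_pt 0 0 1) \<zeta> < \<epsilon>"
    using \<eta>(2)[of z] by auto
  show ?thesis
    using s z(2) p(2)[of z] by (intro exI[of _ "z + s *s quad_pt 0 0 1"]) (simp add: quad_den_def quad_rot_def)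
qed

text \<open>On the line from \<open>w\<close> to \<open>v\<close> the equation is nonconstant, since
  its value at \<open>v\<close> is \<open>quad_c\<close> there. Perturb \<open>w\<close> by a small
  multiple of \<open>n\<close> off the plane \<open>quad_g = 0\<close> and return parallel to
  \<open>v - w\<close>. This direction lies in the plane, so \<open>quad_g\<close> keeps its nonzero
  value.\<close>

lemma quad_near_nonzero_g:
  assumes a: "nondegenerate a" and den: "quad_den \<zeta> \<noteq> 0" and q: "quad a \<zeta> = 0"
    and v: "quad_g a (quad_rot \<zeta>) v = 0" "quad_c a (quad_rot \<zeta>) v \<noteq> 0" and \<epsilon>: "\<epsilon> > 0"
  shows "\<exists>\<xi>. dist \<xi> \<zeta> < \<epsilon> \<and> quad_den \<xi> \<noteq> 0 \<and> quad a \<xi> = 0 \<and> quad_g a (quad_rot \<xi>) (w_part \<xi>) \<noteq> 0"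
proof (cases "quad_g a (quad_rot \<zeta>) (w_part \<zeta>) = 0")
  case False
  then show ?thesis using den q \<epsilon> by (intro exI[of _ \<zeta>]) simp
next
  case True
  define d where "d = quad_pt 0 (v - w_part \<zeta>) 0"
  have "quad a (\<zeta> + 1 *s d) = quad_c a (quad_rot \<zeta>) v + t_part \<zeta> * quad_g a (quad_rot \<zeta>) v"
    unfolding quad_def quad_rot_def quad_pt_line by (simp add: d_def)
  then have "quad a (\<zeta> + d) \<noteq> 0" using v by simp
  moreover have near: "dist \<zeta> \<zeta> < \<epsilon>" using \<epsilon> by simp
  ultimately obtain \<eta> where \<eta>: "\<eta> > 0" "\<And>z. dist z \<zeta> < \<eta> \<Longrightarrow> quad_den z \<noteq> 0 \<Longrightarrow>
      \<exists>s. quad a (z + s *s d) = 0 \<and> dist (z + s *s d) \<zeta> < \<epsilon>"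
    using quad_root_near[OF den q near] unfolding d_def by blast
  obtain n where n: "quad_g a (quad_rot \<zeta>) n \<noteq> 0"
    using quad_g_nonzero[OF quad_rot_rotation[OF den] a] by blast
  obtain s where s: "s > 0" "s * norm (quad_pt 0 n 0) < \<eta>" using small_multiple[OF \<eta>(1)] by blast
  define z where "z = \<zeta> + of_real s *s quad_pt 0 n 0"
  have "dist z \<zeta> < \<eta>" using s unfolding z_def dist_add_smult by simp
  moreover have "quad_den z \<noteq> 0" using den by (simp add: z_def quad_den_def)
  ultimately obtain t where t: "quad a (z + t *s d) = 0" "dist (z + t *s d) \<zeta> < \<epsilon>" using \<eta>(2) by blast
  have "quad_rot (z + t *s d) = quad_rot \<zeta>" "quad_den (z + t *s d) = quad_den \<zeta>"
    by (simp_all add: z_def d_def quad_rot_def quad_den_def)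
  moreover have "quad_g a (quad_rot \<zeta>) (w_part (z + t *s d)) = of_real s * quad_g a (quad_rot \<zeta>) n"
    using True v(1) by (simp add: z_def d_def quad_g_linear)
  ultimately show ?thesis using n s(1) t den by (intro exI[of _ "z + t *s d"]) simp
qed

text \<open>At the identity rotation the obstruction provides a suitable \<open>v\<close>, so one
  exists for a dense set of rotations. The rotation is perturbed into that set, and the return to
  the hypersurface moves \<open>w\<close> only.\<close>

lemma quad_near_transversal:
  assumes a: "nondegenerate a" and ob: "obstruction a (e, k) \<noteq> 0"
    and den: "quad_den \<zeta> \<noteq> 0" and q: "quad a \<zeta> = 0" and g0: "quad_g a (quad_rot \<zeta>) (w_part \<zeta>) = 0"
    and \<epsilon>: "\<epsilon> > 0"
  shows "\<exists>\<xi> v. dist \<xi> \<zeta> < \<epsilon> \<and> quad_den \<xi> \<noteq> 0 \<and> quad a \<xi> = 0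
    \<and> quad_g a (quad_rot \<xi>) v = 0 \<and> quad_c a (quad_rot \<xi>) v \<noteq> 0"
proof -
  let ?v = "\<lambda>\<zeta>. complex_cross3 (axis_vec a (quad_rot \<zeta>)) (complex_vec e)"
  interpret A: real_function_algebra "{f. frac_poly quad_den f}"
    by (rule real_function_algebra_frac_poly[OF poly_quad_den])
  have "(\<lambda>\<zeta>. quad_c a (quad_rot \<zeta>) (?v \<zeta>)) \<in> {f. frac_poly quad_den f}"
    by (intro A.quad_c_mem A.cross_mem A.axis_vec_mem)
       (simp_all add: frac_quad_rot frac_poly_of_poly poly_over_reals.const)
  then obtain \<psi> where \<psi>: "poly_over_reals \<psi>"
    "\<And>\<zeta>. quad_den \<zeta> \<noteq> 0 \<Longrightarrow> \<psi> \<zeta> = 0 \<longleftrightarrow> quad_c a (quad_rot \<zeta>) (?v \<zeta>) = 0"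
    using frac_poly_numerator by blast
  define o0 where "o0 = quad_pt 0 0 0"
  have den0: "quad_den o0 = 1" and rot0: "quad_rot o0 = mat 1"
    by (simp_all add: o0_def quad_den_def quad_rot_def cayley_0 cayley_zero)
  have "?v o0 = ruling_dir a e" by (simp add: rot0 axis_vec_def ruling_dir_def)
  then have nz0: "\<psi> o0 * quad_den o0 \<noteq> 0"
    using \<psi>(2)[of o0] obstruction_quad_c[OF ob nondegenerate_det_frame[OF a]] by (simp add: den0 rot0)
  have pd: "poly_over_reals (\<lambda>\<zeta>. \<psi> \<zeta> * quad_den \<zeta>)" by (intro poly.mult_mem \<psi>(1) poly_quad_den)
  have dense: "\<exists>z. dist z z0 < \<delta> \<and> \<psi> z * quad_den z \<noteq> 0" if "\<delta> > 0" for z0 \<delta>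
    by (rule poly_over_reals_nonzero_near[OF pd nz0 that])
  obtain n where n: "quad_g a (quad_rot \<zeta>) n \<noteq> 0"
    using quad_g_nonzero[OF quad_rot_rotation[OF den] a] by blast
  have c0: "quad_c a (quad_rot \<zeta>) (w_part \<zeta>) = 0" using q g0 by (simp add: quad_def)
  \<comment> \<open>The return direction \<open>n - w\<close> must not lie in the hypersurface. As
    \<open>quad_c\<close> and \<open>quad_g\<close> both vanish at \<open>w\<close>, changing t
    stays on the hypersurface, and a shift by \<epsilon>/4 makes the value at \<open>n\<close>
    nonzero if it was zero.\<close>
  define s where "s = (if quad_c a (quad_rot \<zeta>) n + t_part \<zeta> * quad_g a (quad_rot \<zeta>) n = 0 then complex_of_real (\<epsilon> / 4) else 0)"
  have sn: "quad_c a (quad_rot \<zeta>) n + (t_part \<zeta> + s) * quad_g a (quad_rot \<zeta>) n \<noteq> 0"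
  proof -
    have eq: "quad_c a (quad_rot \<zeta>) n + (t_part \<zeta> + s) * quad_g a (quad_rot \<zeta>) n
        = (quad_c a (quad_rot \<zeta>) n + t_part \<zeta> * quad_g a (quad_rot \<zeta>) n) + s * quad_g a (quad_rot \<zeta>) n"
      by (simp add: algebra_simps)
    show ?thesis
    proof (cases "quad_c a (quad_rot \<zeta>) n + t_part \<zeta> * quad_g a (quad_rot \<zeta>) n = 0")
      case True
      then have "s = complex_of_real (\<epsilon> / 4)" by (simp add: s_def)
      then have "s * quad_g a (quad_rot \<zeta>) n \<noteq> 0" using n \<epsilon> by (metis divide_eq_0_iff mult_eq_0_iff of_real_eq_0_iff order_less_irrefl zero_neq_numeral)
      then show ?thesis unfolding eq True by simp
    next
      case False
      then have "s = 0" by (simp add: s_def)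
      then show ?thesis using False by simp
    qed
  qed
  define \<zeta>' where "\<zeta>' = \<zeta> + s *s axis (Inr (Inr 1)) 1"
  have parts: "q_part \<zeta>' = q_part \<zeta>" "w_part \<zeta>' = w_part \<zeta>" "t_part \<zeta>' = t_part \<zeta> + s"
    by (simp_all add: \<zeta>'_def q_part_def w_part_def t_part_def axis_def vec_eq_iff)
  have d1: "dist \<zeta>' \<zeta> < \<epsilon>" using \<epsilon> unfolding \<zeta>'_def dist_add_smult by (simp add: norm_axis_complex s_def)
  have rot': "quad_rot \<zeta>' = quad_rot \<zeta>" and den': "quad_den \<zeta>' \<noteq> 0"
    using den by (simp_all add: quad_rot_def quad_den_def parts)
  have q': "quad a \<zeta>' = 0" by (simp add: quad_def rot' parts c0 g0)
  define d where "d = quad_pt 0 (n - w_part \<zeta>) 0"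
  have same: "quad_rot (\<zeta> + s *s d) = quad_rot \<zeta>" "quad_den (\<zeta> + s *s d) = quad_den \<zeta>" for \<zeta> s
    by (simp_all add: quad_rot_def quad_den_def d_def)
  have "quad a (\<zeta>' + 1 *s d) = quad_c a (quad_rot \<zeta>) n + (t_part \<zeta> + s) * quad_g a (quad_rot \<zeta>) n"
    unfolding quad_def same rot' by (simp only: quad_pt_line) (simp add: d_def parts)
  then have "quad a (\<zeta>' + d) \<noteq> 0" using sn by simp
  then obtain \<eta> where \<eta>: "\<eta> > 0" "\<And>z. dist z \<zeta>' < \<eta> \<Longrightarrow> quad_den z \<noteq> 0 \<Longrightarrow>
      \<exists>s. quad a (z + s *s d) = 0 \<and> dist (z + s *s d) \<zeta> < \<epsilon>"
    using quad_root_near[OF den' q' d1] unfolding d_def by blast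
  obtain z where z: "dist z \<zeta>' < \<eta>" "\<psi> z * quad_den z \<noteq> 0" using dense[OF \<eta>(1)] by blast
  then obtain t where t: "quad a (z + t *s d) = 0" "dist (z + t *s d) \<zeta> < \<epsilon>" using \<eta>(2)[of z] by auto
  define \<xi> where "\<xi> = z + t *s d"
  have same': "quad_rot \<xi> = quad_rot z" "quad_den \<xi> = quad_den z" unfolding \<xi>_def same by simp_all
  have 1: "dist \<xi> \<zeta> < \<epsilon>" using t(2) by (simp add: \<xi>_def)
  have 2: "quad_den \<xi> \<noteq> 0" using z(2) unfolding same' by auto
  have 3: "quad a \<xi> = 0" using t(1) unfolding \<xi>_def by blast
  have 4: "quad_g a (quad_rot \<xi>) (?v z) = 0" unfolding same' quad_g_def by simp
  have "quad_den z \<noteq> 0" "\<psi> z \<noteq> 0" using z(2) by auto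
  then have 5: "quad_c a (quad_rot \<xi>) (?v z) \<noteq> 0" using \<psi>(2) unfolding same' by blast
  show ?thesis using 1 2 3 4 5 by blast
qed

lemma quad_near_good:
  assumes a: "nondegenerate a" and ob: "obstruction a y \<noteq> 0"
    and den: "quad_den \<zeta> \<noteq> 0" and q: "quad a \<zeta> = 0" and \<epsilon>: "\<epsilon> > 0"
  shows "\<exists>\<xi>. dist \<xi> \<zeta> < \<epsilon> \<and> quad_den \<xi> \<noteq> 0 \<and> quad a \<xi> = 0
    \<and> quad_g a (quad_rot \<xi>) (w_part \<xi>) \<noteq> 0 \<and> w_part \<xi> $ 3 \<noteq> 0"
proof -
  have e3: "\<epsilon> / 3 > 0" using \<epsilon> by simp
  obtain \<xi>1 where 1: "dist \<xi>1 \<zeta> < \<epsilon> / 3 + \<epsilon> / 3" "quad_den \<xi>1 \<noteq> 0" "quad a \<xi>1 = 0"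
    "quad_g a (quad_rot \<xi>1) (w_part \<xi>1) \<noteq> 0"
  proof (cases "quad_g a (quad_rot \<zeta>) (w_part \<zeta>) = 0")
    case False
    then show ?thesis using that[of \<zeta>] den q \<epsilon> by simp
  next
    case True
    obtain e k where "y = (e, k)" by force
    then obtain \<xi>0 v where 0: "dist \<xi>0 \<zeta> < \<epsilon> / 3" "quad_den \<xi>0 \<noteq> 0" "quad a \<xi>0 = 0"
      "quad_g a (quad_rot \<xi>0) v = 0" "quad_c a (quad_rot \<xi>0) v \<noteq> 0"
      using quad_near_transversal[OF a _ den q True e3] ob by blast
    then obtain \<xi>1 where "dist \<xi>1 \<xi>0 < \<epsilon> / 3" "quad_den \<xi>1 \<noteq> 0" "quad a \<xi>1 = 0"
      "quad_g a (quad_rot \<xi>1) (w_part \<xi>1) \<noteq> 0"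
      using quad_near_nonzero_g[OF a 0(2,3,4,5) e3] by blast
    then show ?thesis using that[of \<xi>1] 0(1) dist_triangle[of \<xi>1 \<zeta> \<xi>0] by linarith
  qed
  then obtain \<xi> where "dist \<xi> \<xi>1 < \<epsilon> / 3" "quad_den \<xi> \<noteq> 0" "quad a \<xi> = 0"
    "quad_g a (quad_rot \<xi>) (w_part \<xi>) \<noteq> 0" "w_part \<xi> $ 3 \<noteq> 0"
    using quad_near_third_coordinate[OF 1(2,3,4) e3] by blast
  moreover have "dist \<xi> \<zeta> < \<epsilon>" using calculation(1) 1(1) dist_triangle[of \<xi> \<zeta> \<xi>1] by linarith
  ultimately show ?thesis by blast
qed

section \<open>The good configurations\<close>

definition kernel_vec :: "architecture \<Rightarrow> config \<Rightarrow> 6 \<Rightarrow> complex^6" where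
  "kernel_vec a X i = row_cofactors (Jac a (rot X) (transl X)) i"

text \<open>The four factors permit, in this order, normalising \<open>w $ 3\<close> to 1, solving
  for t, recovering the position, and taking Cayley coordinates. A nonzero first factor also makes
  the kernel on \<open>Sing a\<close> one-dimensional.\<close>

definition good :: "architecture \<Rightarrow> 6 \<Rightarrow> config \<Rightarrow> complex" where
  "good a i X = kernel_vec a X i $ 6 * quad_g a (rot X) (snd6 (kernel_vec a X i))
     * (fst6 (kernel_vec a X i) \<odot> snd6 (kernel_vec a X i)) * (1 + trace (rot X))"

definition good_configs :: "architecture \<Rightarrow> config set" where
  "good_configs a = {X \<in> Sing a. \<exists>i. good a i X \<noteq> 0}"

lemma Jac_kernel_vec: "X \<in> Sing a \<Longrightarrow> Jac a (rot X) (transl X) *v kernel_vec a X i = 0"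
  by (simp add: kernel_vec_def mult_row_cofactors Sing_iff)

text \<open>A nonzero cofactor makes the kernel a line, so the cofactor vector is a nonzero multiple
  of (u, w), and the first three factors of \<open>good\<close> are homogeneous in it.\<close>

lemma good_configsI:
  assumes X: "X \<in> Sing a" "1 + trace (rot X) \<noteq> 0" and rec: "reciprocal a (rot X) (transl X) u w"
    and w: "w $ 3 \<noteq> 0" "quad_g a (rot X) w \<noteq> 0" "u \<odot> w \<noteq> 0" and c: "kernel_vec a X i $ c \<noteq> 0"
  shows "X \<in> good_configs a"
proof -
  define k where "k = join6 u w"
  define l where "l = kernel_vec a X i"
  have "Jac a (rot X) (transl X) *v k = 0" using rec by (simp add: Jac_kernel k_def)
  then have "k $ c *s l = l $ c *s k"
    unfolding l_def
    by (intro kernel_proportional[of _ i c]) (use c Jac_kernel_vec[OF X(1)] in \<open>auto simp: kernel_vec_def\<close>)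
  moreover have kc: "k $ c \<noteq> 0"
  proof
    assume "k $ c = 0"
    then have "k = 0" using calculation c by (simp add: l_def)
    then show False using w(1) by (auto simp: k_def join6_eq_0_iff)
  qed
  ultimately have "l = (l $ c / k $ c) *s k"
    by (metis (no_types, lifting) divide_inverse left_inverse mult.commute vector_smult_assoc vector_smult_lid)
  then obtain \<nu> where l: "l = \<nu> *s k" by blast
  then have "\<nu> \<noteq> 0" using c l_def by auto
  then have "good a i X \<noteq> 0"
    unfolding good_def l_def[symmetric] l using w X(2)
    by (simp add: k_def fst6_linear snd6_linear quad_g_linear cdot_smult)
  then show ?thesis using X(1) by (auto simp: good_configs_def)
qed

context generic_architecture
begin

text \<open>A tame configuration comes from a point \<open>\<zeta>\<close> of the hypersurface. Its
  pitch form is nonzero there, so the map \<open>\<Xi>\<close> back to configurations is continuous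
  near \<open>\<zeta>\<close>. Since the kernel of the Jacobian is a line, some cofactor is nonzero
  and remains so nearby. A good point of the hypersurface close to \<open>\<zeta>\<close> is then
  carried to a good configuration.\<close>

lemma near_good:
  assumes "tame Y" and \<epsilon>: "\<epsilon> > 0"
  shows "\<exists>Z. dist Z Y < \<epsilon> \<and> Z \<in> good_configs a"
proof -
  have Y: "Y \<in> Sing a" "1 + trace (rot Y) \<noteq> 0"
    and pitch: "\<And>u w. u \<noteq> 0 \<or> w \<noteq> 0 \<Longrightarrow> reciprocal a (rot Y) (transl Y) u w \<Longrightarrow> u \<odot> w \<noteq> 0"
    using assms(1) by (auto simp: tame_def)
  have r: "rotation (rot Y)" and dY: "det (Jac a (rot Y) (transl Y)) = 0" using Y by (auto simp: Sing_iff)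
  note G = nondegenerate_det_frame[OF nondeg]
  obtain i where "kernel_vec a Y i \<noteq> 0"
    using row_cofactors_Jac_nonzero[OF dY pitch] by (auto simp: kernel_vec_def)
  then obtain c where c: "kernel_vec a Y i $ c \<noteq> 0" by (auto simp: vec_eq_iff)
  obtain u w where uw: "u \<noteq> 0 \<or> w \<noteq> 0" "reciprocal a (rot Y) (transl Y) u w"
    using dY unfolding singular_iff by blast
  obtain t where t: "quad_c a (rot Y) w + t * quad_g a (rot Y) w = 0"
    "screw_u a (rot Y) w t = u + complex_cross3 w (base_pt a 1)" "position a (rot Y) w t = transl Y"
    using position_of_reciprocal[OF rotation_orthogonal[OF r] G uw(2)] pitch[OF uw] by blast
  define \<zeta> where "\<zeta> = quad_pt (cayley_coords (rot Y)) w t"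
  have rot: "quad_rot \<zeta> = rot Y" and den: "quad_den \<zeta> \<noteq> 0"
    using cayley_cayley_coords[OF r Y(2)] Y(2) by (simp_all add: \<zeta>_def quad_rot_def quad_den_def)
  have q: "quad a \<zeta> = 0" using t(1) by (simp add: quad_def rot) (simp add: \<zeta>_def)
  define \<pi> where "\<pi> = (\<lambda>\<zeta>. screw_u a (quad_rot \<zeta>) (w_part \<zeta>) (t_part \<zeta>) \<odot> w_part \<zeta>)"
  define pos where "pos = (\<lambda>\<zeta>. position a (quad_rot \<zeta>) (w_part \<zeta>) (t_part \<zeta>))"
  have pi1: "\<pi> \<zeta> \<noteq> 0"
    using pitch[OF uw] by (simp add: \<pi>_def rot) (simp add: \<zeta>_def t(2) cdot_add)
  interpret A0: real_function_algebra "{f. frac_poly quad_den f}"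
    by (rule real_function_algebra_frac_poly[OF poly_quad_den])
  have "\<pi> \<in> {f. frac_poly quad_den f}"
    unfolding \<pi>_def by (intro A0.cdot_mem A0.screw_mem) (simp_all add: frac_quad_rot frac_poly_of_poly poly_quad_parts)
  then obtain e where e: "poly_over_reals e" "frac_poly (\<lambda>\<zeta>. quad_den \<zeta> * e \<zeta>) (\<lambda>\<zeta>. 1 / \<pi> \<zeta>)"
    "\<And>\<zeta>. quad_den \<zeta> \<noteq> 0 \<Longrightarrow> e \<zeta> = 0 \<longleftrightarrow> \<pi> \<zeta> = 0"
    using frac_poly_inverse[OF _ poly_quad_den] by blast
  define s where "s = (\<lambda>\<zeta>. quad_den \<zeta> * e \<zeta>)"
  have s: "poly_over_reals s" unfolding s_def by (intro poly.mult_mem poly_quad_den e(1))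
  interpret A: real_function_algebra "{f. frac_poly s f}"
    by (rule real_function_algebra_frac_poly[OF s])
  have R: "(\<lambda>\<zeta>. quad_rot \<zeta> $ i $ j) \<in> {f. frac_poly s f}" for i j
    unfolding s_def using frac_poly_extend[OF frac_quad_rot e(1)] by simp
  have pos: "(\<lambda>\<zeta>. pos \<zeta> $ i) \<in> {f. frac_poly s f}" for i
    unfolding pos_def
    by (rule A.position_mem[OF R])
       (use e(2) in \<open>simp_all add: frac_poly_of_poly poly_quad_parts \<pi>_def s_def\<close>)
  define \<Xi> where "\<Xi> = (\<lambda>\<zeta>. config_of (quad_rot \<zeta>) (pos \<zeta>))"
  have "frac_poly s (\<lambda>\<zeta>. \<Xi> \<zeta> $ n)" for n
    using A.config_of_mem[OF R pos] by (simp add: \<Xi>_def)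
  then have "continuous_on {\<zeta>. s \<zeta> \<noteq> 0} (\<lambda>\<zeta>. \<chi> n. \<Xi> \<zeta> $ n)"
    by (intro continuous_on_vec_lambda frac_poly_continuous s)
  then have cont1: "continuous_on {\<zeta>. s \<zeta> \<noteq> 0} \<Xi>" by simp
  have "(\<lambda>\<zeta>. kernel_vec a (\<Xi> \<zeta>) i $ c) \<in> {f. frac_poly s f}"
    unfolding kernel_vec_def \<Xi>_def rot_config_of transl_config_of
    by (intro A.row_cofactors_mem A.Jac_mem R pos)
  then have cont2: "continuous_on {\<zeta>. s \<zeta> \<noteq> 0} (\<lambda>\<zeta>. kernel_vec a (\<Xi> \<zeta>) i $ c)"
    using frac_poly_continuous s by blast
  have o: "open {\<zeta>. s \<zeta> \<noteq> 0}" by (rule open_nonzero_poly[OF s])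
  have s1: "s \<zeta> \<noteq> 0" using den e(3)[OF den] pi1 by (simp add: s_def)
  have Xi1: "\<Xi> \<zeta> = Y" by (simp add: \<Xi>_def pos_def rot) (simp add: \<zeta>_def t(3))
  have "\<forall>\<^sub>F \<xi> in nhds \<zeta>. s \<xi> \<noteq> 0" using o s1 eventually_nhds by blast
  moreover have "isCont \<Xi> \<zeta>" using cont1 o s1 by (simp add: continuous_on_eq_continuous_at)
  then have "\<forall>\<^sub>F \<xi> in nhds \<zeta>. dist (\<Xi> \<xi>) Y < \<epsilon>"
    using \<epsilon> Xi1 tendstoD[of \<Xi> Y "nhds \<zeta>" \<epsilon>] by (simp add: isCont_def tendsto_nhds_iff)
  moreover have "isCont (\<lambda>\<zeta>. kernel_vec a (\<Xi> \<zeta>) i $ c) \<zeta>" using cont2 o s1 by (simp add: continuous_on_eq_continuous_at)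
  then have "((\<lambda>\<zeta>. kernel_vec a (\<Xi> \<zeta>) i $ c) \<longlongrightarrow> kernel_vec a Y i $ c) (nhds \<zeta>)"
    using Xi1 by (simp add: isCont_def tendsto_nhds_iff)
  then have "\<forall>\<^sub>F \<xi> in nhds \<zeta>. kernel_vec a (\<Xi> \<xi>) i $ c \<noteq> 0"
    using c by (rule tendsto_imp_eventually_ne)
  ultimately have "\<forall>\<^sub>F \<xi> in nhds \<zeta>. s \<xi> \<noteq> 0 \<and> dist (\<Xi> \<xi>) Y < \<epsilon> \<and> kernel_vec a (\<Xi> \<xi>) i $ c \<noteq> 0"
    by (simp add: eventually_conj)
  then obtain \<delta> where \<delta>: "\<delta> > 0" "\<And>\<xi>. dist \<xi> \<zeta> < \<delta> \<Longrightarrow>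
      s \<xi> \<noteq> 0 \<and> dist (\<Xi> \<xi>) Y < \<epsilon> \<and> kernel_vec a (\<Xi> \<xi>) i $ c \<noteq> 0"
    unfolding eventually_nhds_metric by blast
  obtain y where "obstruction a y \<noteq> 0" using obstructed by blast
  then obtain \<xi> where \<xi>: "dist \<xi> \<zeta> < \<delta>" "quad_den \<xi> \<noteq> 0" "quad a \<xi> = 0"
    "quad_g a (quad_rot \<xi>) (w_part \<xi>) \<noteq> 0" "w_part \<xi> $ 3 \<noteq> 0"
    using quad_near_good[OF nondeg _ den q \<delta>(1)] by blast
  have rot\<xi>: "rotation (quad_rot \<xi>)" by (rule quad_rot_rotation[OF \<xi>(2)])
  have pi: "\<pi> \<xi> \<noteq> 0" using \<delta>(2)[OF \<xi>(1)] e(3)[OF \<xi>(2)] by (auto simp: s_def)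
  define u' where "u' = screw_u a (quad_rot \<xi>) (w_part \<xi>) (t_part \<xi>) - complex_cross3 (w_part \<xi>) (base_pt a 1)"
  have rec: "reciprocal a (rot (\<Xi> \<xi>)) (transl (\<Xi> \<xi>)) u' (w_part \<xi>)"
    using reciprocal_position[OF rotation_orthogonal[OF rot\<xi>] G, of "w_part \<xi>" "t_part \<xi>"] \<xi>(3) pi
    by (simp add: \<Xi>_def pos_def u'_def quad_def \<pi>_def)
  have "w_part \<xi> \<noteq> 0" using \<xi>(5) by auto
  then have "det (Jac a (rot (\<Xi> \<xi>)) (transl (\<Xi> \<xi>))) = 0" using rec unfolding singular_iff by blast
  moreover have "rotation (rot (\<Xi> \<xi>))" using rot\<xi> by (simp add: \<Xi>_def)
  ultimately have S: "\<Xi> \<xi> \<in> Sing a" by (simp add: Sing_iff)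
  have "\<Xi> \<xi> \<in> good_configs a"
  proof (rule good_configsI[OF S _ rec \<xi>(5)])
    show "1 + trace (rot (\<Xi> \<xi>)) \<noteq> 0" using \<xi>(2) by (simp add: \<Xi>_def quad_rot_def quad_den_def trace_cayley)
    show "quad_g a (rot (\<Xi> \<xi>)) (w_part \<xi>) \<noteq> 0" using \<xi>(4) by (simp add: \<Xi>_def)
    show "u' \<odot> w_part \<xi> \<noteq> 0" using pi by (simp add: u'_def \<pi>_def cdot_diff)
    show "kernel_vec a (\<Xi> \<xi>) i $ c \<noteq> 0" using \<delta>(2)[OF \<xi>(1)] by blast
  qed
  then show ?thesis using \<delta>(2)[OF \<xi>(1)] by blast
qed

lemma good_configs_dense: "zariski_dense_in (Sing a) (good_configs a)"
proof -
  have "X \<in> closure (good_configs a)" if X: "X \<in> Sing a" for X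
    unfolding closure_approachable
  proof (intro allI impI)
    fix \<epsilon> :: real assume "\<epsilon> > 0"
    then have e: "\<epsilon> / 3 > 0" by simp
    obtain Y where Y: "dist Y X < \<epsilon> / 3" "Y \<in> Sing a" "1 + trace (rot Y) \<noteq> 0"
      using near_cayley_chart[OF X e] by blast
    obtain Y' where Y': "dist Y' Y < \<epsilon> / 3" "tame Y'" using near_tame[OF Y(2,3) e] by blast
    obtain Z where Z: "dist Z Y' < \<epsilon> / 3" "Z \<in> good_configs a" using near_good[OF Y'(2) e] by blast
    have "dist Z X < \<epsilon>"
      using Y(1) Y'(1) Z(1) dist_triangle[of Z X Y'] dist_triangle[of Y' X Y] by linarith
    then show "\<exists>Z\<in>good_configs a. dist Z X < \<epsilon>" using Z(2) by blast
  qed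
  then have "Sing a \<subseteq> closure (good_configs a)" by blast
  moreover have "closure (good_configs a) \<subseteq> Z" if "zariski_closed Z" "good_configs a \<subseteq> Z" for Z
    using that by (intro closure_minimal zariski_closed_imp_closed)
  moreover have "good_configs a \<subseteq> Sing a" by (auto simp: good_configs_def)
  ultimately show ?thesis unfolding zariski_dense_in_def by (meson order_trans)
qed

end

section \<open>The birational map\<close>

lemma exhaust_5: "x = 1 \<or> x = 2 \<or> x = 3 \<or> x = 4 \<or> x = (5 :: 5)"
proof (induct x)
  case (of_int z)
  then have "0 \<le> z" "z < 5" by simp_all
  then have "z = 0 \<or> z = 1 \<or> z = 2 \<or> z = 3 \<or> z = 4" by arith
  then show ?case by auto
qed

lemma forall_5: "(\<forall>i::5. P i) \<longleftrightarrow> P 1 \<and> P 2 \<and> P 3 \<and> P 4 \<and> P 5"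
  by (metis exhaust_5)

lemma vector_5 [simp]:
  "(vector [a,b,c,d,e] :: 'a::zero^5) $ 1 = a"
  "(vector [a,b,c,d,e] :: 'a::zero^5) $ 2 = b"
  "(vector [a,b,c,d,e] :: 'a::zero^5) $ 3 = c"
  "(vector [a,b,c,d,e] :: 'a::zero^5) $ 4 = d"
  "(vector [a,b,c,d,e] :: 'a::zero^5) $ 5 = e"
  unfolding vector_def by simp_all

section \<open>The parametrization by affine 5-space\<close>

definition param_q :: "complex^5 \<Rightarrow> complex^3" where "param_q v = vector [v$1, v$2, v$3]"
definition param_w :: "complex^5 \<Rightarrow> complex^3" where "param_w v = vector [v$4, v$5, 1]"
definition param_rot :: "complex^5 \<Rightarrow> complex^3^3" where "param_rot v = cayley (param_q v)"
text \<open>The root of \<open>quad_c + t * quad_g = 0\<close>, written with the reciprocal of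
  \<open>quad_g\<close> as a factor so that the closure lemmas for fractions apply.\<close>

definition param_t :: "architecture \<Rightarrow> complex^5 \<Rightarrow> complex" where
  "param_t a v = - quad_c a (param_rot v) (param_w v) * (1 / quad_g a (param_rot v) (param_w v))"
definition param_pitch :: "architecture \<Rightarrow> complex^5 \<Rightarrow> complex" where
  "param_pitch a v = screw_u a (param_rot v) (param_w v) (param_t a v) \<odot> param_w v"
definition param :: "architecture \<Rightarrow> complex^5 \<Rightarrow> config" where
  "param a v = config_of (param_rot v) (position a (param_rot v) (param_w v) (param_t a v))"

lemma poly_param: "poly_over_reals (\<lambda>v. param_q v $ i)" "poly_over_reals (\<lambda>v. param_w v $ i)"
  using exhaust_3[of i] by (auto simp: param_q_def param_w_def intro: poly_over_reals.coord poly.one_mem)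

text \<open>Three nested divisions: by \<open>cayley_den\<close> for the rotation, then by
  \<open>quad_g\<close> for t, then by the pitch, which is itself a fraction involving t. Each
  enlarges the denominator by one factor, and the final nonvanishing locus is exactly the set where
  all three divisions are legitimate.\<close>

lemma param_denominator:
  "\<exists>s. poly_over_reals s \<and> (\<forall>n. frac_poly s (\<lambda>v. param a v $ n)) \<and>
    (\<forall>v. s v \<noteq> 0 \<longleftrightarrow> cayley_den (param_q v) \<noteq> 0 \<and> quad_g a (param_rot v) (param_w v) \<noteq> 0 \<and> param_pitch a v \<noteq> 0)"
proof -
  define d where "d = (\<lambda>v. cayley_den (param_q v))"
  have d: "poly_over_reals d" unfolding d_def by (intro poly.cayley_den_mem poly_param)
  interpret A0: real_function_algebra "{f. frac_poly d f}"
    by (rule real_function_algebra_frac_poly[OF d])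
  have R0: "frac_poly d (\<lambda>v. param_rot v $ i $ j)" for i j
    using A0.cayley_mem[of param_q i j] frac_poly_of_poly[OF poly_param(1)] frac_poly_inverse_self[of d]
    by (simp add: param_rot_def d_def)
  have w0: "frac_poly d (\<lambda>v. param_w v $ i)" for i by (rule frac_poly_of_poly[OF poly_param(2)])
  have g0: "frac_poly d (\<lambda>v. quad_g a (param_rot v) (param_w v))"
    and c0: "frac_poly d (\<lambda>v. quad_c a (param_rot v) (param_w v))"
    using A0.quad_g_mem[of param_rot param_w a] A0.quad_c_mem[of param_rot param_w a] R0 w0 by simp_all
  obtain e where e: "poly_over_reals e" "frac_poly (\<lambda>v. d v * e v) (\<lambda>v. 1 / quad_g a (param_rot v) (param_w v))"
    "\<And>v. d v \<noteq> 0 \<Longrightarrow> e v = 0 \<longleftrightarrow> quad_g a (param_rot v) (param_w v) = 0"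
    using frac_poly_inverse[OF g0 d] by blast
  define s1 where "s1 = (\<lambda>v. d v * e v)"
  have s1: "poly_over_reals s1" unfolding s1_def by (intro poly.mult_mem d e(1))
  interpret A1: real_function_algebra "{f. frac_poly s1 f}"
    by (rule real_function_algebra_frac_poly[OF s1])
  have R1: "(\<lambda>v. param_rot v $ i $ j) \<in> {f. frac_poly s1 f}" for i j
    unfolding s1_def using frac_poly_extend[OF R0 e(1)] by simp
  have w1: "(\<lambda>v. param_w v $ i) \<in> {f. frac_poly s1 f}" for i
    unfolding s1_def using frac_poly_extend[OF w0 e(1)] by simp
  have t1: "param_t a \<in> {f. frac_poly s1 f}"
    unfolding param_t_def[abs_def]
    by (intro A1.mult_mem A1.uminus_mem) (use frac_poly_extend[OF c0 e(1)] e(2) in \<open>simp_all add: s1_def\<close>)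
  have pi1: "frac_poly s1 (param_pitch a)"
    unfolding param_pitch_def[abs_def]
    using A1.cdot_mem[OF A1.screw_mem(1)[OF R1 w1 t1] w1] by simp
  obtain f where f: "poly_over_reals f" "frac_poly (\<lambda>v. s1 v * f v) (\<lambda>v. 1 / param_pitch a v)"
    "\<And>v. s1 v \<noteq> 0 \<Longrightarrow> f v = 0 \<longleftrightarrow> param_pitch a v = 0"
    using frac_poly_inverse[OF pi1 s1] by blast
  define s where "s = (\<lambda>v. s1 v * f v)"
  have s: "poly_over_reals s" unfolding s_def by (intro poly.mult_mem s1 f(1))
  interpret A: real_function_algebra "{f. frac_poly s f}"
    by (rule real_function_algebra_frac_poly[OF s])
  have R: "(\<lambda>v. param_rot v $ i $ j) \<in> {f. frac_poly s f}" for i j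
    unfolding s_def using frac_poly_extend[OF _ f(1)] R1 by simp
  have w: "(\<lambda>v. param_w v $ i) \<in> {f. frac_poly s f}" for i
    unfolding s_def using frac_poly_extend[OF _ f(1)] w1 by simp
  have t: "param_t a \<in> {f. frac_poly s f}"
    unfolding s_def using frac_poly_extend[OF _ f(1)] t1 by simp
  have pos: "(\<lambda>v. position a (param_rot v) (param_w v) (param_t a v) $ i) \<in> {f. frac_poly s f}" for i
    by (rule A.position_mem[OF R w t]) (use f(2) in \<open>simp add: s_def param_pitch_def\<close>)
  have "frac_poly s (\<lambda>v. param a v $ n)" for n
    unfolding param_def using A.config_of_mem[OF R pos] by simp
  moreover have "s v \<noteq> 0 \<longleftrightarrow> cayley_den (param_q v) \<noteq> 0 \<and> quad_g a (param_rot v) (param_w v) \<noteq> 0 \<and> param_pitch a v \<noteq> 0" for v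
    using e(3)[of v] f(3)[of v] by (auto simp: s_def s1_def d_def)
  ultimately show ?thesis using s by blast
qed

section \<open>The inverse map and its regularity\<close>

lemma poly_config: "poly_over_reals (\<lambda>X. rot X $ i $ j)" "poly_over_reals (\<lambda>X. transl X $ i)"
  by (simp_all add: rot_def transl_def poly_over_reals.coord)

lemma poly_kernel_vec: "poly_over_reals (\<lambda>X. kernel_vec a X i $ j)"
  unfolding kernel_vec_def by (intro poly.row_cofactors_mem poly.Jac_mem poly_config)

lemma poly_trace: "poly_over_reals (\<lambda>X. 1 + trace (rot X))"
  unfolding trace_def by (intro poly.mem_intros poly_config)

lemma poly_good: "poly_over_reals (good a i)"
  unfolding good_def[abs_def]
  by (intro poly.mult_mem poly_kernel_vec poly.quad_g_mem poly.cdot_mem poly.fst6_mem poly.snd6_mem poly_config poly_trace)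

text \<open>The arbitrary choice of the row does not matter: good rows give proportional kernel
  vectors, and only ratios of components are used.\<close>

definition coords :: "architecture \<Rightarrow> config \<Rightarrow> complex^5" where
  "coords a X = (let q = cayley_coords (rot X); k = kernel_vec a X (SOME i. good a i X \<noteq> 0)
     in vector [q$1, q$2, q$3, k$4 / k$6, k$5 / k$6])"

lemma good_configsD:
  assumes "X \<in> good_configs a"
  shows "X \<in> Sing a" "rotation (rot X)" "1 + trace (rot X) \<noteq> 0" "good a (SOME i. good a i X \<noteq> 0) X \<noteq> 0"
proof -
  have ex: "\<exists>i. good a i X \<noteq> 0" using assms by (auto simp: good_configs_def)
  then show "good a (SOME i. good a i X \<noteq> 0) X \<noteq> 0" by (rule someI_ex)
  then show "1 + trace (rot X) \<noteq> 0" by (auto simp: good_def)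
  show "X \<in> Sing a" using assms by (simp add: good_configs_def)
  then show "rotation (rot X)" by (simp add: Sing_iff)
qed

text \<open>Independence of the chosen row: any kernel vector with nonzero last component gives the
  same ratios. Both regularity of \<open>coords\<close> and the inverse property rest on
  this.\<close>

lemma coords_direction:
  assumes X: "X \<in> good_configs a" and k: "Jac a (rot X) (transl X) *v k = 0" and k6: "k $ 6 \<noteq> 0"
  shows "coords a X $ 4 = k $ 4 / k $ 6" "coords a X $ 5 = k $ 5 / k $ 6"
proof -
  define l where "l = kernel_vec a X (SOME i. good a i X \<noteq> 0)"
  have l6: "l $ 6 \<noteq> 0" using good_configsD(4)[OF X] by (auto simp: good_def l_def)
  have "k $ 6 *s l = l $ 6 *s k"
    using kernel_proportional[of "Jac a (rot X) (transl X)" _ 6 k l] l6 k Jac_kernel_vec[OF good_configsD(1)[OF X]]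
    by (simp add: l_def kernel_vec_def)
  then have "k $ 6 * l $ i = l $ 6 * k $ i" for i by (metis vector_smult_component)
  then have "l $ i / l $ 6 = k $ i / k $ 6" for i using l6 k6 by (simp add: frac_eq_eq mult.commute)
  then show "coords a X $ 4 = k $ 4 / k $ 6" "coords a X $ 5 = k $ 5 / k $ 6"
    by (simp_all add: coords_def Let_def l_def)
qed

lemma param_q_coords: "param_q (coords a X) = cayley_coords (rot X)"
  by (simp add: param_q_def coords_def Let_def vec_eq_iff forall_3)

lemma param_coords:
  assumes G: "det (frame a) \<noteq> 0" and X: "X \<in> good_configs a"
  shows "param a (coords a X) = X" "cayley_den (param_q (coords a X)) \<noteq> 0"
    "quad_g a (param_rot (coords a X)) (param_w (coords a X)) \<noteq> 0" "param_pitch a (coords a X) \<noteq> 0"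
proof -
  note D = good_configsD[OF X]
  define v where "v = coords a X"
  have den: "cayley_den (param_q v) \<noteq> 0"
    using cayley_cayley_coords(1)[OF D(2,3)] D(3) by (simp add: v_def param_q_coords)
  have R: "param_rot v = rot X"
    using cayley_cayley_coords(2)[OF D(2,3)] by (simp add: v_def param_rot_def param_q_coords)
  define l where "l = kernel_vec a X (SOME i. good a i X \<noteq> 0)"
  have l: "l $ 6 \<noteq> 0" "quad_g a (rot X) (snd6 l) \<noteq> 0" "fst6 l \<odot> snd6 l \<noteq> 0"
    using D(4) by (auto simp: good_def l_def)
  define k where "k = inverse (l $ 6) *s l"
  have "reciprocal a (rot X) (transl X) (fst6 l) (snd6 l)"
    using Jac_kernel_vec[OF D(1)] by (simp add: Jac_kernel l_def)
  then have rec: "reciprocal a (rot X) (transl X) (fst6 k) (snd6 k)"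
    unfolding k_def fst6_linear snd6_linear by (rule reciprocal_scale)
  have w: "snd6 k = param_w v"
    using l(1) by (simp add: k_def param_w_def v_def coords_def Let_def vec_eq_iff forall_3 divide_inverse mult.commute flip: l_def)
  have g: "quad_g a (rot X) (param_w v) \<noteq> 0"
    using l(1,2) unfolding w[symmetric] k_def by (simp add: snd6_linear quad_g_linear)
  have pitch: "fst6 k \<odot> param_w v \<noteq> 0"
    using l unfolding w[symmetric] k_def by (simp add: fst6_linear snd6_linear cdot_smult)
  obtain t where t: "quad_c a (rot X) (param_w v) + t * quad_g a (rot X) (param_w v) = 0"
    "screw_u a (rot X) (param_w v) t = fst6 k + complex_cross3 (param_w v) (base_pt a 1)"
    "position a (rot X) (param_w v) t = transl X"
    using position_of_reciprocal[OF rotation_orthogonal[OF D(2)] G rec] pitch unfolding w by blast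
  have "t = param_t a v"
    using t(1) g by (simp add: param_t_def R field_simps add_eq_0_iff)
  then show "param a (coords a X) = X" "param_pitch a (coords a X) \<noteq> 0"
    using t(2,3) pitch unfolding v_def[symmetric]
    by (simp_all add: param_def param_pitch_def R cdot_add)
  show "cayley_den (param_q (coords a X)) \<noteq> 0"
    "quad_g a (param_rot (coords a X)) (param_w (coords a X)) \<noteq> 0"
    using den g unfolding v_def[symmetric] R by simp_all
qed

lemma reciprocal_param:
  assumes G: "det (frame a) \<noteq> 0" and "cayley_den (param_q v) \<noteq> 0"
    "quad_g a (param_rot v) (param_w v) \<noteq> 0" "param_pitch a v \<noteq> 0"
  shows "\<exists>u. reciprocal a (rot (param a v)) (transl (param a v)) u (param_w v)" "param a v \<in> Sing a"
proof -
  have R: "rotation (param_rot v)" using assms(2) by (simp add: param_rot_def rotation_cayley)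
  have "quad_c a (param_rot v) (param_w v) + param_t a v * quad_g a (param_rot v) (param_w v) = 0"
    using assms(3) by (simp add: param_t_def)
  then show ex: "\<exists>u. reciprocal a (rot (param a v)) (transl (param a v)) u (param_w v)"
    using reciprocal_position[OF rotation_orthogonal[OF R] G] assms(4)
    unfolding param_def rot_config_of transl_config_of param_pitch_def by blast
  have "param_w v \<noteq> 0" by (auto simp: param_w_def vec_eq_iff forall_3)
  then have "det (Jac a (rot (param a v)) (transl (param a v))) = 0"
    using ex unfolding singular_iff by blast
  then show "param a v \<in> Sing a" using R by (simp add: Sing_iff param_def)
qed

lemma coords_param:
  assumes "det (frame a) \<noteq> 0" "cayley_den (param_q v) \<noteq> 0"
    "quad_g a (param_rot v) (param_w v) \<noteq> 0" "param_pitch a v \<noteq> 0" and good: "param a v \<in> good_configs a"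
  shows "coords a (param a v) = v"
proof -
  obtain u where u: "reciprocal a (rot (param a v)) (transl (param a v)) u (param_w v)"
    using reciprocal_param(1)[OF assms(1-4)] by blast
  define k where "k = join6 u (param_w v)"
  have "Jac a (rot (param a v)) (transl (param a v)) *v k = 0"
    using u by (simp add: Jac_kernel k_def)
  moreover have k: "k $ 4 = v $ 4" "k $ 5 = v $ 5" "k $ 6 = 1" by (simp_all add: k_def param_w_def)
  ultimately have "coords a (param a v) $ 4 = v $ 4" "coords a (param a v) $ 5 = v $ 5"
    using coords_direction[OF good, of k] by simp_all
  moreover have "cayley_coords (rot (param a v)) = param_q v"
    by (simp add: param_def param_rot_def cayley_coords_cayley[OF assms(2)])
  then have "coords a (param a v) $ 1 = v $ 1" "coords a (param a v) $ 2 = v $ 2" "coords a (param a v) $ 3 = v $ 3"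
    by (simp_all add: coords_def Let_def param_q_def)
  ultimately show ?thesis by (simp add: vec_eq_iff forall_5)
qed

lemma regular_coords: "regular_map_on (good_configs a) (coords a)"
  unfolding regular_map_on_def
proof
  fix n :: 5
  have quot: "regular_function_on (good_configs a) (\<lambda>X. p X / (1 + trace (rot X)))" if "poly_over_reals p" for p
    unfolding regular_function_on_def
  proof
    fix X assume "X \<in> good_configs a"
    then show "\<exists>p' q. poly_over_reals p' \<and> poly_over_reals q \<and> q X \<noteq> 0 \<and>
        (\<forall>Y\<in>good_configs a. q Y \<noteq> 0 \<longrightarrow> p Y / (1 + trace (rot Y)) = p' Y / q Y)"
      using that poly_trace good_configsD(3) by blast
  qed
  have dir: "regular_function_on (good_configs a) (\<lambda>X. coords a X $ n)"
    if "\<And>X k. X \<in> good_configs a \<Longrightarrow> Jac a (rot X) (transl X) *v k = 0 \<Longrightarrow> k $ 6 \<noteq> 0 \<Longrightarrow> coords a X $ n = k $ m / k $ 6" for n m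
    unfolding regular_function_on_def
  proof
    fix X assume X: "X \<in> good_configs a"
    \<comment> \<open>The row chosen at \<open>X\<close> also serves for every \<open>Y\<close> at
      which its last cofactor is nonzero, even if the definition of \<open>coords\<close> selects
      another row there.\<close>
    define i where "i = (SOME i. good a i X \<noteq> 0)"
    have "kernel_vec a X i $ 6 \<noteq> 0" using good_configsD(4)[OF X] by (auto simp: good_def i_def)
    moreover have "\<forall>Y\<in>good_configs a. kernel_vec a Y i $ 6 \<noteq> 0 \<longrightarrow> coords a Y $ n = kernel_vec a Y i $ m / kernel_vec a Y i $ 6"
      using that Jac_kernel_vec good_configsD(1) by blast
    ultimately show "\<exists>p q. poly_over_reals p \<and> poly_over_reals q \<and> q X \<noteq> 0 \<and>
        (\<forall>Y\<in>good_configs a. q Y \<noteq> 0 \<longrightarrow> coords a Y $ n = p Y / q Y)"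
      using poly_kernel_vec by blast
  qed
  consider "n = 1" | "n = 2" | "n = 3" | "n = 4" | "n = 5" using exhaust_5[of n] by blast
  then show "regular_function_on (good_configs a) (\<lambda>X. coords a X $ n)"
  proof cases
    case 1
    have "poly_over_reals (\<lambda>X. rot X $ 3 $ 2 - rot X $ 2 $ 3)" by (intro poly.diff_mem poly_config)
    then show ?thesis using quot by (simp add: 1 coords_def Let_def cayley_coords_def)
  next
    case 2
    have "poly_over_reals (\<lambda>X. rot X $ 1 $ 3 - rot X $ 3 $ 1)" by (intro poly.diff_mem poly_config)
    then show ?thesis using quot by (simp add: 2 coords_def Let_def cayley_coords_def)
  next
    case 3
    have "poly_over_reals (\<lambda>X. rot X $ 2 $ 1 - rot X $ 1 $ 2)" by (intro poly.diff_mem poly_config)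
    then show ?thesis using quot by (simp add: 3 coords_def Let_def cayley_coords_def)
  next
    case 4
    show ?thesis unfolding 4 by (rule dir[of 4 4]) (rule coords_direction(1))
  next
    case 5
    show ?thesis unfolding 5 by (rule dir[of 5 5]) (rule coords_direction(2))
  qed
qed

lemma (in generic_architecture) birational_Sing: "birational_over_reals (Sing a) (UNIV :: (complex^5) set)"
proof -
  note G = nondegenerate_det_frame[OF nondeg]
  obtain s where s: "poly_over_reals s" "\<And>n. frac_poly s (\<lambda>v. param a v $ n)"
    "\<And>v. s v \<noteq> 0 \<longleftrightarrow> cayley_den (param_q v) \<noteq> 0 \<and> quad_g a (param_rot v) (param_w v) \<noteq> 0 \<and> param_pitch a v \<noteq> 0"
    using param_denominator[of a] by blast
  interpret A: real_function_algebra "{f. frac_poly s f}"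
    by (rule real_function_algebra_frac_poly[OF s(1)])
  have "(\<lambda>v. good a i (param a v)) \<in> {f. frac_poly s f}" for i
    by (rule A.poly_compose_mem[OF poly_good]) (simp add: s(2))
  then have "\<forall>i. \<exists>h. poly_over_reals h \<and> (\<forall>v. s v \<noteq> 0 \<longrightarrow> (h v = 0 \<longleftrightarrow> good a i (param a v) = 0))"
    by (simp add: frac_poly_numerator)
  from choice[OF this] obtain h where h: "\<And>i. poly_over_reals (h i)"
    "\<And>i v. s v \<noteq> 0 \<Longrightarrow> h i v = 0 \<longleftrightarrow> good a i (param a v) = 0" by blast
  define V where "V = {v. \<exists>i. s v * h i v \<noteq> 0}"
  have V_iff: "v \<in> V \<longleftrightarrow> s v \<noteq> 0 \<and> param a v \<in> good_configs a" for v
  proof -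
    have "v \<in> V \<longleftrightarrow> s v \<noteq> 0 \<and> (\<exists>i. good a i (param a v) \<noteq> 0)" using h(2) by (auto simp: V_def)
    also have "\<dots> \<longleftrightarrow> s v \<noteq> 0 \<and> param a v \<in> good_configs a"
      using reciprocal_param(2)[OF G] s(3) by (auto simp: good_configs_def)
    finally show ?thesis .
  qed
  have coordsV: "coords a X \<in> V" if "X \<in> good_configs a" for X
    using param_coords[OF G that] s(3) that by (simp add: V_iff)
  have sh: "poly_over_reals (\<lambda>v. s v * h i v)" for i by (intro poly.mult_mem s(1) h(1))
  show ?thesis
    unfolding birational_over_reals_def
  proof (intro exI conjI)
    have "good_configs a = Sing a - {X. \<forall>f\<in>range (good a). f X = 0}" by (auto simp: good_configs_def)
    moreover have "zariski_closed {X. \<forall>f\<in>range (good a). f X = 0}"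
      unfolding zariski_closed_def by (intro exI[of _ "range (good a)"]) (auto simp: poly_good)
    ultimately show "zariski_open_in (Sing a) (good_configs a)" unfolding zariski_open_in_def by blast
    show "zariski_dense_in (Sing a) (good_configs a)" by (rule good_configs_dense)
    have "V = UNIV - {v. \<forall>f\<in>range (\<lambda>i v. s v * h i v). f v = 0}" by (auto simp: V_def)
    moreover have "zariski_closed {v. \<forall>f\<in>range (\<lambda>i v. s v * h i v). f v = 0}"
      unfolding zariski_closed_def by (intro exI[of _ "range (\<lambda>i v. s v * h i v)"]) (auto simp: sh)
    ultimately show "zariski_open_in UNIV V" unfolding zariski_open_in_def by blast
    show "zariski_dense_in UNIV V"
      unfolding zariski_dense_in_def
    proof (intro conjI allI impI subset_UNIV)
      fix Z :: "(complex^5) set" assume Z: "zariski_closed Z \<and> V \<subseteq> Z"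
      then obtain F where F: "\<And>f. f \<in> F \<Longrightarrow> poly_over_reals f" "Z = {x. \<forall>f\<in>F. f x = 0}"
        unfolding zariski_closed_def by blast
      \<comment> \<open>A singular configuration for every architecture: the first joint centers
        coincide, so the first limb and with it the first row of the Jacobian are zero. By the
        density results good configurations exist, and \<open>V\<close> is nonempty.\<close>
      have "config_of (mat 1) (base_pt a 1 - plat_pt a 1) \<in> Sing a"
      proof -
        have "Jac a (mat 1) (base_pt a 1 - plat_pt a 1) $ 1 = 0"
          by (simp add: Jac_row limb_def join6_eq_0_iff vec_eq_iff[where 'b = 3] forall_3)
        then have "det (Jac a (mat 1) (base_pt a 1 - plat_pt a 1)) = 0"
          by (intro det_zero_row(2)[of 1]) (simp add: row_def vec_eq_iff)
        then show ?thesis by (simp add: Sing_iff rotation_def orthogonal_matrix_def)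
      qed
      then have "Sing a \<noteq> {}" by blast
      then have "good_configs a \<noteq> {}"
        using near_cayley_chart[of _ 1] near_tame[of _ 1] near_good[of _ 1] by (metis all_not_in_conv zero_less_one)
      then obtain X where "X \<in> good_configs a" by blast
      from coordsV[OF this] obtain y i where y: "s y * h i y \<noteq> 0" unfolding V_def by blast
      \<comment> \<open>Nonempty and open suffices for density in affine space: a polynomial
        vanishing on \<open>V\<close> but not everywhere would give a vanishing product of two
        nonzero polynomials.\<close>
      have "f x = 0" if f: "f \<in> F" for f x
      proof (rule ccontr)
        assume "f x \<noteq> 0"
        then obtain z where "f z * (s z * h i z) \<noteq> 0"
          using poly_over_reals_mult_nonzero[OF F(1)[OF f] sh _ y] by blast
        then have "z \<in> V" "f z \<noteq> 0" by (auto simp: V_def)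
        then show False using Z F(2) f by blast
      qed
      then show "UNIV \<subseteq> Z" using F(2) by blast
    qed
    show "isomorphic_over_reals (good_configs a) V"
      unfolding isomorphic_over_reals_def
    proof (intro exI conjI ballI)
      show "regular_map_on (good_configs a) (coords a)" by (rule regular_coords)
      show "regular_map_on V (param a)"
        unfolding regular_map_on_def
        by (intro allI frac_poly_regular[OF s(2,1)]) (simp add: V_iff)
      show "coords a ` good_configs a \<subseteq> V" using coordsV by blast
      show "param a ` V \<subseteq> good_configs a" using V_iff by blast
      show "param a (coords a X) = X" if "X \<in> good_configs a" for X by (rule param_coords(1)[OF G that])
      show "coords a (param a v) = v" if "v \<in> V" for v
        using that coords_param[OF G] s(3) V_iff by blast
    qed
  qed
qed

theorem theorem10:
  shows "\<exists>W :: architecture set. zariski_open_architectures W \<and> W \<noteq> {} \<and>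
    (\<forall>a\<in>W. birational_over_reals (Sing a) (UNIV :: (complex^5) set))"
  using exists_generic generic_architecture.birational_Sing by metis

end
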